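(* Let $a\in L^\infty(\mathbb R^n,\mathbb R^n)$ with $\operatorname{div} a=0$ in $\mathcal D'(\mathbb R^n)$, and let $A$ be the closure in $L^2=L^2(\mathbb R^n)$ of the operator $A_0u=a\cdot\nabla u$, $D(A_0)=C_0^1(\mathbb R^n)$. A contraction $C_0$-semigroup $(T_t)_{t\ge0}$ on $L^2$ which provides generalized solutions (that is, such that for every $u_0\in L^2$ the function $u(t,x)=(T_tu_0)(x)$ is a generalized solution of the Cauchy problem $u_t+\operatorname{div}_x(a(x)u)=0$, $u(0,x)=u_0(x)$) is unique if and only if $A$ is a maximal skew-symmetric operator.
   Context: $\Pi=(0,+\infty)\times\mathbb R^n$, $\bar\Pi=[0,+\infty)\times\mathbb R^n$. $L^2(\mathbb R^n)$ is the real Hilbert space; $C_0^k$ denotes compactly supported $C^k$ functions (functions in $C_0^\infty(\bar\Pi)$ need not vanish at $t=0$). A function $u\in L^1_{loc}(\bar\Pi)$ is a generalized solution of the Cauchy problem with data $u_0\in L^1_{loc}(\mathbb R^n)$ if for all $f\in C_0^\infty(\bar\Pi)$ $$\int_\Pi [u f_t+u\,a\cdot\nabla_x f]\,dt\,dx+\int_{\mathbb R^n}u_0(x)f(0,x)\,dx=0.$$ A densely defined operator $S$ is skew-symmetric if $S\subset -S^*$; it is maximal skew-symmetric if it has no proper skew-symmetric extension. $A_0$ is skew-symmetric because $\operatorname{div}a=0$, so $A$ is a closed skew-symmetric operator. A contraction semigroup is one with $\|T_tu\|_2\le\|u\|_2$ for all $u\in L^2$, $t\ge 0$. *)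

theory Defs
  imports "HOL-Analysis.Analysis"
begin

section \<open>The real Hilbert space of square-integrable functions\<close>

definition square_integrable :: "('a::euclidean_space \<Rightarrow> real) \<Rightarrow> bool" where
  "square_integrable f \<longleftrightarrow>
     f \<in> borel_measurable lebesgue \<and> integrable lebesgue (\<lambda>x. (f x)\<^sup>2)"

definition L2_eq :: "('a::euclidean_space \<Rightarrow> real) \<Rightarrow> ('a \<Rightarrow> real) \<Rightarrow> bool" where
  "L2_eq f g \<longleftrightarrow>
     square_integrable f \<and> square_integrable g \<and> (AE x in lebesgue. f x = g x)"

lemma square_integrable_mult:
  assumes "square_integrable f" "square_integrable g"
  shows "integrable lebesgue (\<lambda>x. f x * g x)"
proof (rule Bochner_Integration.integrable_bound)
  show "integrable lebesgue (\<lambda>x. (f x)\<^sup>2 + (g x)\<^sup>2)"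
    using assms by (auto simp: square_integrable_def)
  show "(\<lambda>x. f x * g x) \<in> borel_measurable lebesgue"
    using assms by (auto simp: square_integrable_def)
  have "\<bar>s * t\<bar> \<le> s\<^sup>2 + t\<^sup>2" for s t :: real
  proof -
    have "2 * (\<bar>s\<bar> * \<bar>t\<bar>) \<le> s\<^sup>2 + t\<^sup>2"
      using sum_squares_bound[of "\<bar>s\<bar>" "\<bar>t\<bar>"] by (simp add: mult.assoc)
    moreover have "0 \<le> \<bar>s\<bar> * \<bar>t\<bar>" by simp
    ultimately show ?thesis unfolding abs_mult by linarith
  qed
  then show "AE x in lebesgue. norm (f x * g x) \<le> norm ((f x)\<^sup>2 + (g x)\<^sup>2)"
    by auto
qed

lemma square_integrable_add:
  assumes "square_integrable f" "square_integrable g"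
  shows "square_integrable (\<lambda>x. f x + g x)"
  using assms square_integrable_mult[OF assms]
  by (auto simp: square_integrable_def power2_sum mult.assoc)

lemma square_integrable_scale:
  assumes "square_integrable f"
  shows "square_integrable (\<lambda>x. c * f x)"
  using assms by (auto simp: square_integrable_def power_mult_distrib)

lemma square_integrable_zero: "square_integrable (\<lambda>x. 0)"
  by (simp add: square_integrable_def)

lemma square_integrable_uminus:
  "square_integrable f \<Longrightarrow> square_integrable (\<lambda>x. - f x)"
  using square_integrable_scale[of f "-1"] by simp

lemma square_integrable_diff:
  "square_integrable f \<Longrightarrow> square_integrable g \<Longrightarrow> square_integrable (\<lambda>x. f x - g x)"
  using square_integrable_add[of f "\<lambda>x. - g x"] square_integrable_uminus[of g] by simp

quotient_type (overloaded) 'a L2 = "'a::euclidean_space \<Rightarrow> real" / partial: L2_eq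
  morphisms rep_L2 abs_L2
proof (rule part_equivpI)
  show "\<exists>f. L2_eq f (f :: 'a \<Rightarrow> real)"
    using square_integrable_zero by (auto simp: L2_eq_def)
  show "symp (L2_eq :: ('a \<Rightarrow> real) \<Rightarrow> _)"
    by (rule sympI) (auto simp: L2_eq_def elim: eventually_mono)
  show "transp (L2_eq :: ('a \<Rightarrow> real) \<Rightarrow> _)"
  proof (rule transpI)
    fix f g h :: "'a \<Rightarrow> real"
    assume fg: "L2_eq f g" and gh: "L2_eq g h"
    from fg have "AE x in lebesgue. f x = g x" by (simp add: L2_eq_def)
    moreover from gh have "AE x in lebesgue. g x = h x" by (simp add: L2_eq_def)
    ultimately have "AE x in lebesgue. f x = h x" by eventually_elim simp
    with fg gh show "L2_eq f h" by (simp add: L2_eq_def)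
  qed
qed

instantiation L2 :: (euclidean_space) real_inner
begin

lift_definition zero_L2 :: "'a L2" is "\<lambda>x. 0"
  by (simp add: L2_eq_def square_integrable_zero)

lift_definition plus_L2 :: "'a L2 \<Rightarrow> 'a L2 \<Rightarrow> 'a L2" is "\<lambda>f g x. f x + g x"
  unfolding L2_eq_def
  by (intro conjI) (auto intro: square_integrable_add)

lift_definition minus_L2 :: "'a L2 \<Rightarrow> 'a L2 \<Rightarrow> 'a L2" is "\<lambda>f g x. f x - g x"
  unfolding L2_eq_def
  by (intro conjI) (auto intro: square_integrable_diff)

lift_definition uminus_L2 :: "'a L2 \<Rightarrow> 'a L2" is "\<lambda>f x. - f x"
  unfolding L2_eq_def
  by (intro conjI) (auto intro: square_integrable_uminus)

lift_definition scaleR_L2 :: "real \<Rightarrow> 'a L2 \<Rightarrow> 'a L2" is "\<lambda>c f x. c * f x"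
  unfolding L2_eq_def
  by (intro conjI) (auto intro: square_integrable_scale)

lift_definition inner_L2 :: "'a L2 \<Rightarrow> 'a L2 \<Rightarrow> real"
  is "\<lambda>f g. LINT x|lebesgue. f x * g x"
proof -
  fix f1 f2 g1 g2 :: "'a \<Rightarrow> real"
  assume f: "L2_eq f1 f2" and g: "L2_eq g1 g2"
  from f have "AE x in lebesgue. f1 x = f2 x" by (simp add: L2_eq_def)
  moreover from g have "AE x in lebesgue. g1 x = g2 x" by (simp add: L2_eq_def)
  ultimately have "AE x in lebesgue. f1 x * g1 x = f2 x * g2 x" by eventually_elim simp
  with f g show "(LINT x|lebesgue. f1 x * g1 x) = (LINT x|lebesgue. f2 x * g2 x)"
    by (intro integral_cong_AE)
      (auto simp: L2_eq_def intro!: borel_measurable_integrable square_integrable_mult)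
qed

definition norm_L2 :: "'a L2 \<Rightarrow> real" where
  "norm_L2 u = sqrt (inner u u)"

definition sgn_L2 :: "'a L2 \<Rightarrow> 'a L2" where
  "sgn_L2 u = scaleR (inverse (norm u)) u"

definition dist_L2 :: "'a L2 \<Rightarrow> 'a L2 \<Rightarrow> real" where
  "dist_L2 u v = norm (u - v)"

definition uniformity_L2 :: "('a L2 \<times> 'a L2) filter" where
  "uniformity_L2 = (INF e\<in>{0<..}. principal {(u, v). dist u v < e})"

definition open_L2 :: "'a L2 set \<Rightarrow> bool" where
  "open_L2 U \<longleftrightarrow> (\<forall>u\<in>U. eventually (\<lambda>(u', v). u' = u \<longrightarrow> v \<in> U) uniformity)"

instance
proof
  fix u v w :: "'a L2" and r s :: real and U :: "'a L2 set"
  show "u + v + w = u + (v + w)"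
    by transfer (auto simp: L2_eq_def add.assoc intro!: square_integrable_add)
  show "u + v = v + u"
    by transfer (auto simp: L2_eq_def add.commute intro!: square_integrable_add)
  show "0 + u = u"
    by transfer (auto simp: L2_eq_def)
  show "- u + u = 0"
    by transfer (auto simp: L2_eq_def square_integrable_zero)
  show "u - v = u + - v"
    by transfer (auto simp: L2_eq_def intro!: square_integrable_diff)
  show "r *\<^sub>R (u + v) = r *\<^sub>R u + r *\<^sub>R v"
    by transfer (auto simp: L2_eq_def distrib_left
        intro!: square_integrable_add square_integrable_scale)
  show "(r + s) *\<^sub>R u = r *\<^sub>R u + s *\<^sub>R u"
    by transfer (auto simp: L2_eq_def distrib_right
        intro!: square_integrable_add square_integrable_scale)
  show "r *\<^sub>R s *\<^sub>R u = (r * s) *\<^sub>R u"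
    by transfer (auto simp: L2_eq_def mult.assoc simp flip: mult.assoc
        intro!: square_integrable_scale)
  show "1 *\<^sub>R u = u"
    by transfer (auto simp: L2_eq_def)
  show "dist u v = norm (u - v)" by (rule dist_L2_def)
  show "sgn u = scaleR (inverse (norm u)) u" by (simp add: sgn_L2_def)
  show "uniformity = (INF e\<in>{0<..}. principal {(x, y). dist (x::'a L2) y < e})"
    by (rule uniformity_L2_def)
  show "open U \<longleftrightarrow> (\<forall>x\<in>U. eventually (\<lambda>(x', y). x' = x \<longrightarrow> y \<in> U) uniformity)"
    by (rule open_L2_def)
  show "inner u v = inner v u"
    by transfer (simp add: mult.commute)
  show "inner (u + v) w = inner u w + inner v w"
    by transfer (simp add: L2_eq_def distrib_right square_integrable_mult)
  show "inner (r *\<^sub>R u) v = r * inner u v"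
    by transfer (simp add: mult.assoc)
  show "0 \<le> inner u u"
    by transfer simp
  show "inner u u = 0 \<longleftrightarrow> u = 0"
  proof transfer
    fix f :: "'a \<Rightarrow> real" assume "L2_eq f f"
    then have f: "square_integrable f" by (simp add: L2_eq_def)
    show "(LINT x|lebesgue. f x * f x) = 0 \<longleftrightarrow> L2_eq f (\<lambda>x. 0)"
      using integral_nonneg_eq_0_iff_AE[OF square_integrable_mult[OF f f]] f
      by (simp add: L2_eq_def square_integrable_zero)
  qed
  show "norm u = sqrt (inner u u)" by (rule norm_L2_def)
qed

end


section \<open>Unbounded operators\<close>

text \<open>An unbounded operator is represented by its graph, so that inclusion of sets is
  extension of operators, and the closure of an operator is the topological closure.\<close>

type_synonym 'h op_graph = "('h \<times> 'h) set"

definition linear_operator :: "'h::real_inner op_graph \<Rightarrow> bool" where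
  "linear_operator S \<longleftrightarrow> subspace S \<and> single_valued S"

definition densely_defined :: "'h::real_inner op_graph \<Rightarrow> bool" where
  "densely_defined S \<longleftrightarrow> closure (Domain S) = UNIV"

definition adjoint_operator :: "'h::real_inner op_graph \<Rightarrow> 'h op_graph" where
  "adjoint_operator S = {(v, w). \<forall>(u, Su) \<in> S. inner Su v = inner u w}"

definition neg_operator :: "'h::real_inner op_graph \<Rightarrow> 'h op_graph" where
  "neg_operator S = {(u, - Su) | u Su. (u, Su) \<in> S}"

definition skew_symmetric :: "'h::real_inner op_graph \<Rightarrow> bool" where
  "skew_symmetric S \<longleftrightarrow>
     linear_operator S \<and> densely_defined S \<and> S \<subseteq> neg_operator (adjoint_operator S)"

definition maximal_skew_symmetric :: "'h::real_inner op_graph \<Rightarrow> bool" where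
  "maximal_skew_symmetric S \<longleftrightarrow>
     skew_symmetric S \<and> \<not> (\<exists>S'. skew_symmetric S' \<and> S \<subset> S')"


section \<open>Contraction semigroups\<close>

text \<open>The time parameter is a real number; only the values at nonnegative times matter.\<close>

definition C0_semigroup :: "(real \<Rightarrow> 'h::real_normed_vector \<Rightarrow> 'h) \<Rightarrow> bool" where
  "C0_semigroup T \<longleftrightarrow>
     (\<forall>t\<ge>0. bounded_linear (T t)) \<and>
     (\<forall>u. T 0 u = u) \<and>
     (\<forall>s\<ge>0. \<forall>t\<ge>0. \<forall>u. T (s + t) u = T s (T t u)) \<and>
     (\<forall>u. ((\<lambda>t. T t u) \<longlongrightarrow> u) (at_right 0))"

definition contraction_semigroup :: "(real \<Rightarrow> 'h::real_normed_vector \<Rightarrow> 'h) \<Rightarrow> bool" where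
  "contraction_semigroup T \<longleftrightarrow> C0_semigroup T \<and> (\<forall>t\<ge>0. \<forall>u. norm (T t u) \<le> norm u)"


section \<open>Test functions and the transport operator\<close>

primrec C_k :: "nat \<Rightarrow> ('a::euclidean_space \<Rightarrow> real) \<Rightarrow> bool" where
  "C_k 0 f \<longleftrightarrow> continuous_on UNIV f"
| "C_k (Suc k) f \<longleftrightarrow> (\<forall>x. f differentiable (at x)) \<and>
     (\<forall>b\<in>Basis. C_k k (\<lambda>x. frechet_derivative f (at x) b))"

definition compact_support :: "('a::euclidean_space \<Rightarrow> real) \<Rightarrow> bool" where
  "compact_support f \<longleftrightarrow> compact (closure {x. f x \<noteq> 0})"

definition C0_1 :: "('a::euclidean_space \<Rightarrow> real) set" where
  "C0_1 = {f. C_k 1 f \<and> compact_support f}"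

definition C0_inf :: "('a::euclidean_space \<Rightarrow> real) set" where
  "C0_inf = {f. (\<forall>k. C_k k f) \<and> compact_support f}"

definition grad :: "('a::euclidean_space \<Rightarrow> real) \<Rightarrow> 'a \<Rightarrow> 'a" where
  "grad f x = (\<Sum>b\<in>Basis. frechet_derivative f (at x) b *\<^sub>R b)"

definition L_inf :: "('a::euclidean_space \<Rightarrow> 'a) \<Rightarrow> bool" where
  "L_inf a \<longleftrightarrow> a \<in> borel_measurable lebesgue \<and> (\<exists>C. AE x in lebesgue. norm (a x) \<le> C)"

text \<open>As a distribution, \<open>div a\<close> pairs with \<open>\<phi>\<close> to minus the integral below.\<close>

definition div_free :: "('a::euclidean_space \<Rightarrow> 'a) \<Rightarrow> bool" where
  "div_free a \<longleftrightarrow> (\<forall>\<phi>\<in>C0_inf. (LINT x|lebesgue. a x \<bullet> grad \<phi> x) = 0)"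

definition A0 :: "('a::euclidean_space \<Rightarrow> 'a) \<Rightarrow> 'a L2 op_graph" where
  "A0 a = {(abs_L2 u, abs_L2 (\<lambda>x. a x \<bullet> grad u x)) | u. u \<in> C0_1}"

definition A_op :: "('a::euclidean_space \<Rightarrow> 'a) \<Rightarrow> 'a L2 op_graph" where
  "A_op a = closure (A0 a)"


section \<open>Generalized solutions of the Cauchy problem\<close>

definition L1_loc :: "'a::euclidean_space set \<Rightarrow> ('a \<Rightarrow> real) \<Rightarrow> bool" where
  "L1_loc X u \<longleftrightarrow> (\<forall>K. compact K \<and> K \<subseteq> X \<longrightarrow> u absolutely_integrable_on K)"

text \<open>A test function on the closed half-space is the restriction of a smooth compactly
  supported function on the whole space-time, here \<open>f\<close>; only the values
  of \<open>f\<close> for \<open>t \<ge> 0\<close> enter below.\<close>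

definition generalized_solution ::
  "('a::euclidean_space \<Rightarrow> 'a) \<Rightarrow> ('a \<Rightarrow> real) \<Rightarrow> (real \<times> 'a \<Rightarrow> real) \<Rightarrow> bool" where
  "generalized_solution a u0 u \<longleftrightarrow>
     L1_loc ({0..} \<times> UNIV) u \<and> L1_loc UNIV u0 \<and>
     (\<forall>f\<in>C0_inf.
        (LINT p:{0<..} \<times> UNIV|lebesgue.
            (case p of (t, x) \<Rightarrow>
               u (t, x) * deriv (\<lambda>s. f (s, x)) t
             + u (t, x) * (a x \<bullet> grad (\<lambda>y. f (t, y)) x)))
        + (LINT x|lebesgue. u0 x * f (0, x)) = 0)"

text \<open>The elements \<open>T t u0\<close> are classes modulo null sets, so \<open>u(t,x) = (T t u0)(x)\<close> means
  that \<open>u\<close> is a function on space-time whose time slices represent them.\<close>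

definition provides_generalized_solutions ::
  "('a::euclidean_space \<Rightarrow> 'a) \<Rightarrow> (real \<Rightarrow> 'a L2 \<Rightarrow> 'a L2) \<Rightarrow> bool" where
  "provides_generalized_solutions a T \<longleftrightarrow>
     (\<forall>u0. \<exists>u. (\<forall>t\<ge>0. AE x in lebesgue. u (t, x) = rep_L2 (T t u0) x) \<and>
               generalized_solution a (rep_L2 u0) u)"

end

theory Submission
  imports Defs
begin

text \<open>
  A contraction semigroup \<open>T\<close> provides generalized solutions exactly when it solves
  \<open>u\<^sub>t = A\<^sup>* u\<close> weakly, that is, when \<open>T t u \<bullet> f\<close> has the time derivative \<open>T t u \<bullet> A f\<close> for
  every \<open>f\<close> in the domain of \<open>A\<close> (lemma \<open>provides_iff_weak_evolution\<close>). In one direction the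
  space-time identity is tested with products \<open>\<theta>(t) \<phi>(x)\<close>, where \<open>\<theta>\<close> approximates the
  indicator function of a time interval, and mollification passes from smooth \<open>\<phi>\<close> to the domain
  of \<open>A\<close>. In the other direction the identity is the fundamental theorem of calculus for
  \<open>T t u \<bullet> f(t, \<cdot>)\<close>, once the orbit \<open>T t u\<close> has been given a jointly measurable version.

  What remains is a statement about a closed skew-symmetric operator \<open>A\<close> in a Hilbert space
  (theorem \<open>unique_weak_evolution_iff_maximal\<close>). The operators \<open>1 - A\<close> and \<open>1 + A\<close> have closed
  ranges. If \<open>A\<close> is maximal, one of the ranges is the whole space: otherwise nonzero vectors of
  equal norm orthogonal to either range would extend the Cayley transform, and with it \<open>A\<close>. So
  \<open>A\<close> or \<open>-A\<close> generates a contraction semigroup \<open>S\<close> by the Lumer-Phillips theorem. In the first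
  case duality gives \<open>T t u \<bullet> f = u \<bullet> S t f\<close>. In the second \<open>T t u \<bullet> S t u\<close> does not depend on
  \<open>t\<close> and equals \<open>|u|\<^sup>2\<close>, which forces \<open>T t u = S t u\<close> because both factors have norm at most
  \<open>|u|\<close>. In either case \<open>T\<close> is determined by \<open>A\<close>.

  If \<open>A\<close> has a proper skew-symmetric extension, each of the two operators, after closure, has an
  m-dissipative extension of its negative whose Cayley transform is zero on the orthogonal
  complement of the range of one plus the operator. The two extensions generate semigroups that solve the weak equation for \<open>A\<close>, and
  they differ because the second one conserves energy at vectors where the first one loses some.

  The Lumer-Phillips theorem is obtained from the implicit Euler scheme with dyadic steps: halving
  the step size changes one step by an error of second order, so the approximations converge on
  the domain of the square of the generator.
\<close>

section \<open>Orthogonal decomposition in a Hilbert space\<close>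

text \<open>A minimising sequence for the distance is Cauchy by the parallelogram law, so the
  distance is attained; the minimiser is the foot of the perpendicular.\<close>

lemma orthogonal_projection_exists:
  fixes M :: "'h::{real_inner,banach} set" and x :: 'h
  assumes M: "subspace M" "closed M"
  obtains m where "m \<in> M" and "\<And>y. y \<in> M \<Longrightarrow> (x - m) \<bullet> y = 0"
proof -
  define d where "d = infdist x M"
  have ne: "M \<noteq> {}" using M(1) subspace_0 by blast
  have d0: "0 \<le> d" by (simp add: d_def infdist_nonneg)
  have dle: "d \<le> norm (x - m)" if "m \<in> M" for m
    using infdist_le[OF that, of x] by (simp add: d_def dist_norm)
  have "\<exists>m\<in>M. norm (x - m) < d + e" if "e > 0" for e
  proof (rule ccontr)
    assume "\<not> ?thesis"
    then have "d + e \<le> infdist x M"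
      using ne by (auto simp: infdist_def dist_norm intro!: cINF_greatest)
    then show False using that by (simp add: d_def)
  qed
  then have "\<exists>m\<in>M. norm (x - m) < d + inverse (real (Suc k))" for k by simp
  then obtain m where mM: "\<And>k. m k \<in> M"
    and mk: "\<And>k. norm (x - m k) < d + inverse (real (Suc k))" by metis
  have par: "(norm (p - q))\<^sup>2 \<le> 8 * d * e + 4 * e\<^sup>2"
    if "p \<in> M" "q \<in> M" "norm (x - p) \<le> d + e" "norm (x - q) \<le> d + e" "0 \<le> e" for p q e
  proof -
    have "(1/2) *\<^sub>R (p + q) \<in> M"
      using M(1) that by (intro subspace_scale subspace_add)
    then have "d\<^sup>2 \<le> (norm (x - (1/2) *\<^sub>R (p + q)))\<^sup>2"
      using dle d0 by (intro power_mono) auto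
    moreover have "(norm (x - p))\<^sup>2 \<le> (d + e)\<^sup>2" "(norm (x - q))\<^sup>2 \<le> (d + e)\<^sup>2"
      using that by (auto intro!: power_mono)
    moreover have "(norm (p - q))\<^sup>2 =
        2 * (norm (x - p))\<^sup>2 + 2 * (norm (x - q))\<^sup>2 - 4 * (norm (x - (1/2) *\<^sub>R (p + q)))\<^sup>2"
      by (simp add: power2_norm_eq_inner inner_diff_left inner_diff_right inner_add_left
          inner_add_right inner_commute algebra_simps)
    ultimately have "(norm (p - q))\<^sup>2 \<le> 4 * (d + e)\<^sup>2 - 4 * d\<^sup>2" by linarith
    also have "\<dots> = 8 * d * e + 4 * e\<^sup>2" by (simp add: power2_eq_square algebra_simps)
    finally show ?thesis .
  qed
  have "Cauchy m"
  proof (rule metric_CauchyI)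
    fix \<epsilon> :: real assume "0 < \<epsilon>"
    have "(\<lambda>k. 8 * d * inverse (real (Suc k)) + 4 * (inverse (real (Suc k)))\<^sup>2)
        \<longlonglongrightarrow> 8 * d * 0 + 4 * 0\<^sup>2"
      by (intro tendsto_intros LIMSEQ_inverse_real_of_nat)
    then have "\<forall>\<^sub>F k in sequentially.
        8 * d * inverse (real (Suc k)) + 4 * (inverse (real (Suc k)))\<^sup>2 < \<epsilon>\<^sup>2"
      using \<open>0 < \<epsilon>\<close> by (intro order_tendstoD(2)) auto
    then obtain N where
      N: "8 * d * inverse (real (Suc N)) + 4 * (inverse (real (Suc N)))\<^sup>2 < \<epsilon>\<^sup>2"
      by (auto simp: eventually_sequentially)
    have near: "norm (x - m k) \<le> d + inverse (real (Suc N))" if "N \<le> k" for k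
      using mk[of k] le_imp_inverse_le[of "real (Suc N)" "real (Suc k)"] that by linarith
    have "dist (m i) (m j) < \<epsilon>" if "N \<le> i" "N \<le> j" for i j
    proof -
      have "(norm (m i - m j))\<^sup>2 < \<epsilon>\<^sup>2"
        using par[OF mM mM near near, of i j] that N by fastforce
      then show ?thesis using \<open>0 < \<epsilon>\<close> by (simp add: dist_norm power2_less_imp_less)
    qed
    then show "\<exists>N. \<forall>i\<ge>N. \<forall>j\<ge>N. dist (m i) (m j) < \<epsilon>" by blast
  qed
  then obtain p where p: "m \<longlonglongrightarrow> p"
    using Cauchy_convergent convergentD by blast
  have pM: "p \<in> M" using closed_sequentially[OF M(2)] mM p by blast
  have "norm (x - p) \<le> d + 0"
  proof (rule LIMSEQ_le)
    show "(\<lambda>k. norm (x - m k)) \<longlonglongrightarrow> norm (x - p)" by (intro tendsto_intros p)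
    show "(\<lambda>k. d + inverse (real (Suc k))) \<longlonglongrightarrow> d + 0"
      by (intro tendsto_intros LIMSEQ_inverse_real_of_nat)
    show "\<exists>N. \<forall>n\<ge>N. norm (x - m n) \<le> d + inverse (real (Suc n))" using mk less_imp_le by blast
  qed
  then have pd: "norm (x - p) \<le> d" by simp
  have "(x - p) \<bullet> y = 0" if y: "y \<in> M" for y
  proof -
    define c where "c = (x - p) \<bullet> y"
    have q: "2 * t * c \<le> t * t * (y \<bullet> y)" for t
    proof -
      have "p + t *\<^sub>R y \<in> M" using M(1) pM y by (intro subspace_add subspace_scale)
      then have "(norm (x - p))\<^sup>2 \<le> (norm (x - (p + t *\<^sub>R y)))\<^sup>2"
        using dle pd by (intro power_mono) (auto intro: order_trans)
      also have "\<dots> = (norm (x - p))\<^sup>2 - 2 * t * c + t * t * (y \<bullet> y)"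
        unfolding c_def
        by (simp add: power2_norm_eq_inner inner_diff_left inner_diff_right inner_add_left
            inner_add_right inner_commute algebra_simps)
      finally show ?thesis by simp
    qed
    \<comment> \<open>Testing with \<open>t = s c\<close>, the term linear in \<open>t\<close> dominates as long as \<open>s |y|\<^sup>2 < 2\<close>.\<close>
    define s where "s = inverse (1 + y \<bullet> y)"
    have "0 < 1 + y \<bullet> y" using inner_ge_zero[of y] by linarith
    then have s: "0 < s" "s * (y \<bullet> y) < 1" by (auto simp: s_def field_simps)
    have "2 * (s * c) * c \<le> (s * c) * (s * c) * (y \<bullet> y)" by (rule q)
    then have "c\<^sup>2 * (s * (2 - s * (y \<bullet> y))) \<le> 0"
      by (simp add: power2_eq_square algebra_simps)
    moreover have "0 < s * (2 - s * (y \<bullet> y))" using s by simp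
    ultimately have "c\<^sup>2 \<le> 0" by (metis mult_pos_pos not_le)
    then show ?thesis by (simp add: c_def)
  qed
  with pM that show ?thesis by blast
qed

lemma subspace_closure:
  fixes M :: "'h::real_normed_vector set"
  assumes "subspace M" shows "subspace (closure M)"
  unfolding subspace_def
proof (intro conjI ballI allI)
  show "0 \<in> closure M" using assms subspace_0 closure_subset by blast
next
  fix x y assume "x \<in> closure M" "y \<in> closure M"
  then obtain f g where "\<And>n. f n \<in> M" "f \<longlonglongrightarrow> x" "\<And>n. g n \<in> M" "g \<longlonglongrightarrow> y"
    unfolding closure_sequential by blast
  then show "x + y \<in> closure M"
    unfolding closure_sequential
    by (intro exI[of _ "\<lambda>n. f n + g n"] conjI allI subspace_add assms tendsto_add)
next
  fix c x assume "x \<in> closure M"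
  then obtain f where "\<And>n. f n \<in> M" "f \<longlonglongrightarrow> x"
    unfolding closure_sequential by blast
  then show "c *\<^sub>R x \<in> closure M"
    unfolding closure_sequential
    by (intro exI[of _ "\<lambda>n. c *\<^sub>R f n"] conjI allI subspace_scale assms tendsto_scaleR tendsto_const)
qed

lemma dense_if_orthogonal_complement_trivial:
  fixes M :: "'h::{real_inner,banach} set"
  assumes "subspace M" and triv: "\<And>z. (\<And>y. y \<in> M \<Longrightarrow> z \<bullet> y = 0) \<Longrightarrow> z = 0"
  shows "closure M = UNIV"
proof -
  have "x \<in> closure M" for x
  proof -
  obtain m where m: "m \<in> closure M" "\<And>y. y \<in> closure M \<Longrightarrow> (x - m) \<bullet> y = 0"
    using orthogonal_projection_exists subspace_closure[OF assms(1)] closed_closure by metis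
  then have "x - m = 0" using triv closure_subset by blast
    with m(1) show ?thesis by simp
  qed
  then show ?thesis by blast
qed

lemma orthogonal_to_dense_zero:
  fixes z :: "'h::real_inner"
  assumes "closure D = UNIV" and "\<And>y. y \<in> D \<Longrightarrow> z \<bullet> y = 0"
  shows "z = 0"
proof -
  have "z \<in> closure D" by (simp add: assms)
  then obtain f where f: "\<And>n. f n \<in> D" "f \<longlonglongrightarrow> z" unfolding closure_sequential by blast
  have "(\<lambda>n. z \<bullet> f n) \<longlonglongrightarrow> z \<bullet> z" by (intro tendsto_intros f)
  then have "z \<bullet> z = 0" using f(1) assms(2) by (simp add: LIMSEQ_const_iff)
  then show ?thesis by simp
qed

section \<open>Dissipative operators and the Lumer-Phillips theorem\<close>

definition dissipative :: "'h::real_inner op_graph \<Rightarrow> bool" where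
  "dissipative G \<longleftrightarrow> subspace G \<and> (\<forall>(u, w)\<in>G. w \<bullet> u \<le> 0)"

definition range_one_minus :: "real \<Rightarrow> 'h::real_inner op_graph \<Rightarrow> 'h set" where
  "range_one_minus h G = (\<lambda>(u, w). u - h *\<^sub>R w) ` G"

text \<open>Pairing \<open>u - h w\<close> with \<open>u\<close>: dissipativity makes the cross term nonnegative.\<close>

lemma dissipative_norm_le:
  assumes "dissipative G" "(u, w) \<in> G" "0 \<le> h"
  shows "norm u \<le> norm (u - h *\<^sub>R w)"
proof -
  have "w \<bullet> u \<le> 0" using assms by (auto simp: dissipative_def)
  then have "h * (w \<bullet> u) \<le> 0" using assms(3) by (simp add: mult_nonneg_nonpos)
  then have "(norm u)\<^sup>2 \<le> u \<bullet> (u - h *\<^sub>R w)"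
    by (simp add: power2_norm_eq_inner inner_diff_right inner_commute)
  also have "\<dots> \<le> norm u * norm (u - h *\<^sub>R w)" by (rule norm_cauchy_schwarz)
  finally show ?thesis by (cases "norm u = 0") (auto simp: power2_eq_square)
qed

lemma dissipative_diff:
  "dissipative G \<Longrightarrow> (u, w) \<in> G \<Longrightarrow> (u', w') \<in> G \<Longrightarrow> (u - u', w - w') \<in> G"
  unfolding dissipative_def using subspace_diff by force

lemma subspace_range_one_minus:
  assumes "subspace G" shows "subspace (range_one_minus h G)"
  unfolding range_one_minus_def
proof (rule linear_subspace_image[OF _ assms])
  show "linear (\<lambda>(u, w). u - h *\<^sub>R w)"
    by (rule linearI) (auto simp: algebra_simps)
qed

text \<open>Since \<open>1 - h G\<close> does not decrease norms, a convergent sequence of its values has a Cauchy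
  sequence of arguments, and the limit lies in the closed graph.\<close>

lemma closed_range_one_minus:
  fixes G :: "'h::{real_inner,banach} op_graph"
  assumes G: "dissipative G" "closed G" and h: "h > 0"
  shows "closed (range_one_minus h G)"
  unfolding closed_sequential_limits
proof (intro allI impI, elim conjE)
  fix v l assume vr: "\<forall>n. v n \<in> range_one_minus h G" and vl: "v \<longlonglongrightarrow> l"
  have "\<exists>u w. (u, w) \<in> G \<and> v n = u - h *\<^sub>R w" for n
    using vr by (fastforce simp: range_one_minus_def)
  then obtain u w where uw: "\<And>n. (u n, w n) \<in> G" "\<And>n. v n = u n - h *\<^sub>R w n" by metis
  have "Cauchy u"
  proof (rule metric_CauchyI)
    fix e :: real assume "e > 0"
    then obtain N where N: "\<And>i j. N \<le> i \<Longrightarrow> N \<le> j \<Longrightarrow> dist (v i) (v j) < e"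
      using LIMSEQ_imp_Cauchy[OF vl] unfolding Cauchy_def by meson
    have "dist (u i) (u j) \<le> dist (v i) (v j)" for i j
      using dissipative_norm_le[OF G(1) dissipative_diff[OF G(1) uw(1)[of i] uw(1)[of j]], of h] h
      by (simp add: dist_norm uw(2) algebra_simps)
    then show "\<exists>N. \<forall>i\<ge>N. \<forall>j\<ge>N. dist (u i) (u j) < e" using N by (meson le_less_trans)
  qed
  then obtain p where p: "u \<longlonglongrightarrow> p" using Cauchy_convergent convergentD by blast
  have "w = (\<lambda>n. (1/h) *\<^sub>R (u n - v n))" using uw(2) h by auto
  then have "w \<longlonglongrightarrow> (1/h) *\<^sub>R (p - l)" using p vl by (auto intro!: tendsto_intros)
  with p have "(\<lambda>n. (u n, w n)) \<longlonglongrightarrow> (p, (1/h) *\<^sub>R (p - l))" by (rule tendsto_Pair)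
  then have "(p, (1/h) *\<^sub>R (p - l)) \<in> G" using closed_sequentially[OF G(2), of "\<lambda>n. (u n, w n)"] uw(1) by simp
  then show "l \<in> range_one_minus h G"
    unfolding range_one_minus_def using h by (force intro: rev_image_eqI)
qed

locale m_dissipative =
  fixes G :: "'h::{real_inner,banach} op_graph"
  assumes diss: "dissipative G"
    and dense: "closure (Domain G) = UNIV"
    and range1: "range_one_minus 1 G = UNIV"
begin

lemma add_mem: "(u, w) \<in> G \<Longrightarrow> (u', w') \<in> G \<Longrightarrow> (u + u', w + w') \<in> G"
  using diss subspace_add unfolding dissipative_def by force

lemma scale_mem: "(u, w) \<in> G \<Longrightarrow> (c *\<^sub>R u, c *\<^sub>R w) \<in> G"
  using diss subspace_scale unfolding dissipative_def by force

lemma range1E: obtains u w where "(u, w) \<in> G" "u - w = v"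
proof -
  have "v \<in> range_one_minus 1 G" by (simp add: range1)
  then show ?thesis using that by (auto simp: range_one_minus_def)
qed

text \<open>The graph is closed because \<open>1 - G\<close> has an everywhere defined bounded inverse.\<close>

lemma closed_graph: "closed G"
  unfolding closed_sequential_limits
proof (intro allI impI, elim conjE)
  fix g l assume g: "\<forall>n. g n \<in> G" "g \<longlonglongrightarrow> l"
  obtain u w where l: "l = (u, w)" by fastforce
  have lim: "(\<lambda>n. fst (g n)) \<longlonglongrightarrow> u" "(\<lambda>n. snd (g n)) \<longlonglongrightarrow> w"
    using tendsto_fst[OF g(2)] tendsto_snd[OF g(2)] by (auto simp: l)
  obtain u' w' where u': "(u', w') \<in> G" "u' - w' = u - w" by (rule range1E)
  have "(\<lambda>n. fst (g n)) \<longlonglongrightarrow> u'"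
  proof (rule LIM_zero_cancel, rule tendsto_norm_zero_cancel, rule tendsto_sandwich)
    show "\<forall>\<^sub>F n in sequentially. 0 \<le> norm (fst (g n) - u')" by simp
    have "norm (fst (g n) - u') \<le> norm ((fst (g n) - snd (g n)) - (u - w))" for n
    proof -
      have "(fst (g n), snd (g n)) \<in> G" using g(1) by simp
      from dissipative_norm_le[OF diss dissipative_diff[OF diss this u'(1)], of 1]
      show ?thesis by (simp add: u'(2)[symmetric] algebra_simps)
    qed
    then show "\<forall>\<^sub>F n in sequentially.
        norm (fst (g n) - u') \<le> norm ((fst (g n) - snd (g n)) - (u - w))" by simp
    show "(\<lambda>n. norm ((fst (g n) - snd (g n)) - (u - w))) \<longlonglongrightarrow> 0"
      using tendsto_norm[OF tendsto_diff[OF tendsto_diff[OF lim] tendsto_const[of "u - w"]]]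
      by simp
  qed simp
  then have "u' = u" using lim(1) LIMSEQ_unique by blast
  with u' show "l \<in> G" by (simp add: l)
qed

text \<open>Let \<open>z\<close> be orthogonal to the range of \<open>1 - h G\<close> and write \<open>z = u - w\<close> with \<open>w = G u\<close>.
  Then \<open>0 = z \<bullet> (u - h w) = |u|\<^sup>2 - (1 + h) w \<bullet> u + h |w|\<^sup>2\<close>, and no term is negative.\<close>

lemma range_one_minus_UNIV:
  assumes h: "0 < h" shows "range_one_minus h G = UNIV"
proof -
  have sub: "subspace G" using diss by (simp add: dissipative_def)
  have "closure (range_one_minus h G) = UNIV"
  proof (rule dense_if_orthogonal_complement_trivial[OF subspace_range_one_minus[OF sub]])
    fix z assume orth: "\<And>y. y \<in> range_one_minus h G \<Longrightarrow> z \<bullet> y = 0"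
    obtain u w where uw: "(u, w) \<in> G" "u - w = z" by (rule range1E)
    have "u - h *\<^sub>R w \<in> range_one_minus h G"
      unfolding range_one_minus_def using uw(1) by force
    then have "(u - w) \<bullet> (u - h *\<^sub>R w) = 0" using orth uw(2) by simp
    then have "u \<bullet> u + h * (w \<bullet> w) = (1 + h) * (w \<bullet> u)"
      by (simp add: inner_diff_left inner_diff_right inner_commute algebra_simps)
    moreover have "(1 + h) * (w \<bullet> u) \<le> 0"
      using uw(1) diss h by (auto simp: dissipative_def intro!: mult_nonneg_nonpos)
    moreover have "0 \<le> h * (w \<bullet> w)" "0 \<le> u \<bullet> u" using h by auto
    ultimately have "u \<bullet> u = 0" "h * (w \<bullet> w) = 0" by linarith+
    with uw(2) h show "z = 0" by auto
  qed
  then show ?thesis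
    using closed_range_one_minus[OF diss closed_graph h] by simp
qed

text \<open>The implicit Euler step \<open>(1 - h G)\<^sup>-\<^sup>1\<close>.\<close>

definition J :: "real \<Rightarrow> 'h \<Rightarrow> 'h" where
  "J h v = (SOME u. \<exists>w. (u, w) \<in> G \<and> u - h *\<^sub>R w = v)"

context
  fixes h :: real
  assumes h: "0 < h"
begin

lemma J_ex: "\<exists>w. (J h v, w) \<in> G \<and> J h v - h *\<^sub>R w = v"
proof -
  have "v \<in> range_one_minus h G" using range_one_minus_UNIV[OF h] by simp
  then have "\<exists>u w. (u, w) \<in> G \<and> u - h *\<^sub>R w = v" by (force simp: range_one_minus_def)
  then show ?thesis unfolding J_def by (rule someI_ex)
qed

lemma J_mem: "(J h v, (1/h) *\<^sub>R (J h v - v)) \<in> G"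
proof -
  obtain w where w: "(J h v, w) \<in> G" "J h v - h *\<^sub>R w = v" using J_ex by blast
  then have "w = (1/h) *\<^sub>R (J h v - v)" using h by (simp add: algebra_simps)
  with w show ?thesis by simp
qed

lemma J_eqI:
  assumes "(u, w) \<in> G" shows "J h (u - h *\<^sub>R w) = u"
proof -
  obtain u' w' where u': "J h (u - h *\<^sub>R w) = u'"
    and w': "(u', w') \<in> G" "u' - h *\<^sub>R w' = u - h *\<^sub>R w" using J_ex by blast
  have "(u' - u) - h *\<^sub>R (w' - w) = (u' - h *\<^sub>R w') - (u - h *\<^sub>R w)"
    by (simp add: scaleR_diff_right)
  with dissipative_norm_le[OF diss dissipative_diff[OF diss w'(1) assms], of h] h
  have "norm (u' - u) \<le> 0" by (simp only: w'(2)) simp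
  then show ?thesis by (simp add: u')
qed

lemma J_norm: "norm (J h v) \<le> norm v"
proof -
  obtain w where w: "(J h v, w) \<in> G" "J h v - h *\<^sub>R w = v" using J_ex by blast
  with dissipative_norm_le[OF diss w(1), of h] h show ?thesis by (simp only: w(2) less_imp_le)
qed

lemma J_linear: "linear (J h)"
proof (rule linearI)
  fix u v :: 'h and c :: real
  obtain w where w: "(J h v, w) \<in> G" "J h v - h *\<^sub>R w = v" using J_ex by blast
  obtain w' where w': "(J h u, w') \<in> G" "J h u - h *\<^sub>R w' = u" using J_ex by blast
  have "J h ((J h u + J h v) - h *\<^sub>R (w' + w)) = J h u + J h v"
    by (rule J_eqI[OF add_mem[OF w'(1) w(1)]])
  moreover have "(J h u + J h v) - h *\<^sub>R (w' + w)
      = (J h u - h *\<^sub>R w') + (J h v - h *\<^sub>R w)"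
    by (simp add: scaleR_right_distrib)
  ultimately show "J h (u + v) = J h u + J h v" unfolding w(2) w'(2) by simp
  have "J h (c *\<^sub>R J h v - h *\<^sub>R c *\<^sub>R w) = c *\<^sub>R J h v"
    by (rule J_eqI[OF scale_mem[OF w(1)]])
  moreover have "c *\<^sub>R J h v - h *\<^sub>R c *\<^sub>R w = c *\<^sub>R (J h v - h *\<^sub>R w)"
    by (simp add: algebra_simps)
  ultimately show "J h (c *\<^sub>R v) = c *\<^sub>R J h v" using w(2) by simp
qed

lemma J_graph:
  assumes "(u, w) \<in> G" shows "J h u - u = h *\<^sub>R J h w" and "(J h u, J h w) \<in> G"
proof -
  have "J h u - h *\<^sub>R J h w = J h (u - h *\<^sub>R w)"
    by (simp only: linear_diff[OF J_linear] linear_scale[OF J_linear])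
  then have "J h u - h *\<^sub>R J h w = u" by (simp only: J_eqI[OF assms])
  then show eq: "J h u - u = h *\<^sub>R J h w" by (simp add: algebra_simps)
  show "(J h u, J h w) \<in> G" using J_mem[of u] h by (simp add: eq)
qed

lemma J_pow_norm: "norm ((J h ^^ m) v) \<le> norm v"
  by (induction m) (auto intro: order_trans[OF J_norm])

lemma J_pow_linear: "linear (J h ^^ m)"
proof (induction m)
  case 0 show ?case using linear_id by (simp add: id_def[abs_def])
next
  case (Suc m) show ?case using linear_compose[OF Suc J_linear] by (simp add: o_def)
qed

lemma J_pow_graph: "(u, w) \<in> G \<Longrightarrow> ((J h ^^ m) u, (J h ^^ m) w) \<in> G"
  by (induction m) (auto intro: J_graph)

lemma J_pow_step:
  assumes "(u, w) \<in> G" shows "norm ((J h ^^ m) u - u) \<le> real m * h * norm w"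
proof (induction m)
  case (Suc m)
  have "(J h ^^ Suc m) u - u = h *\<^sub>R J h ((J h ^^ m) w) + ((J h ^^ m) u - u)"
    using J_graph(1)[OF J_pow_graph[OF assms, of m]] by (simp add: algebra_simps)
  also have "norm \<dots> \<le> h * norm w + real m * h * norm w"
    using h Suc order_trans[OF J_norm J_pow_norm]
    by (intro norm_triangle_le add_mono) (auto intro!: mult_left_mono)
  finally show ?case by (simp add: algebra_simps)
qed simp

text \<open>A Taylor estimate that asks no more of \<open>u\<close> than to be in the domain: \<open>w = G u\<close> is
  replaced by a nearby \<open>w'\<close> of the domain wherever a bound on \<open>G w\<close> would be needed.\<close>

lemma J_pow_Taylor:
  assumes uw: "(u, w) \<in> G" and wz: "(w', z) \<in> G"
  shows "norm ((J h ^^ m) u - u - (real m * h) *\<^sub>R w)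
    \<le> real m * h * (2 * norm (w - w') + real m * h * norm z)"
proof (induction m)
  case (Suc m)
  let ?b = "2 * norm (w - w') + real (Suc m) * h * norm z"
  have "norm ((J h ^^ Suc m) w - w) \<le> ?b"
  proof -
    have "(J h ^^ Suc m) w - w
        = (J h ^^ Suc m) (w - w') + ((J h ^^ Suc m) w' - w') + (w' - w)"
      by (simp only: linear_diff[OF J_pow_linear]) simp
    also have "norm \<dots> \<le> norm (w - w') + real (Suc m) * h * norm z + norm (w' - w)"
      by (intro norm_triangle_le add_mono J_pow_norm J_pow_step wz order_refl)
    finally show ?thesis by (simp add: norm_minus_commute)
  qed
  then have 1: "norm (h *\<^sub>R ((J h ^^ Suc m) w - w)) \<le> h * ?b"
    using h by (simp del: funpow.simps)
  have "real m * h * norm z \<le> real (Suc m) * h * norm z"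
    using h by (intro mult_right_mono) auto
  then have "real m * h * (2 * norm (w - w') + real m * h * norm z) \<le> real m * h * ?b"
    using h by (intro mult_left_mono) auto
  then have 2: "norm ((J h ^^ m) u - u - (real m * h) *\<^sub>R w) \<le> real m * h * ?b"
    using Suc by linarith
  have "(J h ^^ Suc m) u = h *\<^sub>R (J h ^^ Suc m) w + (J h ^^ m) u"
    using J_graph(1)[OF J_pow_graph[OF uw, of m]] by (simp add: algebra_simps)
  then have "(J h ^^ Suc m) u - u - (real (Suc m) * h) *\<^sub>R w
      = h *\<^sub>R ((J h ^^ Suc m) w - w) + ((J h ^^ m) u - u - (real m * h) *\<^sub>R w)"
    by (simp add: algebra_simps)
  also have "norm \<dots> \<le> h * ?b + real m * h * ?b"
    by (intro norm_triangle_le add_mono 1 2)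
  finally show ?case by (simp add: algebra_simps)
qed simp

end

text \<open>Halving the step size: two steps of size \<open>h\<close> differ from one of size \<open>2 h\<close> in second order
  only, and contractions do not amplify the errors.\<close>

lemma J_halve:
  assumes h: "0 < h" and uw: "(u, w) \<in> G" and wz: "(w, z) \<in> G"
  shows "norm ((J h ^^ (2 * n)) u - (J (2 * h) ^^ n) u) \<le> real n * (8 * h\<^sup>2 * norm z)"
proof (induction n)
  case (Suc n)
  have h2: "0 < 2 * h" using h by simp
  define u' w' z' where "u' = (J (2 * h) ^^ n) u" "w' = (J (2 * h) ^^ n) w" "z' = (J (2 * h) ^^ n) z"
  have uw': "(u', w') \<in> G" "(w', z') \<in> G" and z': "norm z' \<le> norm z"
    using J_pow_graph[OF h2 uw] J_pow_graph[OF h2 wz] J_pow_norm[OF h2]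
    by (auto simp: u'_w'_z'_def)
  have "norm ((J h ^^ 2) u' - u' - (2 * h) *\<^sub>R w') \<le> 4 * h\<^sup>2 * norm z'"
    using J_pow_Taylor[OF h uw', of 2] by (simp add: power2_eq_square)
  moreover have "norm ((J (2*h) ^^ 1) u' - u' - (2 * h) *\<^sub>R w') \<le> 4 * h\<^sup>2 * norm z'"
    using J_pow_Taylor[OF h2 uw', of 1] by (simp add: power2_eq_square)
  ultimately have "norm ((J h ^^ 2) u' - (J (2*h) ^^ 1) u') \<le> 8 * h\<^sup>2 * norm z'"
    using norm_triangle_ineq4[of "(J h ^^ 2) u' - u' - (2 * h) *\<^sub>R w'"
        "(J (2*h) ^^ 1) u' - u' - (2 * h) *\<^sub>R w'"] by simp
  also have "\<dots> \<le> 8 * h\<^sup>2 * norm z" using z' by (intro mult_left_mono) auto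
  finally have a: "norm ((J h ^^ 2) u' - J (2*h) u') \<le> 8 * h\<^sup>2 * norm z" by simp
  have "(J h ^^ (2 * Suc n)) u - (J (2 * h) ^^ Suc n) u
      = (J h ^^ 2) ((J h ^^ (2 * n)) u - u') + ((J h ^^ 2) u' - J (2 * h) u')"
    by (simp add: linear_diff[OF J_pow_linear[OF h]] funpow_add u'_w'_z'_def numeral_2_eq_2)
      (simp add: linear_diff[OF J_linear[OF h]])
  also have "norm \<dots> \<le> real n * (8 * h\<^sup>2 * norm z) + 8 * h\<^sup>2 * norm z"
    using Suc a by (intro norm_triangle_le add_mono order_trans[OF J_pow_norm[OF h]])
      (auto simp: u'_w'_z'_def)
  finally show ?case by (simp add: algebra_simps)
qed simp

end

lemma contraction_eq_on_dense:
  fixes f g :: "'h::real_normed_vector \<Rightarrow> 'h"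
  assumes "bounded_linear f" "bounded_linear g" "closure D = UNIV" "\<And>u. u \<in> D \<Longrightarrow> f u = g u"
  shows "f u = g u"
proof -
  have "closed {u. f u = g u}"
    using assms(1,2) by (intro closed_Collect_eq linear_continuous_on)
  then have "closure D \<subseteq> {u. f u = g u}" using assms(4) by (intro closure_minimal) auto
  then show ?thesis using assms(3) by auto
qed

lemma closure_UNIV_norm:
  fixes u :: "'h::real_normed_vector"
  assumes "closure D = UNIV" "0 < e" obtains v where "v \<in> D" "norm (u - v) < e"
proof -
  have "u \<in> closure D" by (simp add: assms)
  then show ?thesis using that assms(2)
    unfolding closure_approachable by (auto simp: dist_norm norm_minus_commute)
qed

text \<open>Uniform boundedness carries convergence from a dense set to the whole space.\<close>

lemma convergent_on_dense:
  fixes F :: "nat \<Rightarrow> 'h::banach \<Rightarrow> 'h"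
  assumes lin: "\<And>k. linear (F k)" and nrm: "\<And>k u. norm (F k u) \<le> norm u"
    and D: "closure D = UNIV" and conv: "\<And>v. v \<in> D \<Longrightarrow> convergent (\<lambda>k. F k v)"
  shows "convergent (\<lambda>k. F k u)"
proof -
  have "Cauchy (\<lambda>k. F k u)"
  proof (rule CauchyI)
    fix e :: real assume "0 < e"
    then obtain v where v: "v \<in> D" "norm (u - v) < e / 3"
      using closure_UNIV_norm[OF D, of "e/3"] by auto
    obtain N where N: "\<And>i j. N \<le> i \<Longrightarrow> N \<le> j \<Longrightarrow> norm (F i v - F j v) < e / 3"
      using CauchyD[OF convergent_Cauchy[OF conv[OF v(1)]], of "e/3"] \<open>0 < e\<close> by auto
    have "norm (F i u - F j u) < e" if "N \<le> i" "N \<le> j" for i j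
    proof -
      have "F i u - F j u = F i (u - v) + (F i v - F j v) - F j (u - v)"
        by (simp add: linear_diff[OF lin])
      also have "norm \<dots> \<le> norm (F i (u - v)) + norm (F i v - F j v) + norm (F j (u - v))"
        by (intro order_trans[OF norm_triangle_ineq4] add_mono norm_triangle_ineq order_refl)
      also have "\<dots> < e" using N[OF that] v(2) nrm[of i "u - v"] nrm[of j "u - v"] by linarith
      finally show ?thesis .
    qed
    then show "\<exists>N. \<forall>i\<ge>N. \<forall>j\<ge>N. norm (F i u - F j u) < e" by blast
  qed
  then show ?thesis by (rule Cauchy_convergent)
qed

lemma nat_floor_add:
  fixes x y :: real
  assumes "0 \<le> x" "0 \<le> y"
  obtains r where "r \<le> 1" "nat \<lfloor>x + y\<rfloor> = nat \<lfloor>x\<rfloor> + nat \<lfloor>y\<rfloor> + r"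
proof -
  have "\<lfloor>x\<rfloor> + \<lfloor>y\<rfloor> \<le> \<lfloor>x + y\<rfloor>" "\<lfloor>x + y\<rfloor> \<le> \<lfloor>x\<rfloor> + \<lfloor>y\<rfloor> + 1" by linarith+
  moreover have "0 \<le> \<lfloor>x\<rfloor>" "0 \<le> \<lfloor>y\<rfloor>" using assms by auto
  moreover have "nat c = nat a + nat b + nat (c - a - b) \<and> nat (c - a - b) \<le> 1"
    if "a + b \<le> c" "c \<le> a + b + 1" "0 \<le> a" "0 \<le> b" for a b c :: int
    using that by arith
  ultimately show ?thesis using that by blast
qed

context m_dissipative
begin

lemma J_pow_shift:
  assumes h: "0 < h" and "(u, w) \<in> G" "r \<le> 1"
  shows "norm ((J h ^^ (m + r)) u - (J h ^^ m) u) \<le> h * norm w"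
proof -
  have "(J h ^^ (m + r)) u - (J h ^^ m) u = (J h ^^ m) ((J h ^^ r) u - u)"
    by (simp add: linear_diff[OF J_pow_linear[OF h]] funpow_add)
  also have "norm \<dots> \<le> real r * h * norm w"
    by (rule order_trans[OF J_pow_norm[OF h] J_pow_step[OF h assms(2)]])
  also have "\<dots> \<le> 1 * h * norm w" using assms by (intro mult_right_mono) auto
  finally show ?thesis by simp
qed

text \<open>The Euler approximation at time \<open>t\<close> with step \<open>2\<^sup>-\<^sup>k\<close>.\<close>

definition steps :: "nat \<Rightarrow> real \<Rightarrow> nat" where
  "steps k t = nat \<lfloor>t * 2 ^ k\<rfloor>"

definition E :: "nat \<Rightarrow> real \<Rightarrow> 'h \<Rightarrow> 'h" where
  "E k t = J ((1/2) ^ k) ^^ steps k t"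

definition T :: "real \<Rightarrow> 'h \<Rightarrow> 'h" where
  "T t u = lim (\<lambda>k. E k t u)"

lemma E_linear: "linear (E k t)"
  unfolding E_def by (rule J_pow_linear) simp

lemma E_norm: "norm (E k t u) \<le> norm u"
  unfolding E_def by (rule J_pow_norm) simp

lemma E_graph: "(u, w) \<in> G \<Longrightarrow> (E k t u, E k t w) \<in> G"
  unfolding E_def by (rule J_pow_graph) simp

lemma steps_le: "0 \<le> t \<Longrightarrow> real (steps k t) * (1/2) ^ k \<le> t"
  and steps_ge: "t - (1/2) ^ k \<le> real (steps k t) * (1/2) ^ k"
proof -
  have 1: "2 ^ k * (1/2) ^ k = (1::real)" by (simp add: power_mult_distrib[symmetric])
  have "t * 2 ^ k - 1 \<le> real (steps k t)" unfolding steps_def by linarith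
  then have "(t * 2 ^ k - 1) * (1/2) ^ k \<le> real (steps k t) * (1/2) ^ k"
    by (intro mult_right_mono) auto
  then show "t - (1/2) ^ k \<le> real (steps k t) * (1/2) ^ k"
    using 1 by (simp add: left_diff_distrib mult.assoc)
  assume "0 \<le> t"
  then have "real (steps k t) \<le> t * 2 ^ k" by (simp add: steps_def)
  then have "real (steps k t) * (1/2) ^ k \<le> t * 2 ^ k * (1/2) ^ k"
    by (intro mult_right_mono) auto
  then show "real (steps k t) * (1/2) ^ k \<le> t" using 1 by (simp add: mult.assoc)
qed

lemma steps_tendsto:
  assumes "0 \<le> t" shows "(\<lambda>k. real (steps k t) * (1/2) ^ k) \<longlonglongrightarrow> t"
proof (rule tendsto_sandwich)
  show "(\<lambda>k. t - (1/2) ^ k) \<longlonglongrightarrow> t"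
    using tendsto_diff[OF tendsto_const LIMSEQ_realpow_zero[of "1/2"], of t] by simp
qed (use steps_le[OF assms] steps_ge in auto)

text \<open>Halving the step costs an error of second order in each of the \<open>t / h\<close> steps, and rounding
  \<open>t\<close> to the finer grid costs at most one more step; both are of first order in \<open>h = 2\<^sup>-\<^sup>k\<close>.\<close>

lemma E_Suc:
  assumes t: "0 \<le> t" and uw: "(u, w) \<in> G" and wz: "(w, z) \<in> G"
  shows "norm (E (Suc k) t u - E k t u) \<le> (4 * t * norm z + norm w) * (1/2) ^ Suc k"
proof -
  define h n where "h = (1/2 :: real) ^ Suc k" and "n = steps k t"
  have h: "0 < h" "(1/2) ^ k = 2 * h" by (auto simp: h_def)
  have double: "t * 2 ^ k + t * 2 ^ k = t * 2 ^ Suc k" by simp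
  obtain r where "r \<le> 1" and r: "steps (Suc k) t = n + n + r"
    using nat_floor_add[of "t * 2 ^ k" "t * 2 ^ k"] t unfolding steps_def n_def double by auto
  then have r: "steps (Suc k) t = 2 * n + r" by simp
  have "real n * (2 * h) \<le> t" using steps_le[OF t, of k] by (simp add: h(2) n_def)
  then have "real n * (2 * h) * (4 * h * norm z) \<le> t * (4 * h * norm z)"
    using h by (intro mult_right_mono) auto
  then have 1: "real n * (8 * h\<^sup>2 * norm z) \<le> 4 * t * norm z * h"
    by (simp add: power2_eq_square algebra_simps)
  have "E (Suc k) t u - E k t u
      = ((J h ^^ (2 * n + r)) u - (J h ^^ (2 * n)) u) + ((J h ^^ (2 * n)) u - (J (2*h) ^^ n) u)"
    unfolding E_def r n_def[symmetric] h(2) h_def[symmetric] by simp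
  also have "norm \<dots> \<le> h * norm w + real n * (8 * h\<^sup>2 * norm z)"
    by (intro norm_triangle_le add_mono J_halve[OF h(1) uw wz] J_pow_shift[OF h(1) uw \<open>r \<le> 1\<close>])
  also have "\<dots> \<le> (4 * t * norm z + norm w) * h" using 1 by (simp add: algebra_simps)
  finally show ?thesis unfolding h_def .
qed

text \<open>Elements of the domain of \<open>G\<^sup>2\<close>: the image of the dense domain of \<open>G\<close> under the
  bounded operator \<open>(1 - G)\<^sup>-\<^sup>1\<close>, whose range is dense.\<close>

lemma dense_domain_square: "closure {u. \<exists>w z. (u, w) \<in> G \<and> (w, z) \<in> G} = UNIV"
proof -
  let ?D = "{u. \<exists>w z. (u, w) \<in> G \<and> (w, z) \<in> G}"
  have "Domain G \<subseteq> closure ?D"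
  proof
    fix u assume "u \<in> Domain G"
    then obtain w where uw: "(u, w) \<in> G" by blast
    show "u \<in> closure ?D"
      unfolding closure_approachable
    proof (intro allI impI)
      fix e :: real assume "0 < e"
      then obtain v where v: "v \<in> Domain G" "norm (u - w - v) < e"
        using closure_UNIV_norm[OF dense] by blast
      then obtain v' where v': "(v, v') \<in> G" by blast
      have "(J 1 v, J 1 v') \<in> G" "(J 1 v, J 1 v - v) \<in> G"
        using J_graph(2)[OF _ v', of 1] J_mem[of 1 v] by auto
      then have "(J 1 v - v, J 1 v' - v') \<in> G"
        using J_mem[of 1 v'] J_graph(1)[OF _ v', of 1] by auto
      with \<open>(J 1 v, J 1 v - v) \<in> G\<close> have "J 1 v \<in> ?D" by blast
      moreover have "J 1 (u - w) = u" using J_eqI[OF _ uw, of 1] by simp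
      then have "dist (J 1 v) u = norm (J 1 (v - (u - w)))"
        by (simp add: dist_norm linear_diff[OF J_linear[of 1]])
      then have "dist (J 1 v) u < e"
        using J_norm[of 1 "v - (u - w)"] v(2) by (simp add: norm_minus_commute)
      ultimately show "\<exists>y\<in>?D. dist y u < e" by blast
    qed
  qed
  then have "closure (Domain G) \<subseteq> closure ?D" by (rule closure_minimal) simp
  then show ?thesis using dense by blast
qed

lemma T_tendsto:
  assumes t: "0 \<le> t" shows "(\<lambda>k. E k t u) \<longlonglongrightarrow> T t u"
proof -
  have "convergent (\<lambda>k. E k t v)" if "v \<in> {u. \<exists>w z. (u, w) \<in> G \<and> (w, z) \<in> G}" for v
  proof -
    from that obtain w z where wz: "(v, w) \<in> G" "(w, z) \<in> G" by blast
    have "summable (\<lambda>k. (4 * t * norm z + norm w) * (1/2::real) ^ Suc k)"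
      by (intro summable_mult summable_Suc_iff[THEN iffD2] summable_geometric) simp
    then have "summable (\<lambda>k. E (Suc k) t v - E k t v)"
      by (rule summable_comparison_test'[where N=0]) (rule E_Suc[OF t wz])
    then have "convergent (\<lambda>n. \<Sum>k<n. E (Suc k) t v - E k t v)"
      by (simp add: summable_iff_convergent)
    then have "convergent (\<lambda>n. (E n t v - E 0 t v) + E 0 t v)"
      by (intro convergent_add convergent_const) (simp add: sum_lessThan_telescope[of "\<lambda>k. E k t v"])
    then show ?thesis by simp
  qed
  from convergent_on_dense[OF E_linear E_norm dense_domain_square this]
  show ?thesis unfolding T_def by (simp add: convergent_LIMSEQ_iff)
qed

lemma T_norm: assumes "0 \<le> t" shows "norm (T t u) \<le> norm u"
  by (rule LIMSEQ_le_const2[OF tendsto_norm[OF T_tendsto[OF assms]]]) (use E_norm in blast)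

lemma T_linear: assumes t: "0 \<le> t" shows "linear (T t)"
proof (rule linearI)
  fix u v :: 'h and c :: real
  show "T t (u + v) = T t u + T t v"
    using tendsto_add[OF T_tendsto[OF t, of u] T_tendsto[OF t, of v]] T_tendsto[OF t, of "u + v"]
    by (simp add: linear_add[OF E_linear] LIMSEQ_unique)
  show "T t (c *\<^sub>R u) = c *\<^sub>R T t u"
    using tendsto_scaleR[OF tendsto_const T_tendsto[OF t, of u], of c] T_tendsto[OF t, of "c *\<^sub>R u"]
    by (simp add: linear_scale[OF E_linear] LIMSEQ_unique)
qed

lemma T_bounded_linear: assumes "0 \<le> t" shows "bounded_linear (T t)"
  by (rule bounded_linear_intro[where K=1])
    (use T_linear[OF assms] T_norm[OF assms] in \<open>auto simp: linear_add linear_scale\<close>)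

lemma T_graph:
  assumes t: "0 \<le> t" and uw: "(u, w) \<in> G" shows "(T t u, T t w) \<in> G"
  using closed_sequentially[OF closed_graph, of "\<lambda>k. (E k t u, E k t w)" "(T t u, T t w)"]
    tendsto_Pair[OF T_tendsto[OF t] T_tendsto[OF t], of u w] E_graph[OF uw] by simp

lemma T_zero: "T 0 u = u"
  by (simp add: T_def E_def steps_def)

lemma T_step:
  assumes t: "0 \<le> t" and uw: "(u, w) \<in> G" shows "norm (T t u - u) \<le> t * norm w"
proof (rule LIMSEQ_le_const2)
  show "(\<lambda>k. norm (E k t u - u)) \<longlonglongrightarrow> norm (T t u - u)"
    by (intro tendsto_intros T_tendsto t)
  have "norm (E k t u - u) \<le> t * norm w" for k
    unfolding E_def
    by (rule order_trans[OF J_pow_step[OF _ uw] mult_right_mono[OF steps_le[OF t]]]) auto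
  then show "\<exists>N. \<forall>k\<ge>N. norm (E k t u - u) \<le> t * norm w" by blast
qed

lemma T_Taylor:
  assumes t: "0 \<le> t" and uw: "(u, w) \<in> G" and wz: "(w', z) \<in> G"
  shows "norm (T t u - u - t *\<^sub>R w) \<le> t * (2 * norm (w - w') + t * norm z)"
proof (rule LIMSEQ_le)
  let ?s = "\<lambda>k. real (steps k t) * (1/2) ^ k"
  show "(\<lambda>k. norm (E k t u - u - ?s k *\<^sub>R w)) \<longlonglongrightarrow> norm (T t u - u - t *\<^sub>R w)"
    by (intro tendsto_intros T_tendsto steps_tendsto t)
  show "(\<lambda>k. ?s k * (2 * norm (w - w') + ?s k * norm z))
      \<longlonglongrightarrow> t * (2 * norm (w - w') + t * norm z)"
    by (intro tendsto_intros steps_tendsto t)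
  have "norm (E k t u - u - ?s k *\<^sub>R w) \<le> ?s k * (2 * norm (w - w') + ?s k * norm z)" for k
    unfolding E_def by (rule J_pow_Taylor[OF _ uw wz]) simp
  then show "\<exists>N. \<forall>k\<ge>N. norm (E k t u - u - ?s k *\<^sub>R w)
      \<le> ?s k * (2 * norm (w - w') + ?s k * norm z)" by blast
qed

text \<open>On the grid of step \<open>2\<^sup>-\<^sup>k\<close> the numbers of steps for \<open>s\<close> and \<open>t\<close> add up to the number for
  \<open>s + t\<close> or miss it by one, which does not matter in the limit.\<close>

lemma T_add:
  assumes s: "0 \<le> s" and t: "0 \<le> t" shows "T (s + t) u = T s (T t u)"
proof -
  have st: "0 \<le> s + t" using s t by simp
  have "bounded_linear (\<lambda>u. T s (T t u))"
    using bounded_linear_compose[OF T_bounded_linear[OF s] T_bounded_linear[OF t]] .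
  with T_bounded_linear[OF st] show ?thesis
  proof (rule contraction_eq_on_dense[OF _ _ dense])
    fix u assume "u \<in> Domain G"
    then obtain w where uw: "(u, w) \<in> G" by blast
    have "(\<lambda>k. E k (s + t) u - T s (T t u)) \<longlonglongrightarrow> 0"
    proof (rule Lim_null_comparison)
      have "norm (E k (s + t) u - T s (T t u))
          \<le> (1/2) ^ k * norm w + norm (E k t u - T t u) + norm (E k s (T t u) - T s (T t u))" for k
      proof -
        obtain r where "r \<le> 1" "steps k (s + t) = steps k s + steps k t + r"
          using nat_floor_add[of "s * 2 ^ k" "t * 2 ^ k"] s t
          unfolding steps_def distrib_right[symmetric] by auto
        then have "norm (E k (s + t) u - E k s (E k t u)) \<le> (1/2) ^ k * norm w"
          using J_pow_shift[OF _ uw, of "(1/2) ^ k" r "steps k s + steps k t"]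
          by (simp add: E_def funpow_add)
        moreover have "norm (E k s (E k t u) - E k s (T t u)) \<le> norm (E k t u - T t u)"
          using E_norm[of k s "E k t u - T t u"] by (simp add: linear_diff[OF E_linear])
        moreover have "E k (s + t) u - T s (T t u)
            = (E k (s + t) u - E k s (E k t u)) + (E k s (E k t u) - E k s (T t u))
              + (E k s (T t u) - T s (T t u))" by simp
        ultimately show ?thesis
          by (metis (no_types, lifting) add_mono norm_triangle_le order_refl)
      qed
      then show "\<forall>\<^sub>F k in sequentially. norm (E k (s + t) u - T s (T t u))
          \<le> (1/2) ^ k * norm w + norm (E k t u - T t u) + norm (E k s (T t u) - T s (T t u))"
        by simp
      have a: "(\<lambda>k. (1/2) ^ k * norm w) \<longlonglongrightarrow> 0"
        using tendsto_mult_left_zero[OF LIMSEQ_realpow_zero[of "1/2"]] by simp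
      have b: "(\<lambda>k. norm (E k r v - T r v)) \<longlonglongrightarrow> 0" if "0 \<le> r" for r v
        using tendsto_norm[OF LIM_zero[OF T_tendsto[OF that]]] by simp
      show "(\<lambda>k. (1/2) ^ k * norm w + norm (E k t u - T t u) + norm (E k s (T t u) - T s (T t u)))
          \<longlonglongrightarrow> 0"
        using tendsto_add[OF tendsto_add[OF a b[OF t]] b[OF s]] by simp
    qed
    then have "(\<lambda>k. E k (s + t) u) \<longlonglongrightarrow> T s (T t u)" by (rule LIM_zero_cancel)
    then show "T (s + t) u = T s (T t u)" using T_tendsto[OF st] LIMSEQ_unique by blast
  qed
qed

lemma T_right_continuous: "((\<lambda>t. T t u) \<longlongrightarrow> u) (at_right 0)"
proof (rule tendstoI)
  fix e :: real assume e: "0 < e"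
  obtain v where "v \<in> Domain G" and v: "norm (u - v) < e / 3"
    using closure_UNIV_norm[OF dense, of "e/3"] e by auto
  then obtain w where w: "(v, w) \<in> G" by blast
  define d where "d = e / (3 * (1 + norm w))"
  have "0 < 1 + norm w" using norm_ge_zero[of w] by linarith
  then have d: "0 < d" "d * norm w \<le> e / 3" using e by (auto simp: d_def field_simps)
  have "dist (T t u) u < e" if t: "0 < t" "t < d" for t
  proof -
    have "T t u - u = T t (u - v) + (T t v - v) + (v - u)"
      using t by (simp add: linear_diff[OF T_linear])
    also have "norm \<dots> \<le> norm (u - v) + t * norm w + norm (v - u)"
      using t by (intro norm_triangle_le add_mono T_norm T_step w) auto
    finally have "norm (T t u - u) \<le> norm (u - v) + t * norm w + norm (v - u)" .
    moreover have "t * norm w \<le> d * norm w" using t by (intro mult_right_mono) auto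
    ultimately show ?thesis using v d by (simp add: dist_norm norm_minus_commute)
  qed
  then show "\<forall>\<^sub>F t in at_right 0. dist (T t u) u < e"
    unfolding eventually_at_right_field using d(1) by auto
qed

lemma T_contraction_semigroup: "contraction_semigroup T"
  unfolding contraction_semigroup_def C0_semigroup_def
  using T_bounded_linear T_zero T_add T_right_continuous T_norm by blast

lemma T_derivative:
  assumes t: "0 \<le> t" and uw: "(u, w) \<in> G"
  shows "((\<lambda>s. T s u) has_vector_derivative T t w) (at t within {0..})"
  unfolding has_vector_derivative_def has_derivative_within_alt
proof (intro conjI allI impI bounded_linear_scaleR_left)
  fix e :: real assume e: "0 < e"
  obtain w' where "w' \<in> Domain G" and w': "norm (w - w') < e / 8"
    using closure_UNIV_norm[OF dense, of "e/8"] e by auto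
  then obtain z where z: "(w', z) \<in> G" by blast
  define d where "d = e / (4 * (1 + norm z))"
  have "0 < 1 + norm z" using norm_ge_zero[of z] by linarith
  then have d: "0 < d" "d * norm z \<le> e / 4" using e by (auto simp: d_def field_simps)
  have small: "2 * norm (w - w') + s * norm z \<le> e / 2" if "s \<le> d" for s
  proof -
    have "s * norm z \<le> d * norm z" using that by (intro mult_right_mono) auto
    then show ?thesis using d w' by simp
  qed
  have fwd: "norm (T (r + s) u - T r u - s *\<^sub>R T r w) \<le> s * (e / 2)"
    if "0 \<le> r" "0 \<le> s" "s \<le> d" for r s
  proof -
    have "T (r + s) u - T r u - s *\<^sub>R T r w = T r (T s u - u - s *\<^sub>R w)"
      using that by (simp add: T_add linear_diff[OF T_linear] linear_scale[OF T_linear])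
    then have "norm (T (r + s) u - T r u - s *\<^sub>R T r w) \<le> norm (T s u - u - s *\<^sub>R w)"
      using T_norm that by simp
    also have "\<dots> \<le> s * (2 * norm (w - w') + s * norm z)" by (rule T_Taylor[OF that(2) uw z])
    also have "\<dots> \<le> s * (e / 2)" using that small by (intro mult_left_mono) auto
    finally show ?thesis .
  qed
  have cont: "norm (T (r + s) w - T r w) \<le> e / 2" if "0 \<le> r" "0 \<le> s" "s \<le> d" for r s
  proof -
    have "T (r + s) w - T r w = T r (T s (w - w') + (T s w' - w') + (w' - w))"
      using that by (simp add: T_add linear_diff[OF T_linear] linear_add[OF T_linear])
    then have "norm (T (r + s) w - T r w) \<le> norm (T s (w - w') + (T s w' - w') + (w' - w))"
      using T_norm that by simp
    also have "\<dots> \<le> norm (w - w') + s * norm z + norm (w' - w)"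
      using that by (intro norm_triangle_le add_mono T_norm T_step z) auto
    also have "\<dots> \<le> e / 2" using small[OF that(3)] by (simp add: norm_minus_commute)
    finally show ?thesis .
  qed
  have "norm (T y u - T t u - (y - t) *\<^sub>R T t w) \<le> e * norm (y - t)"
    if y: "0 \<le> y" "norm (y - t) < d" for y
  proof (cases "t \<le> y")
    case True
    then have "norm (T y u - T t u - (y - t) *\<^sub>R T t w) \<le> (y - t) * (e / 2)"
      using fwd[of t "y - t"] t y(2) by simp
    also have "\<dots> \<le> e * norm (y - t)" using True e by simp
    finally show ?thesis .
  next
    case False
    define s where "s = t - y"
    have s: "t = y + s" "0 \<le> s" "s \<le> d" using False y by (auto simp: s_def)
    have "T y u - T t u - (y - t) *\<^sub>R T t w
        = - (T (y + s) u - T y u - s *\<^sub>R T y w) + s *\<^sub>R (T (y + s) w - T y w)"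
      by (simp add: s(1) algebra_simps)
    also have "norm \<dots> \<le> s * (e / 2) + s * (e / 2)"
    proof (intro norm_triangle_le add_mono)
      show "norm (- (T (y + s) u - T y u - s *\<^sub>R T y w)) \<le> s * (e / 2)"
        unfolding norm_minus_cancel by (rule fwd[OF y(1) s(2,3)])
      show "norm (s *\<^sub>R (T (y + s) w - T y w)) \<le> s * (e / 2)"
        using mult_left_mono[OF cont[OF y(1) s(2,3)] s(2)] s(2) by simp
    qed
    also have "\<dots> = e * norm (y - t)" using s by simp
    finally show ?thesis .
  qed
  then show "\<exists>d>0. \<forall>y\<in>{0..}. norm (y - t) < d \<longrightarrow>
      norm (T y u - T t u - (y - t) *\<^sub>R T t w) \<le> e * norm (y - t)"
    using d(1) by auto
qed

end

text \<open>The semigroup is the limit of the implicit Euler scheme \<open>(1 - h G)\<^sup>-\<^sup>n\<close> along the dyadic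
  step sizes \<open>h = 2\<^sup>-\<^sup>k\<close>.\<close>

theorem Lumer_Phillips:
  assumes "m_dissipative G"
  obtains T where "contraction_semigroup T"
    and "\<And>t u w. 0 \<le> t \<Longrightarrow> (u, w) \<in> G \<Longrightarrow> (T t u, T t w) \<in> G"
    and "\<And>t u w. 0 \<le> t \<Longrightarrow> (u, w) \<in> G \<Longrightarrow>
      ((\<lambda>s. T s u) has_vector_derivative T t w) (at t within {0..})"
  using m_dissipative.T_contraction_semigroup[OF assms] m_dissipative.T_graph[OF assms]
    m_dissipative.T_derivative[OF assms] by blast

section \<open>Skew-symmetric operators and the semigroups compatible with them\<close>

lemma skew_symmetric_form:
  assumes "skew_symmetric S" "(f, g) \<in> S" "(u, v) \<in> S"
  shows "g \<bullet> u + f \<bullet> v = 0"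
proof -
  have "(u, v) \<in> neg_operator (adjoint_operator S)"
    using assms by (auto simp: skew_symmetric_def)
  then obtain w where "v = - w" "(u, w) \<in> adjoint_operator S"
    by (auto simp: neg_operator_def)
  with assms(2) show ?thesis by (auto simp: adjoint_operator_def)
qed

text \<open>A densely defined linear relation on which the form vanishes is single-valued: a value at
  \<open>0\<close> is orthogonal to the domain.\<close>

lemma skew_symmetricI:
  fixes S :: "'h::real_inner op_graph"
  assumes sub: "subspace S" and dense: "closure (Domain S) = UNIV"
    and form: "\<And>f g u v. (f, g) \<in> S \<Longrightarrow> (u, v) \<in> S \<Longrightarrow> g \<bullet> u + f \<bullet> v = 0"
  shows "skew_symmetric S"
proof -
  have "w = w'" if "(u, w) \<in> S" "(u, w') \<in> S" for u w w'
  proof -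
    have "(0, w - w') \<in> S" using subspace_diff[OF sub that] by simp
    then have "(w - w') \<bullet> y = 0" if "y \<in> Domain S" for y
      using form[of 0 "w - w'" y] that by auto
    then have "w - w' = 0" using orthogonal_to_dense_zero[OF dense] by blast
    then show ?thesis by simp
  qed
  then have "single_valued S" by (auto simp: single_valued_def)
  moreover have "(u, v) \<in> neg_operator (adjoint_operator S)" if "(u, v) \<in> S" for u v
  proof -
    have "(u, - v) \<in> adjoint_operator S"
      using form[OF _ that] by (auto simp: adjoint_operator_def add_eq_0_iff2)
    then show ?thesis unfolding neg_operator_def by force
  qed
  ultimately show ?thesis
    using sub dense by (auto simp: skew_symmetric_def linear_operator_def densely_defined_def)
qed

lemma skew_symmetric_subspace: "skew_symmetric S \<Longrightarrow> subspace S"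
  and skew_symmetric_dense: "skew_symmetric S \<Longrightarrow> closure (Domain S) = UNIV"
  by (auto simp: skew_symmetric_def linear_operator_def densely_defined_def)

lemma closure_skew_symmetric:
  fixes S :: "'h::real_inner op_graph"
  assumes S: "skew_symmetric S" shows "skew_symmetric (closure S)"
proof (rule skew_symmetricI)
  show "subspace (closure S)" by (intro subspace_closure skew_symmetric_subspace S)
  have "closure (Domain S) \<subseteq> closure (Domain (closure S))"
    by (intro closure_mono Domain_mono closure_subset)
  then show "closure (Domain (closure S)) = UNIV" using skew_symmetric_dense[OF S] by blast
next
  fix f g u v assume "(f, g) \<in> closure S" "(u, v) \<in> closure S"
  then obtain p q where p: "\<And>n. p n \<in> S" "p \<longlonglongrightarrow> (f, g)" and q: "\<And>n. q n \<in> S" "q \<longlonglongrightarrow> (u, v)"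
    unfolding closure_sequential by blast
  have "snd (p n) \<bullet> fst (q n) + fst (p n) \<bullet> snd (q n) = 0" for n
    using skew_symmetric_form[OF S, of "fst (p n)" "snd (p n)" "fst (q n)" "snd (q n)"] p(1) q(1)
    by simp
  moreover have "(\<lambda>n. snd (p n) \<bullet> fst (q n) + fst (p n) \<bullet> snd (q n)) \<longlonglongrightarrow> g \<bullet> u + f \<bullet> v"
    using tendsto_fst[OF p(2)] tendsto_snd[OF p(2)] tendsto_fst[OF q(2)] tendsto_snd[OF q(2)]
    by (auto intro!: tendsto_intros)
  ultimately show "g \<bullet> u + f \<bullet> v = 0" by (simp add: LIMSEQ_const_iff)
qed

lemma neg_operator_iff: "(u, w) \<in> neg_operator S \<longleftrightarrow> (u, - w) \<in> S"
  unfolding neg_operator_def by force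

lemma neg_skew_symmetric:
  fixes S :: "'h::real_inner op_graph"
  assumes S: "skew_symmetric S" shows "skew_symmetric (neg_operator S)"
proof (rule skew_symmetricI)
  have "neg_operator S = (\<lambda>p. (fst p, - snd p)) ` S"
    unfolding neg_operator_def by force
  moreover have "linear (\<lambda>p::'h \<times> 'h. (fst p, - snd p))" by (rule linearI) auto
  ultimately show "subspace (neg_operator S)"
    using linear_subspace_image[OF _ skew_symmetric_subspace[OF S]] by simp
  have "Domain (neg_operator S) = Domain S" by (force simp: neg_operator_def)
  then show "closure (Domain (neg_operator S)) = UNIV" using skew_symmetric_dense[OF S] by simp
next
  fix f g u v assume "(f, g) \<in> neg_operator S" "(u, v) \<in> neg_operator S"
  then show "g \<bullet> u + f \<bullet> v = 0"
    using skew_symmetric_form[OF S, of f "- g" u "- v"] by (simp add: neg_operator_iff)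
qed

lemma closed_neg_operator:
  fixes S :: "'h::real_inner op_graph"
  assumes "closed S" shows "closed (neg_operator S)"
proof -
  have "neg_operator S = (\<lambda>p. (fst p, - snd p)) -` S"
    by (auto simp: neg_operator_iff)
  then show ?thesis
    by (simp only:) (intro closed_vimage assms continuous_intros)
qed

lemma skew_symmetric_dissipative: "skew_symmetric S \<Longrightarrow> dissipative S"
  using skew_symmetric_form[of S] skew_symmetric_subspace[of S]
  by (fastforce simp: dissipative_def inner_commute)

lemma skew_symmetric_m_dissipative:
  "skew_symmetric S \<Longrightarrow> range_one_minus 1 S = UNIV \<Longrightarrow> m_dissipative S"
  by (simp add: m_dissipative_def skew_symmetric_dissipative skew_symmetric_dense)

text \<open>The semigroup \<open>T\<close> solves \<open>u\<^sub>t = A\<^sup>* u\<close> in the weak sense.\<close>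

definition weak_evolution :: "'h::real_inner op_graph \<Rightarrow> (real \<Rightarrow> 'h \<Rightarrow> 'h) \<Rightarrow> bool" where
  "weak_evolution A T \<longleftrightarrow> (\<forall>u t. \<forall>(f, g)\<in>A. 0 \<le> t \<longrightarrow>
     ((\<lambda>s. T s u \<bullet> f) has_real_derivative T t u \<bullet> g) (at t within {0..}))"

lemma contraction_semigroup_dist:
  assumes T: "contraction_semigroup T" and "0 \<le> s" "0 \<le> t"
  shows "norm (T s u - T t u) \<le> norm (T \<bar>s - t\<bar> u - u)"
proof -
  have *: "norm (T (r + d) u - T r u) \<le> norm (T d u - u)" if "0 \<le> r" "0 \<le> d" for r d
  proof -
    have lin: "bounded_linear (T r)" and add: "T (r + d) u = T r (T d u)"
      and nrm: "norm (T r (T d u - u)) \<le> norm (T d u - u)"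
      using T that by (auto simp: contraction_semigroup_def C0_semigroup_def)
    show ?thesis using nrm by (simp add: add bounded_linear.linear[OF lin] linear_diff)
  qed
  show ?thesis
  proof (cases "s \<le> t")
    case True
    then show ?thesis using *[of s "t - s"] assms by (simp add: norm_minus_commute)
  next
    case False
    then show ?thesis using *[of t "s - t"] assms by simp
  qed
qed

lemma contraction_semigroup_modulus:
  assumes T: "contraction_semigroup T" and e: "0 < e"
  obtains d where "0 < d"
    and "\<And>s t. 0 \<le> s \<Longrightarrow> 0 \<le> t \<Longrightarrow> \<bar>s - t\<bar> < d \<Longrightarrow> norm (T s u - T t u) < e"
proof -
  have "((\<lambda>t. T t u) \<longlongrightarrow> u) (at_right 0)" and T0: "T 0 u = u"
    using T by (auto simp: contraction_semigroup_def C0_semigroup_def)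
  then have "\<forall>\<^sub>F t in at_right 0. dist (T t u) u < e" using e by (auto dest: tendstoD)
  then obtain d where d: "0 < d" "\<And>t. 0 < t \<Longrightarrow> t < d \<Longrightarrow> dist (T t u) u < e"
    unfolding eventually_at_right_field by auto
  have "norm (T s u - T t u) < e" if "0 \<le> s" "0 \<le> t" "\<bar>s - t\<bar> < d" for s t
  proof (cases "s = t")
    case False
    then show ?thesis
      using contraction_semigroup_dist[OF T that(1,2), of u] d(2)[of "\<bar>s - t\<bar>"] that
      by (simp add: dist_norm)
  qed (use e in simp)
  with d(1) that show ?thesis by blast
qed

lemma contraction_semigroup_continuous:
  assumes T: "contraction_semigroup T" shows "continuous_on {0..} (\<lambda>t. T t u)"
  unfolding continuous_on_iff
proof (intro ballI allI impI)
  fix t :: real and e :: real assume "t \<in> {0..}" "0 < e"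
  then show "\<exists>d>0. \<forall>s\<in>{0..}. dist s t < d \<longrightarrow> dist (T s u) (T t u) < e"
    using contraction_semigroup_modulus[OF T, of e u] unfolding dist_norm real_norm_def
    by (metis atLeast_iff)
qed

text \<open>Product rule for a merely continuous, weakly differentiable curve \<open>w\<close> and a strongly
  differentiable curve \<open>y\<close>; it pairs solutions of dual evolution equations.\<close>

lemma weak_strong_product_rule:
  fixes w y :: "real \<Rightarrow> 'h::real_inner"
  assumes wd: "((\<lambda>s. w s \<bullet> y t) has_real_derivative c) (at t within S)"
    and w: "(w \<longlongrightarrow> w t) (at t within S)"
    and y: "(y has_vector_derivative y') (at t within S)"
  shows "((\<lambda>s. w s \<bullet> y s) has_real_derivative c + w t \<bullet> y') (at t within S)"
proof -
  have "((\<lambda>s. (w s - w t) \<bullet> (y s - y t)) has_derivative (\<lambda>h. 0)) (at t within S)"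
    unfolding has_derivative_iff_norm
  proof (intro conjI bounded_linear_zero, rule Lim_null_comparison)
    define q where "q s = norm (y s - y t - (s - t) *\<^sub>R y') / norm (s - t)" for s
    have q: "(q \<longlongrightarrow> 0) (at t within S)"
      using y unfolding q_def has_vector_derivative_def has_derivative_iff_norm by simp
    have "norm ((w s - w t) \<bullet> (y s - y t)) / norm (s - t) \<le> norm (w s - w t) * (q s + norm y')"
      for s
    proof (cases "s = t")
      case False
      have "norm (y s - y t) \<le> norm (y s - y t - (s - t) *\<^sub>R y') + norm ((s - t) *\<^sub>R y')"
        using norm_triangle_ineq[of "y s - y t - (s - t) *\<^sub>R y'" "(s - t) *\<^sub>R y'"]
        by (simp only: diff_add_cancel)
      then have "norm (y s - y t) / norm (s - t)
          \<le> (norm (y s - y t - (s - t) *\<^sub>R y') + norm ((s - t) *\<^sub>R y')) / norm (s - t)"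
        by (rule divide_right_mono) simp
      also have "\<dots> = q s + norm y'" using False by (simp add: q_def add_divide_distrib)
      finally have "norm (y s - y t) / norm (s - t) \<le> q s + norm y'" .
      then have "norm (w s - w t) * (norm (y s - y t) / norm (s - t))
          \<le> norm (w s - w t) * (q s + norm y')" by (rule mult_left_mono) simp
      moreover have "norm ((w s - w t) \<bullet> (y s - y t)) / norm (s - t)
          \<le> norm (w s - w t) * norm (y s - y t) / norm (s - t)"
        using Cauchy_Schwarz_ineq2 by (intro divide_right_mono) auto
      ultimately show ?thesis by simp
    qed (simp add: q_def)
    then show "\<forall>\<^sub>F s in at t within S.
        norm (norm ((w s - w t) \<bullet> (y s - y t) - (w t - w t) \<bullet> (y t - y t) - 0) / norm (s - t))
        \<le> norm (w s - w t) * (q s + norm y')" by simp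
    have "((\<lambda>s. norm (w s - w t) * (q s + norm y')) \<longlongrightarrow> 0 * (0 + norm y')) (at t within S)"
      using tendsto_norm[OF LIM_zero[OF w]] q by (intro tendsto_intros) auto
    then show "((\<lambda>s. norm (w s - w t) * (q s + norm y')) \<longlongrightarrow> 0) (at t within S)" by simp
  qed
  then have "((\<lambda>s. (w s - w t) \<bullet> (y s - y t)) has_real_derivative 0) (at t within S)"
    by (simp add: has_field_derivative_def lambda_zero)
  moreover have "((\<lambda>s. w t \<bullet> (y s - y t)) has_real_derivative w t \<bullet> y') (at t within S)"
    using bounded_linear.has_vector_derivative[OF bounded_linear_inner_right
        has_vector_derivative_diff[OF y has_vector_derivative_const], of "w t" "y t"]
    by (simp add: has_real_derivative_iff_has_vector_derivative)
  ultimately have "((\<lambda>s. w s \<bullet> y t + ((w s - w t) \<bullet> (y s - y t) + w t \<bullet> (y s - y t)))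
      has_real_derivative c + (0 + w t \<bullet> y')) (at t within S)"
    by (intro DERIV_add wd)
  then show ?thesis by (simp add: inner_diff_left inner_diff_right)
qed

text \<open>With \<open>y\<close> a solution of the dual equation the two terms of the derivative cancel.\<close>

lemma weak_evolution_pairing:
  assumes T: "contraction_semigroup T" "weak_evolution A T"
    and y: "\<And>s. s \<in> S \<Longrightarrow> (y s, z s) \<in> A"
    and dy: "\<And>s. s \<in> S \<Longrightarrow> (y has_vector_derivative y' s) (at s within S)"
    and S: "S \<subseteq> {0..}" and t: "t \<in> S"
  shows "((\<lambda>s. T s u \<bullet> y s) has_real_derivative T t u \<bullet> z t + T t u \<bullet> y' t) (at t within S)"
proof (rule weak_strong_product_rule[OF _ _ dy[OF t]])
  have "0 \<le> t" using S t by auto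
  then have "((\<lambda>s. T s u \<bullet> y t) has_real_derivative T t u \<bullet> z t) (at t within {0..})"
    using T(2) y[OF t] unfolding weak_evolution_def by blast
  then show "((\<lambda>s. T s u \<bullet> y t) has_real_derivative T t u \<bullet> z t) (at t within S)"
    by (rule DERIV_subset[OF _ S])
  have "((\<lambda>s. T s u) \<longlongrightarrow> T t u) (at t within {0..})"
    using contraction_semigroup_continuous[OF T(1), of u] \<open>0 \<le> t\<close> by (simp add: continuous_on_def)
  then show "((\<lambda>s. T s u) \<longlongrightarrow> T t u) (at t within S)" by (rule tendsto_within_subset[OF _ S])
qed

lemma has_real_derivative_zero_eq:
  fixes \<phi> :: "real \<Rightarrow> real"
  assumes "\<And>s. s \<in> {0..t} \<Longrightarrow> (\<phi> has_real_derivative 0) (at s within {0..t})" "0 \<le> t"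
  shows "\<phi> t = \<phi> 0"
proof -
  have "\<exists>c. \<forall>s\<in>{0..t}. \<phi> s = c" using assms by (intro has_field_derivative_zero_constant) auto
  then show ?thesis using assms(2) by auto
qed

text \<open>If \<open>-A\<close> itself generates a semigroup \<open>S\<close>, then \<open>T t u \<bullet> S t u\<close> is constant in time, equal
  to \<open>|u|\<^sup>2\<close>; since both factors have norm at most \<open>|u|\<close>, they coincide.\<close>

lemma unique_if_neg_generates:
  fixes A :: "'h::{real_inner,banach} op_graph"
  assumes A: "skew_symmetric A" and ran: "range_one_minus 1 (neg_operator A) = UNIV"
    and T: "contraction_semigroup T" "weak_evolution A T"
    and T': "contraction_semigroup T'" "weak_evolution A T'" and t: "0 \<le> t"
  shows "T t = T' t"
proof -
  obtain S where S: "contraction_semigroup S"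
    and Sg: "\<And>t u w. 0 \<le> t \<Longrightarrow> (u, w) \<in> neg_operator A \<Longrightarrow> (S t u, S t w) \<in> neg_operator A"
    and Sd: "\<And>t u w. 0 \<le> t \<Longrightarrow> (u, w) \<in> neg_operator A \<Longrightarrow>
      ((\<lambda>s. S s u) has_vector_derivative S t w) (at t within {0..})"
    using Lumer_Phillips[OF skew_symmetric_m_dissipative[OF neg_skew_symmetric[OF A] ran]] by blast
  have eq: "R t u = S t u" if R: "contraction_semigroup R" "weak_evolution A R"
    and u: "u \<in> Domain (neg_operator A)" for R u
  proof -
    obtain w where w: "(u, w) \<in> neg_operator A" using u by blast
    have "((\<lambda>s. R s u \<bullet> S s u) has_real_derivative 0) (at s within {0..t})" if "s \<in> {0..t}" for s
    proof -
      have "((\<lambda>s. R s u \<bullet> S s u) has_real_derivative R s u \<bullet> (- S s w) + R s u \<bullet> S s w)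
          (at s within {0..t})"
      proof (rule weak_evolution_pairing[OF R, where z = "\<lambda>s. - S s w" and y' = "\<lambda>s. S s w"])
        fix r assume "r \<in> {0..t}"
        then show "(S r u, - S r w) \<in> A" using Sg[OF _ w, of r] by (simp add: neg_operator_iff)
        show "((\<lambda>s. S s u) has_vector_derivative S r w) (at r within {0..t})"
          using Sd[OF _ w, of r] \<open>r \<in> {0..t}\<close>
          by (auto intro: has_vector_derivative_within_subset)
      qed (use that in auto)
      then show ?thesis by simp
    qed
    then have "R t u \<bullet> S t u = R 0 u \<bullet> S 0 u" by (rule has_real_derivative_zero_eq[OF _ t])
    also have "\<dots> = (norm u)\<^sup>2"
      using R S by (simp add: contraction_semigroup_def C0_semigroup_def power2_norm_eq_inner)
    finally have "(norm (R t u - S t u))\<^sup>2 = (norm (R t u))\<^sup>2 + (norm (S t u))\<^sup>2 - 2 * (norm u)\<^sup>2"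
      by (simp add: power2_norm_eq_inner inner_diff_left inner_diff_right inner_commute)
    moreover have "(norm (R t u))\<^sup>2 \<le> (norm u)\<^sup>2" "(norm (S t u))\<^sup>2 \<le> (norm u)\<^sup>2"
      using R S t by (auto simp: contraction_semigroup_def intro!: power_mono)
    ultimately have "(norm (R t u - S t u))\<^sup>2 \<le> 0" by linarith
    then show ?thesis by simp
  qed
  have "bounded_linear (T t)" "bounded_linear (T' t)"
    using T T' t by (auto simp: contraction_semigroup_def C0_semigroup_def)
  from contraction_eq_on_dense[OF this skew_symmetric_dense[OF neg_skew_symmetric[OF A]]]
  show ?thesis using eq[OF T] eq[OF T'] by (intro ext) auto
qed

text \<open>If \<open>A\<close> generates a semigroup \<open>S\<close>, duality gives \<open>T t u \<bullet> f = u \<bullet> S t f\<close>.\<close>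

lemma unique_if_generates:
  fixes A :: "'h::{real_inner,banach} op_graph"
  assumes A: "skew_symmetric A" and ran: "range_one_minus 1 A = UNIV"
    and T: "contraction_semigroup T" "weak_evolution A T"
    and T': "contraction_semigroup T'" "weak_evolution A T'" and t: "0 \<le> t"
  shows "T t = T' t"
proof -
  obtain S where S: "contraction_semigroup S"
    and Sg: "\<And>t u w. 0 \<le> t \<Longrightarrow> (u, w) \<in> A \<Longrightarrow> (S t u, S t w) \<in> A"
    and Sd: "\<And>t u w. 0 \<le> t \<Longrightarrow> (u, w) \<in> A \<Longrightarrow>
      ((\<lambda>s. S s u) has_vector_derivative S t w) (at t within {0..})"
    using Lumer_Phillips[OF skew_symmetric_m_dissipative[OF A ran]] by blast
  have S0: "S 0 f = f" for f using S by (auto simp: contraction_semigroup_def C0_semigroup_def)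
  have eq: "R t u \<bullet> f = u \<bullet> S t f" if R: "contraction_semigroup R" "weak_evolution A R"
    and f: "f \<in> Domain A" for R u f
  proof -
    obtain g where g: "(f, g) \<in> A" using f by blast
    have R0: "R 0 u = u" using R by (auto simp: contraction_semigroup_def C0_semigroup_def)
    have "((\<lambda>s. R s u \<bullet> S (t - s) f) has_real_derivative 0) (at s within {0..t})"
      if "s \<in> {0..t}" for s
    proof -
      have "((\<lambda>s. R s u \<bullet> S (t - s) f) has_real_derivative
          R s u \<bullet> S (t - s) g + R s u \<bullet> (- S (t - s) g)) (at s within {0..t})"
      proof (rule weak_evolution_pairing[OF R, where z = "\<lambda>s. S (t - s) g"
            and y' = "\<lambda>s. - S (t - s) g"])
        fix r assume r: "r \<in> {0..t}"
        then show "(S (t - r) f, S (t - r) g) \<in> A" using Sg[OF _ g] by simp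
        have "((\<lambda>s. t - s) has_vector_derivative - 1) (at r within {0..t})"
          by (auto intro!: derivative_eq_intros)
        moreover have "((\<lambda>s. S s f) has_vector_derivative S (t - r) g)
            (at (t - r) within (\<lambda>s. t - s) ` {0..t})"
          using Sd[OF _ g, of "t - r"] r by (auto intro: has_vector_derivative_within_subset)
        ultimately show "((\<lambda>s. S (t - s) f) has_vector_derivative - S (t - r) g) (at r within {0..t})"
          using vector_diff_chain_within[of "\<lambda>s. t - s" "-1" r "{0..t}" "\<lambda>s. S s f"]
          by (simp add: o_def)
      qed (use that in auto)
      then show ?thesis by simp
    qed
    then have "R t u \<bullet> S (t - t) f = R 0 u \<bullet> S (t - 0) f" by (rule has_real_derivative_zero_eq[OF _ t])
    then show ?thesis by (simp add: S0 R0)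
  qed
  show ?thesis
  proof
    fix u
    have "(T t u - T' t u) \<bullet> f = 0" if "f \<in> Domain A" for f
      using eq[OF T that, of u] eq[OF T' that, of u] by (simp add: inner_diff_left)
    then have "T t u - T' t u = 0"
      by (rule orthogonal_to_dense_zero[OF skew_symmetric_dense[OF A]])
    then show "T t u = T' t u" by simp
  qed
qed

lemma mem_range_one_plus:
  assumes "(f, g) \<in> S" shows "f + g \<in> range_one_minus 1 (neg_operator S)"
proof -
  have "(f, - g) \<in> neg_operator S" using assms by (simp add: neg_operator_iff)
  then show ?thesis unfolding range_one_minus_def by force
qed

text \<open>The ranges of \<open>1 - A\<close> and \<open>1 + A\<close> are the initial and final spaces of the Cayley transform.
  If both have a nonzero orthogonal complement, pick \<open>\<psi>\<close> and \<open>\<phi>\<close> of equal norm there; the Cayley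
  transform extends by sending one to the other, and undoing it adds the pair \<open>(p, q)\<close> with
  \<open>p + q = \<phi>\<close> and \<open>p - q = \<psi>\<close> to the graph.\<close>

lemma maximal_skew_symmetric_range:
  fixes A :: "'h::{real_inner,banach} op_graph"
  assumes max: "maximal_skew_symmetric A" and cl: "closed A"
  shows "range_one_minus 1 A = UNIV \<or> range_one_minus 1 (neg_operator A) = UNIV"
proof (rule ccontr)
  assume neg: "\<not> ?thesis"
  have A: "skew_symmetric A" using max by (simp add: maximal_skew_symmetric_def)
  have nA: "skew_symmetric (neg_operator A)" by (rule neg_skew_symmetric[OF A])
  have ex: "\<exists>z. z \<noteq> 0 \<and> (\<forall>y\<in>range_one_minus 1 B. z \<bullet> y = 0)"
    if B: "skew_symmetric B" "closed B" "range_one_minus 1 B \<noteq> UNIV" for B :: "'h op_graph"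
  proof (rule ccontr)
    assume "\<not> ?thesis"
    then have "closure (range_one_minus 1 B) = UNIV"
      using subspace_range_one_minus[OF skew_symmetric_subspace[OF B(1)]]
      by (intro dense_if_orthogonal_complement_trivial) auto
    then show False
      using closed_range_one_minus[OF skew_symmetric_dissipative[OF B(1)] B(2), of 1] B(3) by simp
  qed
  obtain \<psi>0 where \<psi>0: "\<psi>0 \<noteq> 0" "\<And>y. y \<in> range_one_minus 1 A \<Longrightarrow> \<psi>0 \<bullet> y = 0"
    using ex[OF A cl] neg by blast
  obtain \<phi> where \<phi>0: "\<phi> \<noteq> 0" "\<And>y. y \<in> range_one_minus 1 (neg_operator A) \<Longrightarrow> \<phi> \<bullet> y = 0"
    using ex[OF nA closed_neg_operator[OF cl]] neg by blast
  define \<psi> where "\<psi> = (norm \<phi> / norm \<psi>0) *\<^sub>R \<psi>0"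
  have nrm: "norm \<psi> = norm \<phi>" using \<psi>0(1) by (simp add: \<psi>_def)
  have \<psi>: "(f - g) \<bullet> \<psi> = 0" if "(f, g) \<in> A" for f g
  proof -
    have "f - g \<in> range_one_minus 1 A" unfolding range_one_minus_def using that by force
    then have "\<psi>0 \<bullet> (f - g) = 0" by (rule \<psi>0(2))
    then show ?thesis by (simp add: \<psi>_def inner_commute)
  qed
  have \<phi>: "(f + g) \<bullet> \<phi> = 0" if "(f, g) \<in> A" for f g
  proof -
    have "f + g \<in> range_one_minus 1 (neg_operator A)" by (rule mem_range_one_plus[OF that])
    then show ?thesis using \<phi>0(2) by (metis inner_commute)
  qed
  define p q where "p = (1/2) *\<^sub>R (\<phi> + \<psi>)" and "q = (1/2) *\<^sub>R (\<phi> - \<psi>)"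
  have pq: "q \<bullet> p = 0"
  proof -
    have "(\<phi> - \<psi>) \<bullet> (\<phi> + \<psi>) = (norm \<phi>)\<^sup>2 - (norm \<psi>)\<^sup>2"
      by (simp add: power2_norm_eq_inner inner_diff_left inner_diff_right inner_add_left
          inner_add_right inner_commute)
    then show ?thesis by (simp add: p_def q_def nrm)
  qed
  have Apq: "g \<bullet> p + f \<bullet> q = 0" if "(f, g) \<in> A" for f g
    using \<phi>[OF that] \<psi>[OF that]
    by (simp add: p_def q_def inner_add_left inner_add_right inner_diff_left inner_diff_right
        add_divide_distrib diff_divide_distrib)
  define S where "S = {x + y | x y. x \<in> A \<and> y \<in> span {(p, q)}}"
  have sup: "A \<subseteq> S"
  proof
    fix x assume "x \<in> A"
    moreover have "0 \<in> span {(p, q)}" by (rule span_zero)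
    ultimately show "x \<in> S" unfolding S_def by (intro CollectI exI[of _ x] exI[of _ 0]) simp
  qed
  have "skew_symmetric S"
  proof (rule skew_symmetricI)
    show "subspace S" unfolding S_def
      by (intro subspace_sums skew_symmetric_subspace[OF A] subspace_span)
    show "closure (Domain S) = UNIV"
      using sup skew_symmetric_dense[OF A] closure_mono[OF Domain_mono] by blast
  next
    have S_cases: "\<exists>f' g' c. (f', g') \<in> A \<and> f = f' + c *\<^sub>R p \<and> g = g' + c *\<^sub>R q"
      if "(f, g) \<in> S" for f g
      using that by (auto simp: S_def span_singleton)
    fix f g u v assume "(f, g) \<in> S" "(u, v) \<in> S"
    then obtain f' g' c u' v' d where *: "(f', g') \<in> A" "f = f' + c *\<^sub>R p" "g = g' + c *\<^sub>R q"
      "(u', v') \<in> A" "u = u' + d *\<^sub>R p" "v = v' + d *\<^sub>R q"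
      using S_cases by metis
    have "g \<bullet> u + f \<bullet> v = (g' \<bullet> u' + f' \<bullet> v') + d * (g' \<bullet> p + f' \<bullet> q)
        + c * (v' \<bullet> p + u' \<bullet> q) + 2 * c * d * (q \<bullet> p)"
      by (simp add: * inner_add_left inner_add_right inner_commute algebra_simps)
    then show "g \<bullet> u + f \<bullet> v = 0"
      using skew_symmetric_form[OF A *(1,4)] Apq[OF *(1)] Apq[OF *(4)] pq by simp
  qed
  moreover have "A \<subset> S"
  proof -
    have "(p, q) \<in> S"
      unfolding S_def using span_base[of "(p, q)" "{(p, q)}"] subspace_0[OF skew_symmetric_subspace[OF A]]
      by (intro CollectI exI[of _ 0] exI[of _ "(p, q)"]) simp
    moreover have "(p, q) \<notin> A"
    proof
      assume "(p, q) \<in> A"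
      then have "(p + q) \<bullet> \<phi> = 0" by (rule \<phi>)
      moreover have "p + q = \<phi>" by (simp add: p_def q_def scaleR_add_right[symmetric] scaleR_2[symmetric])
      ultimately show False using \<phi>0(1) by simp
    qed
    ultimately show ?thesis using sup by blast
  qed
  ultimately show False using max by (auto simp: maximal_skew_symmetric_def)
qed

text \<open>The dissipative extension of \<open>-S\<close> whose Cayley transform is zero on the complement of the
  range of \<open>1 + S\<close>.\<close>

definition zero_extension :: "'h::real_inner op_graph \<Rightarrow> 'h op_graph" where
  "zero_extension S = {(f + \<phi>, - g - \<phi>) | f g \<phi>. (f, g) \<in> S \<and>
     (\<forall>y\<in>range_one_minus 1 (neg_operator S). \<phi> \<bullet> y = 0)}"

text \<open>The component \<open>\<phi>\<close> is responsible for all the energy lost.\<close>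

lemma zero_extension_form:
  assumes "skew_symmetric S" "(f, g) \<in> S" "\<forall>y\<in>range_one_minus 1 (neg_operator S). \<phi> \<bullet> y = 0"
  shows "(- g - \<phi>) \<bullet> (f + \<phi>) = - (\<phi> \<bullet> \<phi>)"
proof -
  have "\<phi> \<bullet> (f + g) = 0" using assms(3) mem_range_one_plus[OF assms(2)] by blast
  moreover have "g \<bullet> f = 0"
    using skew_symmetric_form[OF assms(1,2,2)] by (simp add: inner_commute)
  ultimately show ?thesis
    by (simp add: inner_add_right inner_diff_left inner_commute algebra_simps)
qed

lemma zero_extension_m_dissipative:
  fixes S :: "'h::{real_inner,banach} op_graph"
  assumes S: "skew_symmetric S" and cl: "closed S"
  shows "m_dissipative (zero_extension S)"
proof
  let ?N = "{\<phi>. \<forall>y\<in>range_one_minus 1 (neg_operator S). \<phi> \<bullet> y = 0}"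
  let ?X = "{x + y | x y. x \<in> neg_operator S \<and> y \<in> (\<lambda>\<phi>. (\<phi>, - \<phi>)) ` ?N}"
  note nS = neg_skew_symmetric[OF S]
  have "zero_extension S = ?X"
  proof (intro set_eqI iffI)
    fix x assume "x \<in> zero_extension S"
    then obtain f g \<phi> where *: "x = (f + \<phi>, - g - \<phi>)" "(f, g) \<in> S" "\<phi> \<in> ?N"
      unfolding zero_extension_def by blast
    then have "x = (f, - g) + (\<phi>, - \<phi>)" "(f, - g) \<in> neg_operator S"
      by (auto simp: neg_operator_iff)
    with *(3) show "x \<in> ?X" by blast
  next
    fix x assume "x \<in> ?X"
    then obtain f g \<phi> where *: "x = (f, g) + (\<phi>, - \<phi>)" "(f, g) \<in> neg_operator S" "\<phi> \<in> ?N"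
      by (auto simp: image_iff)
    then have "x = (f + \<phi>, - (- g) - \<phi>)" "(f, - g) \<in> S" by (auto simp: neg_operator_iff)
    with *(3) show "x \<in> zero_extension S" unfolding zero_extension_def by blast
  qed
  moreover have "subspace ?X"
  proof (intro subspace_sums skew_symmetric_subspace[OF nS] linear_subspace_image)
    show "linear (\<lambda>\<phi>::'h. (\<phi>, - \<phi>))" by (rule linearI) auto
    show "subspace ?N" by (auto simp: subspace_def inner_add_left)
  qed
  moreover have "w \<bullet> u \<le> 0" if "(u, w) \<in> zero_extension S" for u w
    using that zero_extension_form[OF S] by (auto simp: zero_extension_def)
  ultimately show "dissipative (zero_extension S)" unfolding dissipative_def by auto
  have "neg_operator S \<subseteq> zero_extension S"
  proof (clarify)
    fix u w assume "(u, w) \<in> neg_operator S"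
    then have "(u, w) = (u + 0, - (- w) - 0)" "(u, - w) \<in> S" by (auto simp: neg_operator_iff)
    then show "(u, w) \<in> zero_extension S"
      unfolding zero_extension_def by (intro CollectI exI[of _ u] exI[of _ "- w"] exI[of _ 0]) simp
  qed
  then show "closure (Domain (zero_extension S)) = UNIV"
    using skew_symmetric_dense[OF nS] closure_mono[OF Domain_mono] by blast
  show "range_one_minus 1 (zero_extension S) = UNIV"
  proof -
    have "v \<in> range_one_minus 1 (zero_extension S)" for v
    proof -
      have "closed (range_one_minus 1 (neg_operator S))"
        by (intro closed_range_one_minus skew_symmetric_dissipative nS closed_neg_operator cl) simp
      then obtain m where m: "m \<in> range_one_minus 1 (neg_operator S)"
        "\<And>y. y \<in> range_one_minus 1 (neg_operator S) \<Longrightarrow> (v - m) \<bullet> y = 0"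
        using orthogonal_projection_exists[OF subspace_range_one_minus[OF skew_symmetric_subspace[OF nS]]]
        by metis
      obtain f g where fg: "(f, g) \<in> S" "m = f + g"
        using m(1) by (auto simp: range_one_minus_def neg_operator_def)
      \<comment> \<open>\<open>1 - G\<close> sends \<open>(f + \<phi>, - g - \<phi>)\<close> to \<open>(f + g) + 2 \<phi>\<close>, whence the factor one half.\<close>
      define \<phi> where "\<phi> = (1/2) *\<^sub>R (v - m)"
      have "(f + \<phi>, - g - \<phi>) \<in> zero_extension S"
        unfolding zero_extension_def using fg(1) m(2)
        by (intro CollectI exI[of _ f] exI[of _ g] exI[of _ \<phi>]) (simp add: \<phi>_def)
      moreover have "\<phi> + \<phi> = v - m" by (simp add: \<phi>_def scaleR_2[symmetric])
      then have "v = (f + \<phi>) - 1 *\<^sub>R (- g - \<phi>)" by (simp add: fg(2) algebra_simps)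
      ultimately show ?thesis unfolding range_one_minus_def by (force intro: rev_image_eqI)
    qed
    then show ?thesis by blast
  qed
qed

lemma zero_extension_adjoint:
  assumes S: "skew_symmetric S" and "(u, w) \<in> zero_extension S" "(f, g) \<in> S"
  shows "w \<bullet> f = u \<bullet> g"
proof -
  obtain f' g' \<phi> where *: "u = f' + \<phi>" "w = - g' - \<phi>" "(f', g') \<in> S"
    "\<forall>y\<in>range_one_minus 1 (neg_operator S). \<phi> \<bullet> y = 0"
    using assms(2) by (auto simp: zero_extension_def)
  have "\<phi> \<bullet> (f + g) = 0" using *(4) mem_range_one_plus[OF assms(3)] by blast
  moreover have "g' \<bullet> f + f' \<bullet> g = 0" by (rule skew_symmetric_form[OF S *(3) assms(3)])
  ultimately show ?thesis
    by (simp add: *(1,2) inner_add_left inner_add_right inner_diff_left)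
qed

text \<open>For an initial value in the domain of the generator the weak equation is immediate; the
  general case is a uniform limit of these.\<close>

lemma weak_evolution_from_generator:
  fixes G :: "'h::{real_inner,banach} op_graph"
  assumes dense: "closure (Domain G) = UNIV" and T: "contraction_semigroup T"
    and Tg: "\<And>t u w. 0 \<le> t \<Longrightarrow> (u, w) \<in> G \<Longrightarrow> (T t u, T t w) \<in> G"
    and Td: "\<And>t u w. 0 \<le> t \<Longrightarrow> (u, w) \<in> G \<Longrightarrow>
      ((\<lambda>s. T s u) has_vector_derivative T t w) (at t within {0..})"
    and adj: "\<And>u w f g. (u, w) \<in> G \<Longrightarrow> (f, g) \<in> A \<Longrightarrow> w \<bullet> f = u \<bullet> g"
  shows "weak_evolution A T"
  unfolding weak_evolution_def
proof (intro allI ballI, clarify)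
  fix u t f g assume fg: "(f, g) \<in> A" and t: "(0::real) \<le> t"
  have lin: "linear (T s)" and nrm: "norm (T s v) \<le> norm v" if "0 \<le> s" for s v
    using T that by (auto simp: contraction_semigroup_def C0_semigroup_def bounded_linear.linear)
  have "u \<in> closure (Domain G)" by (simp add: dense)
  then obtain v where v: "\<And>n. v n \<in> Domain G" "v \<longlonglongrightarrow> u" unfolding closure_sequential by blast
  have lim: "(\<lambda>n. T s (v n) \<bullet> f) \<longlonglongrightarrow> T s u \<bullet> f" if "0 \<le> s" for s
  proof (intro tendsto_inner tendsto_const, rule bounded_linear.tendsto[OF _ v(2)])
    show "bounded_linear (T s)"
      using T that by (auto simp: contraction_semigroup_def C0_semigroup_def)
  qed
  have "\<exists>\<phi>. \<forall>s\<in>{0..}. (\<lambda>n. T s (v n) \<bullet> f) \<longlonglongrightarrow> \<phi> s \<and>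
      (\<phi> has_derivative (\<lambda>h. (T s u \<bullet> g) * h)) (at s within {0..})"
  proof (rule has_derivative_sequence[where ?x0.0 = 0 and l = "T 0 u \<bullet> f"])
    show "convex {0::real..}" by (rule convex_real_interval)
    fix n s assume s: "s \<in> {0::real..}"
    obtain w where w: "(v n, w) \<in> G" using v(1) by blast
    have "((\<lambda>s. T s (v n) \<bullet> f) has_vector_derivative T s w \<bullet> f) (at s within {0..})"
      using bounded_linear.has_vector_derivative[OF bounded_linear_inner_left Td[OF _ w]] s by auto
    then show "((\<lambda>s. T s (v n) \<bullet> f) has_derivative (\<lambda>h. (T s (v n) \<bullet> g) * h)) (at s within {0..})"
      using adj[OF Tg[OF _ w] fg, of s] s
      by (simp add: has_vector_derivative_def mult.commute[of _ "T s (v n) \<bullet> g"])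
  next
    fix e :: real assume e: "0 < e"
    have "(\<lambda>n. norm (v n - u) * norm g) \<longlonglongrightarrow> 0 * norm g"
      using v(2) by (intro tendsto_intros tendsto_norm_zero LIM_zero)
    then have "\<forall>\<^sub>F n in sequentially. norm (v n - u) * norm g < e"
      using e by (intro order_tendstoD(2)) auto
    then show "\<forall>\<^sub>F n in sequentially. \<forall>s\<in>{0..}. \<forall>h.
        norm ((T s (v n) \<bullet> g) * h - (T s u \<bullet> g) * h) \<le> e * norm h"
    proof (rule eventually_mono, intro ballI allI)
      fix n s h assume n: "norm (v n - u) * norm g < e" and s: "s \<in> {0::real..}"
      have "\<bar>T s (v n) \<bullet> g - T s u \<bullet> g\<bar> = \<bar>T s (v n - u) \<bullet> g\<bar>"
        using lin s by (simp add: linear_diff inner_diff_left)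
      also have "\<dots> \<le> norm (v n - u) * norm g"
        using s by (intro order_trans[OF Cauchy_Schwarz_ineq2] mult_right_mono nrm) auto
      finally have "\<bar>T s (v n) \<bullet> g - T s u \<bullet> g\<bar> * \<bar>h\<bar> \<le> e * \<bar>h\<bar>"
        using n by (intro mult_right_mono) auto
      then show "norm ((T s (v n) \<bullet> g) * h - (T s u \<bullet> g) * h) \<le> e * norm h"
        by (simp add: left_diff_distrib[symmetric] abs_mult)
    qed
  qed (use lim in auto)
  then obtain \<phi> where \<phi>: "\<And>s. 0 \<le> s \<Longrightarrow> (\<lambda>n. T s (v n) \<bullet> f) \<longlonglongrightarrow> \<phi> s"
    "\<And>s. 0 \<le> s \<Longrightarrow> (\<phi> has_derivative (\<lambda>h. (T s u \<bullet> g) * h)) (at s within {0..})" by auto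
  have "\<phi> s = T s u \<bullet> f" if "0 \<le> s" for s using LIMSEQ_unique[OF \<phi>(1) lim] that by blast
  then show "((\<lambda>s. T s u \<bullet> f) has_real_derivative T t u \<bullet> g) (at t within {0..})"
    using has_derivative_transform[OF _ _ \<phi>(2)[OF t], of "\<lambda>s. T s u \<bullet> f"] t
    by (simp add: has_field_derivative_def)
qed

text \<open>A proper skew-symmetric extension \<open>S\<close> of \<open>A\<close> gives a second semigroup, the one generated by
  the zero extension of the closure of \<open>S\<close>. If it coincided with the semigroup of \<open>A\<close>, so would
  the generators. But the generator belonging to \<open>S\<close> extends \<open>-S\<close>, where no energy is lost,
  whereas the one belonging to \<open>A\<close> loses energy everywhere outside \<open>-A\<close>.\<close>

lemma two_semigroups_if_not_maximal:
  fixes A :: "'h::{real_inner,banach} op_graph"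
  assumes A: "skew_symmetric A" and cl: "closed A" and not_max: "\<not> maximal_skew_symmetric A"
  obtains T T' t where "contraction_semigroup T" "weak_evolution A T"
    and "contraction_semigroup T'" "weak_evolution A T'" and "0 \<le> t" "T t \<noteq> T' t"
proof -
  obtain S0 where S0: "skew_symmetric S0" "A \<subset> S0"
    using A not_max by (auto simp: maximal_skew_symmetric_def)
  define S where "S = closure S0"
  have S: "skew_symmetric S" "closed S" "A \<subset> S"
    using closure_skew_symmetric[OF S0(1)] S0(2) closure_subset[of S0] by (auto simp: S_def)
  let ?G = "zero_extension A" and ?G' = "zero_extension S"
  note mG = zero_extension_m_dissipative[OF A cl]
  note mG' = zero_extension_m_dissipative[OF S(1,2)]
  obtain T where T: "contraction_semigroup T"
    and Tg: "\<And>t u w. 0 \<le> t \<Longrightarrow> (u, w) \<in> ?G \<Longrightarrow> (T t u, T t w) \<in> ?G"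
    and Td: "\<And>t u w. 0 \<le> t \<Longrightarrow> (u, w) \<in> ?G \<Longrightarrow>
      ((\<lambda>s. T s u) has_vector_derivative T t w) (at t within {0..})"
    using Lumer_Phillips[OF mG] by blast
  obtain T' where T': "contraction_semigroup T'"
    and T'g: "\<And>t u w. 0 \<le> t \<Longrightarrow> (u, w) \<in> ?G' \<Longrightarrow> (T' t u, T' t w) \<in> ?G'"
    and T'd: "\<And>t u w. 0 \<le> t \<Longrightarrow> (u, w) \<in> ?G' \<Longrightarrow>
      ((\<lambda>s. T' s u) has_vector_derivative T' t w) (at t within {0..})"
    using Lumer_Phillips[OF mG'] by blast
  have w: "weak_evolution A T"
    by (rule weak_evolution_from_generator[OF m_dissipative.dense[OF mG] T Tg Td
          zero_extension_adjoint[OF A]])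
  have w': "weak_evolution A T'"
    by (rule weak_evolution_from_generator[OF m_dissipative.dense[OF mG'] T' T'g T'd])
      (use zero_extension_adjoint[OF S(1)] S(3) in blast)+
  have False if same: "\<And>t. 0 \<le> t \<Longrightarrow> T t = T' t"
  proof -
    obtain f g where fg: "(f, g) \<in> S" "(f, g) \<notin> A" using S(3) by auto
    have fg': "(f, - g) \<in> ?G'"
      unfolding zero_extension_def using fg(1)
      by (intro CollectI exI[of _ f] exI[of _ g] exI[of _ 0]) simp
    \<comment> \<open>Compare with the element of the generator of \<open>A\<close> that has the same image under \<open>1 - G\<close>; the
      difference \<open>p\<close> would be an eigenvector for the eigenvalue one.\<close>
    obtain u w where uw: "(u, w) \<in> ?G" "u - w = f - (- g)"
      by (rule m_dissipative.range1E[OF mG])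
    define p where "p = u - f"
    have pw: "p = w - (- g)" using uw(2) by (simp add: p_def algebra_simps)
    have T0: "T 0 x = x" "T' 0 x = x" for x
      using T T' by (auto simp: contraction_semigroup_def C0_semigroup_def)
    have lin: "linear (T s)" if "0 \<le> s" for s
      using T that by (auto simp: contraction_semigroup_def C0_semigroup_def bounded_linear.linear)
    have "((\<lambda>s. T s u - T' s f) has_vector_derivative T 0 w - T' 0 (- g)) (at 0 within {0..})"
      by (intro has_vector_derivative_diff Td T'd uw(1) fg') auto
    then have "((\<lambda>s. T s u - T' s f) has_vector_derivative p) (at 0 within {0..})"
      by (simp add: T0 pw)
    then have "((\<lambda>s. T s p) has_vector_derivative p) (at 0 within {0..})"
      by (rule has_vector_derivative_transform[rotated 2])
        (auto simp: p_def linear_diff[OF lin] same[symmetric])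
    then have deriv: "((\<lambda>s. T s p \<bullet> p) has_real_derivative p \<bullet> p) (at 0 within {0..})"
      using bounded_linear.has_vector_derivative[OF bounded_linear_inner_left]
      by (auto simp: has_real_derivative_iff_has_vector_derivative)
    have "p = 0"
    proof (rule ccontr)
      assume "p \<noteq> 0"
      then have "0 < p \<bullet> p" by simp
      from has_real_derivative_pos_inc_right[OF deriv this]
      obtain d where d: "0 < d" "\<And>h. 0 < h \<Longrightarrow> 0 + h \<in> {0..} \<Longrightarrow> h < d \<Longrightarrow> T 0 p \<bullet> p < T (0 + h) p \<bullet> p"
        by blast
      then have "p \<bullet> p < T (d/2) p \<bullet> p" using d(2)[of "d/2"] by (simp add: T0)
      also have "\<dots> \<le> norm (T (d/2) p) * norm p" by (rule norm_cauchy_schwarz)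
      also have "\<dots> \<le> norm p * norm p"
        using T d(1) by (intro mult_right_mono) (auto simp: contraction_semigroup_def)
      finally show False by (simp add: norm_eq_sqrt_inner)
    qed
    then have "u = f" "w = - g" using pw by (auto simp: p_def eq_neg_iff_add_eq_0)
    then have "(f, - g) \<in> ?G" using uw(1) by simp
    then obtain f' g' \<phi> where *: "f = f' + \<phi>" "- g = - g' - \<phi>" "(f', g') \<in> A"
      "\<forall>y\<in>range_one_minus 1 (neg_operator A). \<phi> \<bullet> y = 0"
      by (auto simp: zero_extension_def)
    have "(- g) \<bullet> f = - (\<phi> \<bullet> \<phi>)"
      using zero_extension_form[OF A *(3,4)] by (simp only: *(1,2))
    moreover have "g \<bullet> f = 0"
      using skew_symmetric_form[OF S(1) fg(1) fg(1)] by (simp add: inner_commute)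
    ultimately have "\<phi> = 0" by simp
    then have "f = f'" "g = g'" using *(1,2) by auto
    with *(3) fg(2) show False by simp
  qed
  then show ?thesis using that[OF T w T' w'] by blast
qed

theorem unique_weak_evolution_iff_maximal:
  fixes A :: "'h::{real_inner,banach} op_graph"
  assumes A: "skew_symmetric A" and cl: "closed A"
  shows "(\<forall>T T'. contraction_semigroup T \<and> weak_evolution A T \<and>
                 contraction_semigroup T' \<and> weak_evolution A T'
                 \<longrightarrow> (\<forall>t\<ge>0. T t = T' t))
         \<longleftrightarrow> maximal_skew_symmetric A"
proof (intro iffI allI impI; (elim conjE)?)
  fix T T' t
  assume "maximal_skew_symmetric A"
    and T: "contraction_semigroup T" "weak_evolution A T"
      "contraction_semigroup T'" "weak_evolution A T'" and t: "(0::real) \<le> t"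
  then consider "range_one_minus 1 A = UNIV" | "range_one_minus 1 (neg_operator A) = UNIV"
    using maximal_skew_symmetric_range[OF _ cl] by blast
  then show "T t = T' t"
    using unique_if_generates[OF A _ T t] unique_if_neg_generates[OF A _ T t] by cases auto
next
  assume u: "\<forall>T T'. contraction_semigroup T \<and> weak_evolution A T \<and>
    contraction_semigroup T' \<and> weak_evolution A T' \<longrightarrow> (\<forall>t\<ge>0. T t = T' t)"
  show "maximal_skew_symmetric A"
  proof (rule ccontr)
    assume "\<not> ?thesis"
    then obtain T T' t where "contraction_semigroup T" "weak_evolution A T"
      "contraction_semigroup T'" "weak_evolution A T'" "0 \<le> t" "T t \<noteq> T' t"
      using two_semigroups_if_not_maximal[OF A cl] by metis
    with u show False by blast
  qed
qed

section \<open>Completeness of the space of square-integrable functions\<close>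

lemma square_integrable_rep: "square_integrable (rep_L2 v)"
  using Quotient_rep_reflp[OF Quotient_L2, of v] by (simp add: L2_eq_def)

lemma abs_rep_L2 [simp]: "abs_L2 (rep_L2 v) = v"
  by (rule Quotient_abs_rep[OF Quotient_L2])

lemma L2_eq_refl: "square_integrable f \<Longrightarrow> L2_eq f f"
  by (simp add: L2_eq_def)

lemma abs_L2_eqI:
  "square_integrable f \<Longrightarrow> square_integrable g \<Longrightarrow> AE x in lebesgue. f x = g x \<Longrightarrow> abs_L2 f = abs_L2 g"
  by (rule Quotient_rel_abs[OF Quotient_L2]) (simp add: L2_eq_def)

lemma inner_abs_L2:
  "square_integrable f \<Longrightarrow> square_integrable g \<Longrightarrow> abs_L2 f \<bullet> abs_L2 g = (LINT x|lebesgue. f x * g x)"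
  by (simp add: inner_L2.abs_eq L2_eq_refl)

lemma plus_abs_L2:
  "square_integrable f \<Longrightarrow> square_integrable g \<Longrightarrow> abs_L2 f + abs_L2 g = abs_L2 (\<lambda>x. f x + g x)"
  by (simp add: plus_L2.abs_eq L2_eq_refl)

lemma minus_abs_L2:
  "square_integrable f \<Longrightarrow> square_integrable g \<Longrightarrow> abs_L2 f - abs_L2 g = abs_L2 (\<lambda>x. f x - g x)"
  by (simp add: minus_L2.abs_eq L2_eq_refl)

lemma scaleR_abs_L2: "square_integrable f \<Longrightarrow> c *\<^sub>R abs_L2 f = abs_L2 (\<lambda>x. c * f x)"
  by (simp add: scaleR_L2.abs_eq L2_eq_refl)

lemma inner_abs_L2_right:
  assumes "square_integrable f" shows "u \<bullet> abs_L2 f = (LINT x|lebesgue. rep_L2 u x * f x)"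
  using inner_abs_L2[OF square_integrable_rep[of u] assms] by simp

lemma norm_abs_L2:
  assumes "square_integrable f"
  shows "(norm (abs_L2 f))\<^sup>2 = (LINT x|lebesgue. (f x)\<^sup>2)"
  unfolding power2_norm_eq_inner inner_abs_L2[OF assms assms] by (simp add: power2_eq_square)

lemma nn_integral_square:
  assumes "square_integrable f"
  shows "(\<integral>\<^sup>+x. ennreal ((f x)\<^sup>2) \<partial>lebesgue) = ennreal ((norm (abs_L2 f))\<^sup>2)"
  unfolding norm_abs_L2[OF assms]
  using assms by (intro nn_integral_eq_integral) (auto simp: square_integrable_def)

lemma square_integrable_if_nn_integral_finite:
  assumes "f \<in> borel_measurable lebesgue" "(\<integral>\<^sup>+x. ennreal ((f x)\<^sup>2) \<partial>lebesgue) < \<infinity>"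
  shows "square_integrable f"
  using assms by (auto simp: square_integrable_def intro!: integrableI_bounded)

lemma norm_le_if_nn_integral_le:
  assumes "square_integrable f" "(\<integral>\<^sup>+x. ennreal ((f x)\<^sup>2) \<partial>lebesgue) \<le> ennreal (c\<^sup>2)" "0 \<le> c"
  shows "norm (abs_L2 f) \<le> c"
proof -
  have "(norm (abs_L2 f))\<^sup>2 \<le> c\<^sup>2"
    using assms(2) by (simp add: nn_integral_square[OF assms(1)] ennreal_le_iff)
  then show ?thesis using assms(3) by (rule power2_le_imp_le)
qed

text \<open>By monotone convergence the series has a finite integral. The weights \<open>c\<close> will trade part of
  the decay of the norms for control of the series without squares.\<close>

lemma AE_summable_squares:
  fixes d :: "nat \<Rightarrow> 'a::euclidean_space \<Rightarrow> real" and c b :: "nat \<Rightarrow> real"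
  assumes d: "\<And>k. square_integrable (d k)" and c: "\<And>k. 0 \<le> c k"
    and le: "\<And>k. c k * (norm (abs_L2 (d k)))\<^sup>2 \<le> b k" and b: "summable b"
  shows "AE x in lebesgue. summable (\<lambda>k. c k * (d k x)\<^sup>2)"
proof -
  have m: "(\<lambda>x. d k x) \<in> borel_measurable lebesgue" for k
    using d[of k] by (simp add: square_integrable_def)
  have b0: "0 \<le> b k" for k
    using le[of k] c[of k] by (meson mult_nonneg_nonneg order_trans zero_le_power2)
  have int: "(\<integral>\<^sup>+x. ennreal (c k * (d k x)\<^sup>2) \<partial>lebesgue) \<le> ennreal (b k)" for k
  proof -
    have "(\<integral>\<^sup>+x. ennreal (c k * (d k x)\<^sup>2) \<partial>lebesgue)
        = (\<integral>\<^sup>+x. ennreal (c k) * ennreal ((d k x)\<^sup>2) \<partial>lebesgue)"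
      using c by (simp add: ennreal_mult)
    also have "\<dots> = ennreal (c k) * ennreal ((norm (abs_L2 (d k)))\<^sup>2)"
      using m[of k] by (subst nn_integral_cmult) (auto simp: nn_integral_square[OF d])
    also have "\<dots> = ennreal (c k * (norm (abs_L2 (d k)))\<^sup>2)" using c by (simp add: ennreal_mult)
    also have "\<dots> \<le> ennreal (b k)" using le by (rule ennreal_leI)
    finally show ?thesis .
  qed
  have "(\<integral>\<^sup>+x. (\<Sum>k. ennreal (c k * (d k x)\<^sup>2)) \<partial>lebesgue)
      = (\<Sum>k. \<integral>\<^sup>+x. ennreal (c k * (d k x)\<^sup>2) \<partial>lebesgue)"
    using m by (intro nn_integral_suminf) auto
  also have "\<dots> \<le> (\<Sum>k. ennreal (b k))"
    using int by (intro suminf_le) auto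
  also have "\<dots> < \<infinity>" using b b0 by (simp add: suminf_ennreal2 less_top[symmetric])
  finally have "AE x in lebesgue. (\<Sum>k. ennreal (c k * (d k x)\<^sup>2)) \<noteq> \<infinity>"
    using m by (intro nn_integral_noteq_infinite) (auto simp: less_top)
  then show ?thesis
  proof (rule AE_mp, intro AE_I2 impI)
    fix x assume "(\<Sum>k. ennreal (c k * (d k x)\<^sup>2)) \<noteq> \<infinity>"
    then show "summable (\<lambda>k. c k * (d k x)\<^sup>2)" using c by (intro summable_suminf_not_top) auto
  qed
qed

lemma AE_tendsto_if_rapid:
  fixes f :: "nat \<Rightarrow> 'a::euclidean_space \<Rightarrow> real"
  assumes f: "\<And>k. square_integrable (f k)" and le: "\<And>k. norm (abs_L2 (f k) - v) \<le> (1/2) ^ k"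
  shows "AE x in lebesgue. (\<lambda>k. f k x) \<longlonglongrightarrow> rep_L2 v x"
proof -
  have sq: "square_integrable (\<lambda>x. f k x - rep_L2 v x)" for k
    by (intro square_integrable_diff f square_integrable_rep)
  have "AE x in lebesgue. summable (\<lambda>k. 1 * (f k x - rep_L2 v x)\<^sup>2)"
  proof (rule AE_summable_squares[OF sq])
    fix k
    have "abs_L2 (\<lambda>x. f k x - rep_L2 v x) = abs_L2 (f k) - v"
      using minus_abs_L2[OF f square_integrable_rep, of k v] by simp
    then have "(norm (abs_L2 (\<lambda>x. f k x - rep_L2 v x)))\<^sup>2 \<le> ((1/2) ^ k)\<^sup>2"
      using le[of k] by (simp add: power_mono)
    also have "\<dots> = (1/4) ^ k" by (simp add: power2_eq_square power_mult_distrib[symmetric])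
    finally show "1 * (norm (abs_L2 (\<lambda>x. f k x - rep_L2 v x)))\<^sup>2 \<le> (1/4) ^ k" by simp
  qed simp_all
  then show ?thesis
  proof (rule AE_mp, intro AE_I2 impI)
    fix x assume "summable (\<lambda>k. 1 * (f k x - rep_L2 v x)\<^sup>2)"
    then have "(\<lambda>k. (f k x - rep_L2 v x)\<^sup>2) \<longlonglongrightarrow> 0" by (auto dest: summable_LIMSEQ_zero)
    from tendsto_real_sqrt[OF this] have "(\<lambda>k. \<bar>f k x - rep_L2 v x\<bar>) \<longlonglongrightarrow> 0" by simp
    then show "(\<lambda>k. f k x) \<longlonglongrightarrow> rep_L2 v x" by (rule LIM_zero_cancel[OF tendsto_rabs_zero_cancel])
  qed
qed

text \<open>Riesz-Fischer: a sequence whose increments are at most \<open>2\<^sup>-\<^sup>k\<close> converges almost everywhere,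
  because \<open>2 |e| \<le> 2\<^sup>k e\<^sup>2 + 2\<^sup>-\<^sup>k\<close> bounds the series of its increments, and by Fatou's lemma the
  pointwise limit is also the limit in the mean.\<close>

instance L2 :: (euclidean_space) banach
proof
  fix X :: "nat \<Rightarrow> 'a L2" assume X: "Cauchy X"
  have "\<exists>N. \<forall>m\<ge>N. \<forall>n\<ge>N. norm (X m - X n) < (1/2) ^ k" for k :: nat
    using CauchyD[OF X] by simp
  then obtain N where N: "\<And>k m n. N k \<le> m \<Longrightarrow> N k \<le> n \<Longrightarrow> norm (X m - X n) < (1/2) ^ k" by metis
  define r where "r k = (\<Sum>i\<le>k. Suc (N i))" for k
  have r: "strict_mono r" by (auto simp: strict_mono_Suc_iff r_def)
  have rN: "N k \<le> r m" if "k \<le> m" for k m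
  proof -
    have "Suc (N k) \<le> r k" unfolding r_def by (rule member_le_sum) auto
    also have "r k \<le> r m" using r that by (simp add: strict_mono_less_eq)
    finally show ?thesis by simp
  qed
  define f where "f k = rep_L2 (X (r k))" for k
  have f: "square_integrable (f k)" for k by (simp add: f_def square_integrable_rep)
  have fm: "f k \<in> borel_measurable lebesgue" for k using f by (simp add: square_integrable_def)
  have fd: "square_integrable (\<lambda>x. f m x - f k x)" for m k by (intro square_integrable_diff f)
  have fn: "norm (abs_L2 (\<lambda>x. f m x - f k x)) \<le> (1/2) ^ k" if "k \<le> m" for m k
  proof -
    have "abs_L2 (\<lambda>x. f m x - f k x) = X (r m) - X (r k)"
      using minus_abs_L2[OF f[of m] f[of k]] by (simp add: f_def)
    then show ?thesis using N[OF rN[OF that] rN[OF order_refl]] by (simp add: less_imp_le)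
  qed
  have "AE x in lebesgue. summable (\<lambda>k. 2 ^ k * (f (Suc k) x - f k x)\<^sup>2)"
  proof (rule AE_summable_squares[OF fd])
    fix k
    have "2 ^ k * (norm (abs_L2 (\<lambda>x. f (Suc k) x - f k x)))\<^sup>2 \<le> 2 ^ k * ((1/2) ^ k)\<^sup>2"
      using fn[of k "Suc k"] by (intro mult_left_mono power_mono) auto
    also have "\<dots> = (2 * (1/2)) ^ k * (1/2::real) ^ k"
      unfolding power_mult_distrib power2_eq_square by (simp only: mult.assoc)
    finally show "2 ^ k * (norm (abs_L2 (\<lambda>x. f (Suc k) x - f k x)))\<^sup>2 \<le> (1/2) ^ k" by simp
  qed simp_all
  moreover have "convergent (\<lambda>k. f k x)"
    if s: "summable (\<lambda>k. 2 ^ k * (f (Suc k) x - f k x)\<^sup>2)" for x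
  proof -
    have inc: "norm (f (Suc k) x - f k x) \<le> 2 ^ k * (f (Suc k) x - f k x)\<^sup>2 + (1/2) ^ k" for k
    proof -
      define e where "e = \<bar>f (Suc k) x - f k x\<bar>"
      have "0 \<le> (2 ^ k * e - 1)\<^sup>2" by simp
      then have "2 ^ k * (2 * e) \<le> 2 ^ k * (2 ^ k * e\<^sup>2) + 1"
        by (simp add: power2_diff power_mult_distrib) (simp add: power2_eq_square algebra_simps)
      then have "(1/2) ^ k * (2 ^ k * (2 * e)) \<le> (1/2) ^ k * (2 ^ k * (2 ^ k * e\<^sup>2) + 1)"
        by (intro mult_left_mono) auto
      moreover have "(1/2) ^ k * (2 ^ k * y) = y" for y :: real
        by (simp add: mult.assoc[symmetric] power_mult_distrib[symmetric])
      ultimately have "2 * e \<le> 2 ^ k * e\<^sup>2 + (1/2) ^ k" by (simp add: distrib_left)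
      moreover have "0 \<le> e" by (simp add: e_def)
      ultimately have "e \<le> 2 ^ k * e\<^sup>2 + (1/2) ^ k" by linarith
      then show ?thesis by (simp add: e_def)
    qed
    have "summable (\<lambda>k. 2 ^ k * (f (Suc k) x - f k x)\<^sup>2 + (1/2) ^ k)"
      by (rule summable_add[OF s summable_geometric]) simp
    then have "summable (\<lambda>k. f (Suc k) x - f k x)"
      by (rule summable_comparison_test'[where N = 0]) (rule inc)
    then have "convergent (\<lambda>n. \<Sum>k<n. f (Suc k) x - f k x)"
      by (simp add: summable_iff_convergent)
    then have "convergent (\<lambda>n. (f n x - f 0 x) + f 0 x)"
      by (intro convergent_add convergent_const) (simp add: sum_lessThan_telescope[of "\<lambda>k. f k x"])
    then show ?thesis by simp
  qed
  ultimately have conv: "AE x in lebesgue. convergent (\<lambda>k. f k x)" by auto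
  define F where "F x = lim (\<lambda>k. f k x)" for x
  have Fm: "F \<in> borel_measurable lebesgue"
    unfolding F_def[abs_def] using fm by (rule borel_measurable_lim_metric)
  have lim: "AE x in lebesgue. (\<lambda>k. f k x) \<longlonglongrightarrow> F x"
    using conv by (simp add: F_def convergent_LIMSEQ_iff)
  have le: "(\<integral>\<^sup>+x. ennreal ((F x - f k x)\<^sup>2) \<partial>lebesgue) \<le> ennreal (((1/2) ^ k)\<^sup>2)" for k
  proof -
    have "(\<integral>\<^sup>+x. ennreal ((F x - f k x)\<^sup>2) \<partial>lebesgue)
        = (\<integral>\<^sup>+x. liminf (\<lambda>m. ennreal ((f m x - f k x)\<^sup>2)) \<partial>lebesgue)"
    proof (rule nn_integral_cong_AE, rule AE_mp[OF lim], intro AE_I2 impI)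
      fix x assume "(\<lambda>k. f k x) \<longlonglongrightarrow> F x"
      then have "(\<lambda>m. ennreal ((f m x - f k x)\<^sup>2)) \<longlonglongrightarrow> ennreal ((F x - f k x)\<^sup>2)"
        by (intro tendsto_ennrealI tendsto_intros)
      from lim_imp_Liminf[OF trivial_limit_sequentially this]
      show "ennreal ((F x - f k x)\<^sup>2) = liminf (\<lambda>m. ennreal ((f m x - f k x)\<^sup>2))" by simp
    qed
    also have "\<dots> \<le> liminf (\<lambda>m. \<integral>\<^sup>+x. ennreal ((f m x - f k x)\<^sup>2) \<partial>lebesgue)"
      using fm by (intro nn_integral_liminf) auto
    also have "\<dots> \<le> ennreal (((1/2) ^ k)\<^sup>2)"
    proof (rule Liminf_le)
      have "(\<integral>\<^sup>+x. ennreal ((f m x - f k x)\<^sup>2) \<partial>lebesgue) \<le> ennreal (((1/2) ^ k)\<^sup>2)" if "k \<le> m" for m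
        unfolding nn_integral_square[OF fd] using fn[OF that] by (intro ennreal_leI power_mono) auto
      then show "\<forall>\<^sub>F m in sequentially.
          (\<integral>\<^sup>+x. ennreal ((f m x - f k x)\<^sup>2) \<partial>lebesgue) \<le> ennreal (((1/2) ^ k)\<^sup>2)"
        by (auto simp: eventually_sequentially)
    qed simp
    finally show ?thesis .
  qed
  have Fd: "square_integrable (\<lambda>x. F x - f k x)" for k
    using Fm fm le[of k] by (intro square_integrable_if_nn_integral_finite)
      (auto intro: le_less_trans)
  have F: "square_integrable F" using square_integrable_add[OF Fd f, of 0 0] by simp
  have "(X \<circ> r) \<longlonglongrightarrow> abs_L2 F"
  proof (rule LIM_zero_cancel, rule Lim_null_comparison)
    have "norm (abs_L2 F - X (r k)) \<le> (1/2) ^ k" for k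
      using norm_le_if_nn_integral_le[OF Fd le] minus_abs_L2[OF F f, of k] by (simp add: f_def)
    then show "\<forall>\<^sub>F k in sequentially. norm ((X \<circ> r) k - abs_L2 F) \<le> (1/2) ^ k"
      by (simp add: norm_minus_commute)
  qed (simp add: LIMSEQ_realpow_zero)
  then show "convergent X" using Cauchy_converges_subseq[OF X r] by (auto simp: convergent_def)
qed

section \<open>Calculus of smooth functions\<close>

lemma C_k_1_has_derivative:
  assumes "C_k (Suc k) f" shows "(f has_derivative (\<lambda>h. grad f x \<bullet> h)) (at x)"
proof -
  let ?D = "frechet_derivative f (at x)"
  have D: "(f has_derivative ?D) (at x)" using assms by (simp add: frechet_derivative_works)
  then have lin: "linear ?D" by (rule has_derivative_linear)
  have "?D h = grad f x \<bullet> h" for h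
  proof -
    have "?D h = ?D (\<Sum>b\<in>Basis. (h \<bullet> b) *\<^sub>R b)" by (simp add: euclidean_representation)
    also have "\<dots> = (\<Sum>b\<in>Basis. (h \<bullet> b) * ?D b)" by (simp add: linear_sum[OF lin] linear_scale[OF lin])
    also have "\<dots> = grad f x \<bullet> h"
      unfolding grad_def inner_sum_left by (simp add: inner_commute mult.commute)
    finally show ?thesis .
  qed
  then have "?D = (\<lambda>h. grad f x \<bullet> h)" by blast
  with D show ?thesis by simp
qed

lemma grad_inner_Basis:
  assumes "(f has_derivative f') (at x)" "b \<in> Basis" shows "grad f x \<bullet> b = f' b"
proof -
  have "frechet_derivative f (at x) = f'" using frechet_derivative_at[OF assms(1)] by simp
  then show ?thesis using assms(2) by (simp add: grad_def inner_sum_left inner_Basis if_distrib cong: if_cong)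
qed

lemma grad_eqI:
  assumes "(f has_derivative (\<lambda>h. g \<bullet> h)) (at x)" shows "grad f x = g"
  by (rule euclidean_eqI) (use grad_inner_Basis[OF assms] in simp)

lemma C_k_Suc_iff:
  assumes "\<And>x. (f has_derivative f' x) (at x)"
  shows "C_k (Suc k) f \<longleftrightarrow> (\<forall>b\<in>Basis. C_k k (\<lambda>x. f' x b))"
proof -
  have "frechet_derivative f (at x) = f' x" for x using frechet_derivative_at[OF assms] by simp
  then show ?thesis using assms by (auto simp: differentiable_def)
qed

lemma C_k_Suc_grad:
  "C_k (Suc k) f \<longleftrightarrow> (\<forall>x. f differentiable (at x)) \<and> (\<forall>b\<in>Basis. C_k k (\<lambda>x. grad f x \<bullet> b))"
proof -
  have "frechet_derivative f (at x) b = grad f x \<bullet> b" if "b \<in> Basis" "f differentiable at x" for x b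
    using grad_inner_Basis[OF frechet_derivative_works[THEN iffD1, OF that(2)] that(1)] by simp
  then show ?thesis by auto
qed

lemma C_k_continuous: "C_k k f \<Longrightarrow> continuous_on UNIV f"
  by (cases k) (auto intro!: differentiable_imp_continuous_on simp: differentiable_on_def
      intro: differentiable_at_withinI)

lemma C_k_SucD: "C_k (Suc k) f \<Longrightarrow> C_k k f"
proof (induction k arbitrary: f)
  case 0 then show ?case using C_k_continuous[OF 0] by simp
next
  case (Suc k)
  have "C_k (Suc k) (\<lambda>x. frechet_derivative f (at x) b)" if "b \<in> Basis" for b
    using Suc.prems that by simp
  then show ?case using Suc.prems Suc.IH by simp
qed

lemma C_k_le: "C_k m f \<Longrightarrow> k \<le> m \<Longrightarrow> C_k k f"
  by (induction m) (use C_k_SucD le_Suc_eq in blast)+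

lemma continuous_grad: "C_k (Suc k) f \<Longrightarrow> continuous_on UNIV (grad f)"
  unfolding grad_def[abs_def] by (intro continuous_intros) (auto dest: C_k_continuous)

lemma C_k_const [simp]: "C_k k (\<lambda>x. c)"
proof (induction k arbitrary: c)
  case (Suc k)
  have "((\<lambda>x::'a. c) has_derivative (\<lambda>h. 0)) (at x)" for x by simp
  from C_k_Suc_iff[OF this, of k] show ?case using Suc by (simp del: C_k.simps)
qed simp

lemma C_k_add: "C_k k f \<Longrightarrow> C_k k g \<Longrightarrow> C_k k (\<lambda>x. f x + g x)"
proof (induction k arbitrary: f g)
  case (Suc k)
  have "((\<lambda>x. f x + g x) has_derivative (\<lambda>h. grad f x \<bullet> h + grad g x \<bullet> h)) (at x)" for x
    by (intro has_derivative_add Suc.prems[THEN C_k_1_has_derivative])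
  then show ?case using Suc by (subst C_k_Suc_iff) (auto simp: C_k_Suc_grad simp del: C_k.simps)
qed (simp add: continuous_on_add)

lemma C_k_mult: "C_k k f \<Longrightarrow> C_k k g \<Longrightarrow> C_k k (\<lambda>x. f x * g x)"
proof (induction k arbitrary: f g)
  case (Suc k)
  have "((\<lambda>x. f x * g x) has_derivative (\<lambda>h. f x * (grad g x \<bullet> h) + (grad f x \<bullet> h) * g x)) (at x)"
    for x by (intro has_derivative_mult Suc.prems[THEN C_k_1_has_derivative])
  then show ?case
    using Suc C_k_SucD[OF Suc.prems(1)] C_k_SucD[OF Suc.prems(2)]
    by (subst C_k_Suc_iff) (auto simp: C_k_Suc_grad simp del: C_k.simps intro!: C_k_add)
qed (simp add: continuous_on_mult)

lemma C_k_cmult: "C_k k f \<Longrightarrow> C_k k (\<lambda>x. c * f x)"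
  by (intro C_k_mult C_k_const)

lemma C_k_sum: "(\<And>i. i \<in> I \<Longrightarrow> C_k k (f i)) \<Longrightarrow> C_k k (\<lambda>x. \<Sum>i\<in>I. f i x)"
  by (induction I rule: infinite_finite_induct) (auto intro!: C_k_add)

lemma C_k_prod: "(\<And>i. i \<in> I \<Longrightarrow> C_k k (f i)) \<Longrightarrow> C_k k (\<lambda>x. \<Prod>i\<in>I. f i x)"
  by (induction I rule: infinite_finite_induct) (auto intro!: C_k_mult)

lemma C_k_inverse: "C_k k f \<Longrightarrow> (\<And>x. f x \<noteq> 0) \<Longrightarrow> C_k k (\<lambda>x. inverse (f x))"
proof (induction k arbitrary: f)
  case (Suc k)
  have "((\<lambda>x. inverse (f x)) has_derivative
      (\<lambda>h. - (inverse (f x) * (grad f x \<bullet> h) * inverse (f x)))) (at x)" for x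
    by (rule Deriv.has_derivative_inverse[OF Suc.prems(2) C_k_1_has_derivative[OF Suc.prems(1)]])
  moreover have "C_k k (\<lambda>x. - (inverse (f x) * (grad f x \<bullet> b) * inverse (f x)))" if "b \<in> Basis" for b
  proof -
    have "C_k k (\<lambda>x. (-1) * (inverse (f x) * (grad f x \<bullet> b) * inverse (f x)))"
      using Suc.IH[OF C_k_SucD[OF Suc.prems(1)] Suc.prems(2)] Suc.prems(1) that
      by (intro C_k_mult C_k_const) (auto simp: C_k_Suc_grad simp del: C_k.simps)
    then show ?thesis by simp
  qed
  ultimately show ?case by (subst C_k_Suc_iff) auto
qed (simp add: continuous_on_inverse)

lemma C_k_affine:
  fixes L :: "'b::euclidean_space \<Rightarrow> 'a::euclidean_space"
  assumes L: "bounded_linear L" shows "C_k k f \<Longrightarrow> C_k k (\<lambda>x. f (L x + c))"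
proof (induction k arbitrary: f)
  case 0
  have "continuous_on UNIV (\<lambda>x. L x + c)"
    by (intro continuous_intros linear_continuous_on L)
  then show ?case using 0 continuous_on_compose2[of UNIV f UNIV "\<lambda>x. L x + c"] by auto
next
  case (Suc k)
  have "((\<lambda>x. f (L x + c)) has_derivative (\<lambda>h. grad f (L x + c) \<bullet> L h)) (at x)" for x
  proof -
    have "((\<lambda>x. L x + c) has_derivative L) (at x)"
      using has_derivative_add[OF bounded_linear_imp_has_derivative[OF L] has_derivative_const] by simp
    from has_derivative_compose[OF this C_k_1_has_derivative[OF Suc.prems]] show ?thesis by simp
  qed
  moreover have "C_k k (\<lambda>x. grad f (L x + c) \<bullet> L b)" for b
  proof -
    have "C_k k (\<lambda>x. \<Sum>j\<in>Basis. (L b \<bullet> j) * (grad f (L x + c) \<bullet> j))"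
      using Suc.prems by (intro C_k_sum C_k_cmult Suc.IH) (auto simp: C_k_Suc_grad simp del: C_k.simps)
    moreover have "(\<Sum>j\<in>Basis. (L b \<bullet> j) * (y \<bullet> j)) = y \<bullet> L b" for y
      by (subst euclidean_inner[of y "L b"]) (simp add: mult.commute)
    ultimately show ?thesis by simp
  qed
  ultimately show ?case by (subst C_k_Suc_iff) auto
qed

lemma C_k_real_derivative:
  fixes f :: "real \<Rightarrow> real"
  assumes "\<And>t. (f has_real_derivative f' t) (at t)" "C_k k f'" shows "C_k (Suc k) f"
  using assms(2) by (subst C_k_Suc_iff[OF assms(1)[unfolded has_field_derivative_def]]) simp

lemma compact_support_iff: "compact_support f \<longleftrightarrow> bounded {x. f x \<noteq> 0}"
  unfolding compact_support_def compact_eq_bounded_closed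
  by (auto intro: bounded_closure bounded_subset[OF _ closure_subset])

section \<open>Smooth cutoff functions\<close>

text \<open>The functions \<open>p(1/t) exp(-1/t)\<close>, extended by zero to \<open>t \<le> 0\<close>. With \<open>p\<close> ranging over all
  polynomials this family is closed under differentiation, so its members are smooth.\<close>

definition flat :: "real poly \<Rightarrow> real \<Rightarrow> real" where
  "flat p t = (if t > 0 then poly p (1/t) * exp (- (1/t)) else 0)"

lemma poly_exp_tendsto_0: "((\<lambda>y. poly p y * exp (- y)) \<longlongrightarrow> 0) at_top" for p :: "real poly"
proof -
  have "((\<lambda>y::real. \<Sum>i\<le>degree p. coeff p i * (y ^ i / exp y)) \<longlongrightarrow> (\<Sum>i\<le>degree p. coeff p i * 0)) at_top"
    by (intro tendsto_sum tendsto_mult tendsto_const tendsto_power_div_exp_0)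
  then show ?thesis
    by (simp add: poly_altdef exp_minus sum_distrib_right divide_inverse mult.assoc)
qed

lemma flat_derivative:
  "(flat p has_real_derivative flat ([:0, 0, 1:] * (p - pderiv p)) t) (at t)"
proof -
  consider "t > 0" | "t < 0" | "t = 0" by linarith
  then show ?thesis
  proof cases
    case 1
    have "((\<lambda>t. poly p (1/t) * exp (- (1/t))) has_real_derivative
        flat ([:0, 0, 1:] * (p - pderiv p)) t) (at t)"
      using 1 by (auto intro!: derivative_eq_intros DERIV_chain2[OF poly_DERIV]
          simp: flat_def field_simps power2_eq_square)
    moreover have "\<forall>\<^sub>F s in nhds t. flat p s = poly p (1/s) * exp (- (1/s))"
      using eventually_nhds_in_open[of "{0<..}" t] 1 by (auto simp: flat_def elim: eventually_mono)
    ultimately show ?thesis by (subst DERIV_cong_ev[OF refl _ refl])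
  next
    case 2
    have "\<forall>\<^sub>F s in nhds t. flat p s = 0"
      using eventually_nhds_in_open[of "{..<0}" t] 2 by (auto simp: flat_def elim: eventually_mono)
    moreover have "((\<lambda>s. 0) has_real_derivative 0) (at t)" by simp
    ultimately show ?thesis using 2 by (subst DERIV_cong_ev[OF refl _ refl]) (auto simp: flat_def)
  next
    case 3
    have "((\<lambda>h. (flat p (0 + h) - flat p 0) / h) \<longlongrightarrow> 0) (at 0)"
    proof (rule filterlim_split_at)
      have "\<forall>\<^sub>F h in at_left 0. (flat p (0 + h) - flat p 0) / h = (0::real)"
        unfolding eventually_at_left_field by (auto simp: flat_def intro: exI[of _ "-1"])
      then show "((\<lambda>h. (flat p (0 + h) - flat p 0) / h) \<longlongrightarrow> 0) (at_left 0)"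
        by (rule tendsto_eventually)
      have "((\<lambda>y. poly ([:0, 1:] * p) y * exp (- y)) \<longlongrightarrow> 0) at_top" by (rule poly_exp_tendsto_0)
      moreover have "\<forall>\<^sub>F y in at_top. poly ([:0, 1:] * p) y * exp (- y)
          = (flat p (0 + inverse y) - flat p 0) / inverse y"
        using eventually_gt_at_top[of 0] by eventually_elim (simp add: flat_def divide_inverse)
      ultimately have "((\<lambda>y. (flat p (0 + inverse y) - flat p 0) / inverse y) \<longlongrightarrow> 0) at_top"
        using tendsto_cong by fastforce
      then show "((\<lambda>h. (flat p (0 + h) - flat p 0) / h) \<longlongrightarrow> 0) (at_right 0)"
        by (subst filterlim_at_right_to_top)
    qed
    then show ?thesis using 3 by (simp add: DERIV_def flat_def)
  qed
qed

lemma C_k_flat: "C_k k (flat p)"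
proof (induction k arbitrary: p)
  case 0
  have "isCont (flat p) t" for t using flat_derivative DERIV_isCont by blast
  then show ?case by (simp add: continuous_on_eq_continuous_at)
next
  case (Suc k)
  show ?case by (rule C_k_real_derivative[OF flat_derivative Suc])
qed

definition smooth_step :: "real \<Rightarrow> real" where
  "smooth_step t = flat 1 t * inverse (flat 1 t + flat 1 (1 - t))"

lemma smooth_step_simps: "t \<le> 0 \<Longrightarrow> smooth_step t = 0" "1 \<le> t \<Longrightarrow> smooth_step t = 1"
  by (auto simp: smooth_step_def flat_def)

lemma smooth_step_bounds: "0 \<le> smooth_step t" "smooth_step t \<le> 1"
proof -
  have "0 \<le> flat 1 t" "0 \<le> flat 1 (1 - t)" by (auto simp: flat_def)
  then show "0 \<le> smooth_step t" "smooth_step t \<le> 1"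
    by (auto simp: smooth_step_def divide_inverse[symmetric] divide_le_eq)
qed

lemma C_k_smooth_step: "C_k k smooth_step"
proof -
  have reflect: "bounded_linear (\<lambda>t::real. - t)" by (intro bounded_linear_minus bounded_linear_ident)
  have "0 < flat 1 t + flat 1 (1 - t)" for t
    by (cases "t \<le> 0"; cases "t < 1") (auto simp: flat_def intro!: add_pos_pos)
  then have "flat 1 t + flat 1 (1 - t) \<noteq> 0" for t by (metis less_irrefl)
  moreover have "C_k k (\<lambda>t. flat 1 (1 - t))"
    using C_k_affine[OF reflect C_k_flat, of k 1 1] by simp
  ultimately have "C_k k (\<lambda>t. flat 1 t * inverse (flat 1 t + flat 1 (1 - t)))"
    by (intro C_k_mult C_k_inverse C_k_add C_k_flat)
  then show ?thesis by (simp add: smooth_step_def[abs_def])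
qed

text \<open>A smooth approximation from below of the indicator function of an open box: the larger the
  slope \<open>k\<close>, the closer to the boundary it reaches the value one.\<close>

definition smooth_box :: "real \<Rightarrow> 'a::euclidean_space \<Rightarrow> 'a \<Rightarrow> 'a \<Rightarrow> real" where
  "smooth_box k a b x =
     (\<Prod>j\<in>Basis. smooth_step (k * (x \<bullet> j - a \<bullet> j)) * smooth_step (k * (b \<bullet> j - x \<bullet> j)))"

lemma smooth_box_bounds: "0 \<le> smooth_box k a b x" "smooth_box k a b x \<le> 1"
  unfolding smooth_box_def
  by (auto intro!: prod_nonneg prod_le_1 mult_nonneg_nonneg mult_le_one smooth_step_bounds)

lemma smooth_box_outside:
  assumes "0 < k" "x \<notin> box a b" shows "smooth_box k a b x = 0"
proof -
  obtain j where "j \<in> Basis" "x \<bullet> j \<le> a \<bullet> j \<or> b \<bullet> j \<le> x \<bullet> j"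
    using assms(2) by (force simp: mem_box not_less)
  then show ?thesis
    using assms(1) unfolding smooth_box_def
    by (intro prod_zero bexI[of _ j]) (auto simp: mult_le_0_iff smooth_step_simps)
qed

lemma smooth_box_C0_inf:
  assumes "0 < k" shows "smooth_box k a b \<in> C0_inf"
proof -
  have "C_k m (\<lambda>x::'a. smooth_step (k * (x \<bullet> j - a \<bullet> j)) * smooth_step (k * (b \<bullet> j - x \<bullet> j)))"
    for m j
  proof (rule C_k_mult)
    have "bounded_linear (\<lambda>x::'a. k * (x \<bullet> j))" "bounded_linear (\<lambda>x::'a. - (k * (x \<bullet> j)))"
      by (auto intro!: bounded_linear_intros bounded_linear_const_mult bounded_linear_minus
          bounded_linear_inner_left)
    from this[THEN C_k_affine, OF C_k_smooth_step, of m]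
    have "C_k m (\<lambda>x. smooth_step (k * (x \<bullet> j) + - (k * (a \<bullet> j))))"
      "C_k m (\<lambda>x. smooth_step (- (k * (x \<bullet> j)) + k * (b \<bullet> j)))" by blast+
    then show "C_k m (\<lambda>x. smooth_step (k * (x \<bullet> j - a \<bullet> j)))"
      "C_k m (\<lambda>x. smooth_step (k * (b \<bullet> j - x \<bullet> j)))" by (simp_all add: right_diff_distrib)
  qed
  then have "C_k m (smooth_box k a b)" for m
    unfolding smooth_box_def[abs_def] by (rule C_k_prod)
  moreover have "bounded {x. smooth_box k a b x \<noteq> 0}"
    by (rule bounded_subset[OF bounded_box[of a b]]) (use smooth_box_outside[OF assms] in blast)
  ultimately show ?thesis by (simp add: C0_inf_def compact_support_iff)
qed

lemma smooth_box_tendsto: "(\<lambda>k. smooth_box (real (Suc k)) a b x) \<longlonglongrightarrow> indicator (box a b) x"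
proof (cases "x \<in> box a b")
  case True
  have "(\<lambda>k. smooth_step (real (Suc k) * d)) \<longlonglongrightarrow> 1" if "0 < d" for d
  proof (rule tendsto_eventually)
    have "\<forall>\<^sub>F k in sequentially. inverse d \<le> real (Suc k)"
      using filterlim_compose[OF filterlim_real_sequentially filterlim_Suc]
      by (simp add: filterlim_at_top)
    then show "\<forall>\<^sub>F k in sequentially. smooth_step (real (Suc k) * d) = 1"
      by eventually_elim (use that in \<open>auto intro!: smooth_step_simps simp: field_simps\<close>)
  qed
  then have "(\<lambda>k. smooth_box (real (Suc k)) a b x) \<longlonglongrightarrow> (\<Prod>j\<in>(Basis::'a set). 1 * 1)"
    unfolding smooth_box_def using True by (intro tendsto_prod tendsto_mult) (auto simp: mem_box)
  then show ?thesis using True by simp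
qed (simp add: smooth_box_outside)

section \<open>Test functions in the space of square-integrable functions\<close>

lemma continuous_lebesgue_measurable:
  fixes f :: "'a::euclidean_space \<Rightarrow> 'b::{second_countable_topology,real_normed_vector}"
  assumes "continuous_on UNIV f" shows "f \<in> borel_measurable lebesgue"
  using measurable_completion[of f lborel borel] borel_measurable_continuous_onI[OF assms] by simp

lemma integrable_continuous_compact_support:
  fixes f :: "'a::euclidean_space \<Rightarrow> real"
  assumes f: "continuous_on UNIV f" "bounded {x. f x \<noteq> 0}"
  shows "integrable lborel f" "integrable lebesgue f"
proof -
  let ?S = "closure {x. f x \<noteq> 0}"
  have "compact ?S" using f(2) by (simp add: compact_eq_bounded_closed bounded_closure)
  then have "integrable lborel (\<lambda>x. indicator ?S x *\<^sub>R f x)"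
    using f(1) by (intro borel_integrable_compact) (auto intro: continuous_on_subset)
  moreover have "indicator ?S x *\<^sub>R f x = f x" for x
    using closure_subset[of "{x. f x \<noteq> 0}"] by (cases "f x = 0") auto
  then have "(\<lambda>x. indicator ?S x *\<^sub>R f x) = f" by (rule ext)
  ultimately show "integrable lborel f" by (simp only:)
  then show "integrable lebesgue f" by (simp add: integrable_completion)
qed

lemma square_integrable_continuous_compact_support:
  fixes f :: "'a::euclidean_space \<Rightarrow> real"
  assumes f: "continuous_on UNIV f" "bounded {x. f x \<noteq> 0}"
  shows "square_integrable f"
  unfolding square_integrable_def
  using f by (intro conjI continuous_lebesgue_measurable integrable_continuous_compact_support(2)
      continuous_intros) auto

lemma C0_1_iff: "f \<in> C0_1 \<longleftrightarrow> C_k 1 f \<and> bounded {x. f x \<noteq> 0}"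
  by (simp add: C0_1_def compact_support_iff)

lemma C0_inf_iff: "f \<in> C0_inf \<longleftrightarrow> (\<forall>k. C_k k f) \<and> bounded {x. f x \<noteq> 0}"
  by (simp add: C0_inf_def compact_support_iff)

lemma C0_inf_imp_C0_1: "f \<in> C0_inf \<Longrightarrow> f \<in> C0_1"
  by (simp add: C0_inf_iff C0_1_iff del: C_k.simps)

lemma C0_1_square_integrable: "f \<in> C0_1 \<Longrightarrow> square_integrable f"
  using C_k_continuous[of 1 f]
  by (auto simp: C0_1_iff simp del: C_k.simps One_nat_def
      intro: square_integrable_continuous_compact_support)

lemma C0_1_has_derivative: "f \<in> C0_1 \<Longrightarrow> (f has_derivative (\<lambda>h. grad f x \<bullet> h)) (at x)"
  using C_k_1_has_derivative[of 0 f x] by (simp add: C0_1_iff del: C_k.simps)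

lemma C0_1_continuous_grad: "f \<in> C0_1 \<Longrightarrow> continuous_on UNIV (grad f)"
  using continuous_grad[of 0 f] by (simp add: C0_1_iff del: C_k.simps)

lemma grad_outside_support:
  assumes "x \<notin> closure {x. f x \<noteq> 0}" shows "grad f x = 0"
proof (rule grad_eqI)
  have "((\<lambda>x. 0) has_derivative (\<lambda>h. 0 \<bullet> h)) (at x)" by simp
  then show "(f has_derivative (\<lambda>h. 0 \<bullet> h)) (at x)"
    by (rule has_derivative_transform_within_open[where s = "- closure {x. f x \<noteq> 0}"])
      (use assms closure_subset[of "{x. f x \<noteq> 0}"] in auto)
qed

lemma C0_1_bounded_grad_support: "f \<in> C0_1 \<Longrightarrow> bounded {x. grad f x \<noteq> 0}"
  using grad_outside_support[of _ f]
  by (auto simp: C0_1_iff intro: bounded_subset[OF bounded_closure])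

text \<open>Testing against smooth approximations of indicator functions, an element orthogonal to all
  test functions has integral zero over every box.\<close>

lemma orthogonal_C0_inf_box_integral:
  fixes v :: "'a::euclidean_space L2"
  assumes orth: "\<And>f. f \<in> C0_inf \<Longrightarrow> v \<bullet> abs_L2 f = 0"
  shows "integrable lebesgue (\<lambda>x. rep_L2 v x * indicator (box a b) x)"
    and "(LINT x|lebesgue. rep_L2 v x * indicator (box a b) x) = 0"
proof -
  have ind: "square_integrable (indicator (box a b) :: 'a \<Rightarrow> real)"
  proof -
    have "(\<lambda>x. (indicator (box a b) x)\<^sup>2) = (indicator (box a b) :: 'a \<Rightarrow> real)"
      by (auto simp: indicator_def)
    moreover have "box a b \<in> sets lebesgue" "emeasure lebesgue (box a b) < \<infinity>"
      using lmeasurable_box[of a b] by (auto simp: fmeasurable_def)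
    ultimately show ?thesis
      by (simp add: square_integrable_def borel_measurable_indicator)
  qed
  show int: "integrable lebesgue (\<lambda>x. rep_L2 v x * indicator (box a b) x)"
    by (rule square_integrable_mult[OF square_integrable_rep ind])
  have sb: "smooth_box (real (Suc k)) a b \<in> C0_inf" for k
    by (rule smooth_box_C0_inf) simp
  note sq = C0_1_square_integrable[OF C0_inf_imp_C0_1[OF sb]]
  have "(\<lambda>k. LINT x|lebesgue. rep_L2 v x * smooth_box (real (Suc k)) a b x)
      \<longlonglongrightarrow> (LINT x|lebesgue. rep_L2 v x * indicator (box a b) x)"
  proof (rule integral_dominated_convergence[where w = "\<lambda>x. \<bar>rep_L2 v x * indicator (box a b) x\<bar>"])
    show "(\<lambda>x. rep_L2 v x * indicator (box a b) x) \<in> borel_measurable lebesgue"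
      "integrable lebesgue (\<lambda>x. \<bar>rep_L2 v x * indicator (box a b) x\<bar>)"
      using int by auto
    show "(\<lambda>x. rep_L2 v x * smooth_box (real (Suc k)) a b x) \<in> borel_measurable lebesgue" for k
      using square_integrable_mult[OF square_integrable_rep sq] by blast
    show "AE x in lebesgue. (\<lambda>k. rep_L2 v x * smooth_box (real (Suc k)) a b x)
        \<longlonglongrightarrow> rep_L2 v x * indicator (box a b) x"
      by (intro AE_I2 tendsto_mult tendsto_const smooth_box_tendsto)
    have "norm (rep_L2 v x * smooth_box (real (Suc k)) a b x)
        \<le> \<bar>rep_L2 v x * indicator (box a b) x\<bar>" for k x
      using smooth_box_outside[of "real (Suc k)" x a b] smooth_box_bounds[of "real (Suc k)" a b x]
      by (cases "x \<in> box a b") (auto simp: abs_mult mult_left_le)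
    then show "AE x in lebesgue. norm (rep_L2 v x * smooth_box (real (Suc k)) a b x)
        \<le> \<bar>rep_L2 v x * indicator (box a b) x\<bar>" for k by simp
  qed
  moreover have "(LINT x|lebesgue. rep_L2 v x * smooth_box (real (Suc k)) a b x) = 0" for k
    using orth[OF sb, of k] inner_abs_L2_right[OF sq, of v k] by simp
  ultimately show "(LINT x|lebesgue. rep_L2 v x * indicator (box a b) x) = 0"
    by (simp add: LIMSEQ_const_iff)
qed

text \<open>The measures with densities the positive and the negative part agree on boxes, hence
  everywhere.\<close>

lemma AE_zero_if_box_integrals_zero:
  fixes g :: "'a::euclidean_space \<Rightarrow> real"
  assumes g: "g \<in> borel_measurable borel"
    and int: "\<And>a b. integrable lborel (\<lambda>x. g x * indicator (box a b) x)"
    and zero: "\<And>a b. (LINT x|lborel. g x * indicator (box a b) x) = 0"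
  shows "AE x in lborel. g x = 0"
proof -
  define P where "P = density lborel (\<lambda>x. ennreal (g x))"
  define N where "N = density lborel (\<lambda>x. ennreal (- g x))"
  have em: "emeasure P (box a b) = emeasure N (box a b)" "emeasure P (box a b) \<noteq> \<infinity>" for a b
  proof -
    have "emeasure P (box a b) = (\<integral>\<^sup>+x. ennreal (g x * indicator (box a b) x) \<partial>lborel)"
      unfolding P_def using g by (subst emeasure_density) (auto intro!: nn_integral_cong simp: indicator_def)
    moreover have "emeasure N (box a b) = (\<integral>\<^sup>+x. ennreal (- (g x * indicator (box a b) x)) \<partial>lborel)"
      unfolding N_def using g by (subst emeasure_density) (auto intro!: nn_integral_cong simp: indicator_def)
    moreover have fin: "(\<integral>\<^sup>+x. ennreal (g x * indicator (box a b) x) \<partial>lborel) \<noteq> \<infinity>"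
      "(\<integral>\<^sup>+x. ennreal (- (g x * indicator (box a b) x)) \<partial>lborel) \<noteq> \<infinity>"
      using int[of a b] by (auto simp: real_integrable_def)
    moreover have "enn2real (\<integral>\<^sup>+x. ennreal (g x * indicator (box a b) x) \<partial>lborel)
        = enn2real (\<integral>\<^sup>+x. ennreal (- (g x * indicator (box a b) x)) \<partial>lborel)"
      using real_lebesgue_integral_def[OF int[of a b]] zero[of a b] by simp
    ultimately show "emeasure P (box a b) = emeasure N (box a b)" "emeasure P (box a b) \<noteq> \<infinity>"
      by (metis ennreal_enn2real infinity_ennreal_def less_top)+
  qed
  have "P = N"
  proof (rule measure_eqI_generator_eq)
    let ?E = "range (\<lambda>(a, b). box a b :: 'a set)"
    let ?A = "\<lambda>n::nat. box (- (real n *\<^sub>R One)) (real n *\<^sub>R One) :: 'a set"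
    show "Int_stable ?E" by (auto simp: Int_stable_def box_Int_box)
    show "?E \<subseteq> Pow UNIV" "sets P = sigma_sets UNIV ?E" "sets N = sigma_sets UNIV ?E"
      by (simp_all add: borel_eq_box sets_lborel P_def N_def)
    show "range ?A \<subseteq> ?E" "(\<Union>i. ?A i) = UNIV" unfolding UN_box_eq_UNIV by auto
    fix X assume "X \<in> ?E"
    then show "emeasure P X = emeasure N X" using em(1) by auto
  next
    show "emeasure P (box (- (real n *\<^sub>R One)) (real n *\<^sub>R One)) \<noteq> \<infinity>" for n by (rule em(2))
  qed
  then have "AE x in lborel. ennreal (g x) = ennreal (- g x)"
    unfolding P_def N_def using g by (intro sigma_finite_measure.density_unique lborel.sigma_finite_measure_axioms) auto
  then show ?thesis
  proof (rule AE_mp, intro AE_I2 impI)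
    fix x assume "ennreal (g x) = ennreal (- g x)"
    then show "g x = 0" by (cases "0 \<le> g x") (auto simp: ennreal_neg ennreal_eq_0_iff)
  qed
qed

lemma C0_inf_separating:
  fixes v :: "'a::euclidean_space L2"
  assumes orth: "\<And>f. f \<in> C0_inf \<Longrightarrow> v \<bullet> abs_L2 f = 0"
  shows "v = 0"
proof -
  have m: "rep_L2 v \<in> borel_measurable lebesgue"
    using square_integrable_rep[of v] by (simp add: square_integrable_def)
  obtain g where g: "g \<in> borel_measurable borel" and eq: "AE x in lborel. rep_L2 v x = g x"
    using completion_ex_borel_measurable_real[OF m] by auto
  have eq': "AE x in lebesgue. rep_L2 v x = g x" using AE_completion[OF eq] .
  have gm: "g \<in> borel_measurable lebesgue" using g by (simp add: measurable_completion)
  have "AE x in lborel. g x = 0"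
  proof (rule AE_zero_if_box_integrals_zero[OF g])
    fix a b :: 'a
    have bm: "(\<lambda>x. g x * indicator (box a b) x) \<in> borel_measurable lborel" using g by auto
    have c: "AE x in lebesgue. rep_L2 v x * indicator (box a b) x = g x * indicator (box a b) x"
      using eq' by eventually_elim simp
    have r: "integrable lebesgue (\<lambda>x. rep_L2 v x * indicator (box a b) x)"
      "(LINT x|lebesgue. rep_L2 v x * indicator (box a b) x) = 0"
      using orthogonal_C0_inf_box_integral[of v a b] orth by blast+
    have mm: "(\<lambda>x. rep_L2 v x * indicator (box a b) x) \<in> borel_measurable lebesgue"
      "(\<lambda>x. g x * indicator (box a b) x) \<in> borel_measurable lebesgue"
      using r(1) measurable_completion[OF bm] by auto
    show "integrable lborel (\<lambda>x. g x * indicator (box a b) x)"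
      using r(1) integrable_cong_AE[OF mm c] integrable_completion[OF bm] by simp
    show "(LINT x|lborel. g x * indicator (box a b) x) = 0"
      using r(2) integral_cong_AE[OF mm c] integral_completion[OF bm] by simp
  qed
  then have "AE x in lebesgue. g x = 0" by (rule AE_completion)
  with eq' have "AE x in lebesgue. rep_L2 v x = 0" by eventually_elim simp
  then have "abs_L2 (rep_L2 v) = abs_L2 (\<lambda>x. 0)"
    by (intro abs_L2_eqI square_integrable_rep square_integrable_zero)
  then show ?thesis by (simp add: zero_L2_def)
qed

section \<open>Mollification\<close>

definition conv :: "('a::euclidean_space \<Rightarrow> real) \<Rightarrow> ('a \<Rightarrow> real) \<Rightarrow> 'a \<Rightarrow> real" where
  "conv f g x = (LINT y|lborel. f y * g (x - y))"

lemma lborel_reflect: "distr lborel borel (\<lambda>y. x - y) = (lborel :: 'a::euclidean_space measure)"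
proof -
  have "x + (\<Sum>j\<in>Basis. (-1 * (y \<bullet> j)) *\<^sub>R j) = x - y" for y :: 'a
    by (simp add: sum_negf euclidean_representation)
  then show ?thesis
    using lborel_affine_euclidean[of "\<lambda>_. -1" x] by (simp add: density_1)
qed

lemma conv_commute:
  fixes f g :: "'a::euclidean_space \<Rightarrow> real"
  assumes "continuous_on UNIV f" "continuous_on UNIV g"
  shows "conv f g x = conv g f x"
proof -
  have m: "f \<in> borel_measurable borel" "g \<in> borel_measurable borel"
    using assms by (auto intro: borel_measurable_continuous_onI)
  have "conv g f x = (LINT y|distr lborel borel (\<lambda>y. x - y). g y * f (x - y))"
    by (simp add: conv_def lborel_reflect)
  also have "\<dots> = (LINT y|lborel. g (x - y) * f (x - (x - y)))"
    using m by (intro integral_distr) auto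
  also have "\<dots> = conv f g x" by (simp add: conv_def mult.commute)
  finally show ?thesis by simp
qed

context
  fixes f :: "'a::euclidean_space \<Rightarrow> real"
  assumes f: "continuous_on UNIV f" "bounded {x. f x \<noteq> 0}"
begin

lemma conv_eq_integral:
  assumes g: "continuous_on UNIV g" and ab: "{x. f x \<noteq> 0} \<subseteq> cbox a b"
  shows "conv f g x = integral (cbox a b) (\<lambda>y. f y * g (x - y))"
proof -
  have "continuous_on UNIV (\<lambda>y. g (x - y))"
    by (rule continuous_on_compose2[OF g]) (auto intro!: continuous_intros)
  then have c: "continuous_on UNIV (\<lambda>y. f y * g (x - y))" by (intro continuous_intros f)
  have z: "(\<lambda>y. indicator (cbox a b) y *\<^sub>R (f y * g (x - y))) = (\<lambda>y. f y * g (x - y))"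
    using ab by (auto simp: indicator_def fun_eq_iff)
  have "integrable lborel (\<lambda>y. f y * g (x - y))"
    using f(2) by (intro integrable_continuous_compact_support c) (auto elim: bounded_subset)
  then have "set_integrable lborel (cbox a b) (\<lambda>y. f y * g (x - y))"
    unfolding set_integrable_def z .
  from set_borel_integral_eq_integral(2)[OF this] show ?thesis
    unfolding conv_def set_lebesgue_integral_def z .
qed

lemma continuous_conv:
  assumes g: "continuous_on UNIV g" shows "continuous_on UNIV (conv f g)"
proof -
  obtain a where a: "{x. f x \<noteq> 0} \<subseteq> cbox (-a) a"
    using bounded_subset_cbox_symmetric[OF f(2)] by blast
  have "continuous_on (UNIV \<times> cbox (-a) a) (\<lambda>(x, y). f y * g (x - y))"
    unfolding split_def
    by (intro continuous_intros continuous_on_compose2[OF f(1)] continuous_on_compose2[OF g]) auto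
  from integral_continuous_on_param[OF this] show ?thesis
    by (simp add: conv_eq_integral[OF g a, abs_def])
qed

text \<open>Differentiation under the integral sign: the derivative falls on the factor \<open>g\<close>, and the
  bounded support of \<open>f\<close> confines the integral to a box. By commutativity either factor of a
  convolution can be made to carry the derivative.\<close>

lemma conv_has_derivative:
  assumes g: "C_k 1 g"
  shows "(conv f g has_derivative (\<lambda>h. conv f (\<lambda>z. grad g z \<bullet> h) x)) (at x)"
proof -
  obtain a where a: "{x. f x \<noteq> 0} \<subseteq> cbox (-a) a"
    using bounded_subset_cbox_symmetric[OF f(2)] by blast
  have gc: "continuous_on UNIV g" "continuous_on UNIV (grad g)"
    using C_k_continuous[OF g] continuous_grad[of 0 g] g by simp_all
  define D where "D x y = blinfun_inner_left (f y *\<^sub>R grad g (x - y))" for x y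
  have contD: "continuous_on (UNIV \<times> cbox (-a) a) (\<lambda>(x, y). D x y)"
    unfolding split_def D_def
    by (intro continuous_intros bounded_linear.continuous_on[OF bounded_linear_blinfun_inner_left]
        continuous_on_compose2[OF f(1)] continuous_on_compose2[OF gc(2)]) auto
  have "((\<lambda>x. integral (cbox (-a) a) (\<lambda>y. f y * g (x - y))) has_derivative
      integral (cbox (-a) a) (D x)) (at x within UNIV)"
  proof (rule leibniz_rule[OF _ _ contD])
    fix x y :: 'a
    have "((\<lambda>x. x - y) has_derivative (\<lambda>h. h)) (at x)" by (auto intro!: derivative_eq_intros)
    from has_derivative_compose[OF this C_k_1_has_derivative[OF g[unfolded One_nat_def]]]
    have "((\<lambda>x. g (x - y)) has_derivative (\<lambda>h. grad g (x - y) \<bullet> h)) (at x)"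
      by simp
    from has_derivative_mult_right[OF this, of "f y"]
    show "((\<lambda>x. f y * g (x - y)) has_derivative blinfun_apply (D x y)) (at x within UNIV)"
      by (simp add: D_def inner_commute)
    show "(\<lambda>y. f y * g (x - y)) integrable_on cbox (-a) a"
      by (intro integrable_continuous continuous_intros continuous_on_compose2[OF gc(1)]
          continuous_on_subset[OF f(1)]) auto
  qed auto
  then have 1: "(conv f g has_derivative integral (cbox (-a) a) (D x)) (at x)"
    by (simp add: conv_eq_integral[OF gc(1) a, abs_def])
  have "D x integrable_on cbox (-a) a"
  proof (rule integrable_continuous)
    show "continuous_on (cbox (-a) a) (D x)"
      unfolding D_def
      by (intro bounded_linear.continuous_on[OF bounded_linear_blinfun_inner_left] continuous_intros
          continuous_on_subset[OF f(1)] continuous_on_compose2[OF gc(2)]) auto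
  qed
  moreover have "conv f (\<lambda>z. grad g z \<bullet> h) x = integral (cbox (-a) a) (\<lambda>y. D x y h)" for h
    using conv_eq_integral[of "\<lambda>z. grad g z \<bullet> h", OF _ a] gc(2)
    by (simp add: D_def inner_commute continuous_intros)
  ultimately have "blinfun_apply (integral (cbox (-a) a) (D x)) = (\<lambda>h. conv f (\<lambda>z. grad g z \<bullet> h) x)"
    by (simp add: fun_eq_iff blinfun_apply_integral)
  with 1 show ?thesis by simp
qed

lemma C_k_conv: "C_k k g \<Longrightarrow> C_k k (conv f g)"
proof (induction k arbitrary: g)
  case (Suc k)
  have "C_k 1 g" using C_k_le[OF Suc.prems, of 1] by simp
  then show ?case
    using Suc by (subst C_k_Suc_iff[OF conv_has_derivative]) (auto simp: C_k_Suc_grad simp del: C_k.simps)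
qed (simp add: continuous_conv)

end

lemma conv_nonzero:
  assumes "conv f g x \<noteq> 0" obtains y where "f y \<noteq> 0" "g (x - y) \<noteq> 0"
proof (rule ccontr)
  assume "\<not> thesis"
  then have "f y * g (x - y) = 0" for y using that by auto
  then have "conv f g x = 0" unfolding conv_def by (simp only: integral_zero)
  with assms show False by simp
qed

text \<open>Smooth boxes shrinking to the origin, divided by their integrals. The integrals are positive
  because the boxes are continuous and have the value one at the origin.\<close>

lemma mollifier_exists:
  obtains \<kappa> :: "nat \<Rightarrow> 'a::euclidean_space \<Rightarrow> real" where
    "\<And>k. \<kappa> k \<in> C0_inf" "\<And>k y. 0 \<le> \<kappa> k y" "\<And>k. (LINT y|lborel. \<kappa> k y) = 1"
    "\<And>k y. \<kappa> k y \<noteq> 0 \<Longrightarrow> norm y \<le> DIM('a) / real (Suc k)"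
proof -
  define r :: "nat \<Rightarrow> 'a \<Rightarrow> real" where
    "r k = smooth_box (real (Suc k)) (- ((1 / real (Suc k)) *\<^sub>R One)) ((1 / real (Suc k)) *\<^sub>R One)" for k
  have r: "r k \<in> C0_inf" for k unfolding r_def by (rule smooth_box_C0_inf) simp
  have rb: "0 \<le> r k y" for k y by (simp add: r_def smooth_box_bounds)
  have r0: "r k 0 = 1" for k by (simp add: r_def smooth_box_def smooth_step_simps inner_sum_left_Basis)
  have rs: "norm y \<le> DIM('a) / real (Suc k)" if "r k y \<noteq> 0" for k y
  proof -
    have "y \<in> box (- ((1 / real (Suc k)) *\<^sub>R One)) ((1 / real (Suc k)) *\<^sub>R One)"
      using that smooth_box_outside[of "real (Suc k)" y] by (auto simp: r_def)
    then have "\<bar>y \<bullet> j\<bar> \<le> 1 / real (Suc k)" if "j \<in> Basis" for j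
      using that by (auto simp: mem_box abs_le_iff less_imp_le minus_le_iff)
    then have "(\<Sum>j\<in>Basis. \<bar>y \<bullet> j\<bar>) \<le> (\<Sum>j\<in>(Basis::'a set). 1 / real (Suc k))"
      by (rule sum_mono)
    then show ?thesis using norm_le_l1[of y] by simp
  qed
  have rc: "continuous_on UNIV (r k)" "bounded {y. r k y \<noteq> 0}" for k
    using r[of k] C_k_continuous[of 0 "r k"] by (auto simp: C0_inf_iff)
  have ri: "integrable lborel (r k)" for k by (rule integrable_continuous_compact_support[OF rc])
  define m where "m k = (LINT y|lborel. r k y)" for k
  have m: "0 < m k" for k
  proof (rule ccontr)
    assume "\<not> 0 < m k"
    moreover have "0 \<le> m k" unfolding m_def by (rule Bochner_Integration.integral_nonneg) (rule rb)
    ultimately have "m k = 0" by simp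
    then have "AE y in lborel. r k y = 0"
      using integral_nonneg_eq_0_iff_AE[OF ri[of k]] rb by (simp add: m_def)
    then have "AE y in lebesgue. y \<in> {y. r k y = 0}" by (auto dest: AE_completion)
    moreover have "closed {y. r k y = 0}" by (intro closed_Collect_eq rc continuous_on_const)
    ultimately have "0 \<in> {y. r k y = 0}" using mem_closed_if_AE_lebesgue by blast
    then show False using r0 by simp
  qed
  show thesis
  proof (rule that[of "\<lambda>k y. (1 / m k) * r k y"])
    fix k y
    have "bounded {y. (1 / m k) * r k y \<noteq> 0}" using rc(2)[of k] by (auto elim: bounded_subset)
    then show "(\<lambda>y. (1 / m k) * r k y) \<in> C0_inf"
      using r[of k] unfolding C0_inf_iff by (blast intro: C_k_cmult)
    show "0 \<le> (1 / m k) * r k y" using m[of k] rb by simp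
    show "(LINT y|lborel. (1 / m k) * r k y) = 1" using m[of k] by (simp add: m_def)
    show "norm y \<le> DIM('a) / real (Suc k)" if "(1 / m k) * r k y \<noteq> 0" using rs[of k y] that by auto
  qed
qed

lemma uniformly_continuous_compact_support:
  fixes f :: "'a::euclidean_space \<Rightarrow> real"
  assumes f: "continuous_on UNIV f" "bounded {x. f x \<noteq> 0}" and e: "0 < e"
  obtains d where "0 < d" "\<And>x y. norm y \<le> d \<Longrightarrow> \<bar>f (x - y) - f x\<bar> \<le> e"
proof -
  obtain R where R: "\<And>x. f x \<noteq> 0 \<Longrightarrow> norm x \<le> R" using f(2) by (auto simp: bounded_iff)
  have "uniformly_continuous_on (cball 0 (R + 2)) f"
    using f(1) by (intro compact_uniformly_continuous) (auto intro: continuous_on_subset)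
  then obtain d where d: "0 < d"
    "\<And>x x'. x \<in> cball 0 (R+2) \<Longrightarrow> x' \<in> cball 0 (R+2) \<Longrightarrow> dist x' x < d \<Longrightarrow> dist (f x') (f x) < e"
    using e unfolding uniformly_continuous_on_def by metis
  have "\<bar>f (x - y) - f x\<bar> \<le> e" if y: "norm y \<le> min (d/2) 1" for x y
  proof (cases "norm x \<le> R + 1")
    case True
    then have "norm (x - y) \<le> R + 2" using norm_triangle_ineq4[of x y] y by simp
    then show ?thesis using d(2)[of x "x - y"] True y d(1)
      by (simp add: dist_norm norm_minus_commute less_imp_le)
  next
    case False
    then have "R < norm (x - y)" "R < norm x" using norm_triangle_ineq2[of x y] y by auto
    then have "f x = 0" "f (x - y) = 0" using R not_less by blast+
    then show ?thesis using e by simp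
  qed
  with d(1) show ?thesis by (intro that[of "min (d/2) 1"]) auto
qed

lemma conv_mollifier_close:
  fixes \<kappa> f :: "'a::euclidean_space \<Rightarrow> real"
  assumes \<kappa>: "\<kappa> \<in> C0_inf" "\<And>y. 0 \<le> \<kappa> y" "(LINT y|lborel. \<kappa> y) = 1" "\<And>y. \<kappa> y \<noteq> 0 \<Longrightarrow> norm y \<le> d"
    and f: "continuous_on UNIV f" and close: "\<And>x y. norm y \<le> d \<Longrightarrow> \<bar>f (x - y) - f x\<bar> \<le> e"
  shows "\<bar>conv \<kappa> f x - f x\<bar> \<le> e"
proof -
  have c: "continuous_on UNIV \<kappa>" "bounded {y. \<kappa> y \<noteq> 0}"
    using \<kappa>(1) C_k_continuous[of 0 \<kappa>] by (auto simp: C0_inf_iff)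
  have ki: "integrable lborel \<kappa>" by (rule integrable_continuous_compact_support[OF c])
  have "continuous_on UNIV (\<lambda>y. f (x - y))"
    by (rule continuous_on_compose2[OF f]) (auto intro!: continuous_intros)
  then have i: "integrable lborel (\<lambda>y. \<kappa> y * f (x - y))"
    using c by (intro integrable_continuous_compact_support continuous_intros)
      (auto elim: bounded_subset)
  have "conv \<kappa> f x - f x = (LINT y|lborel. \<kappa> y * f (x - y)) - (LINT y|lborel. \<kappa> y * f x)"
    using \<kappa>(3) by (simp add: conv_def)
  also have "\<dots> = (LINT y|lborel. \<kappa> y * f (x - y) - \<kappa> y * f x)"
    using i ki by (intro Bochner_Integration.integral_diff[symmetric]) auto
  also have "\<bar>\<dots>\<bar> \<le> (LINT y|lborel. \<kappa> y * e)"
  proof (rule integral_abs_bound[THEN order_trans], rule integral_mono)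
    show "integrable lborel (\<lambda>y. \<bar>\<kappa> y * f (x - y) - \<kappa> y * f x\<bar>)" "integrable lborel (\<lambda>y. \<kappa> y * e)"
      using i ki by auto
    fix y
    have "\<bar>\<kappa> y * f (x - y) - \<kappa> y * f x\<bar> = \<kappa> y * \<bar>f (x - y) - f x\<bar>"
      using \<kappa>(2)[of y] by (simp add: right_diff_distrib[symmetric] abs_mult)
    also have "\<dots> \<le> \<kappa> y * e"
      using \<kappa>(2)[of y] \<kappa>(4)[of y] close[of y x] by (cases "\<kappa> y = 0") (auto intro: mult_left_mono)
    finally show "\<bar>\<kappa> y * f (x - y) - \<kappa> y * f x\<bar> \<le> \<kappa> y * e" .
  qed
  also have "\<dots> = e" using \<kappa>(3) by simp
  finally show ?thesis .
qed

text \<open>Mollifying commutes with differentiation, so test functions of class one are approximated by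
  smooth ones together with their gradients, uniformly and inside a fixed ball.\<close>

lemma C0_1_smooth_approximation:
  fixes \<phi> :: "'a::euclidean_space \<Rightarrow> real"
  assumes \<phi>: "\<phi> \<in> C0_1"
  obtains \<psi> R where "\<And>k. \<psi> k \<in> C0_inf"
    and "\<And>k x. \<psi> k x \<noteq> 0 \<Longrightarrow> norm x \<le> R" and "\<And>x. \<phi> x \<noteq> 0 \<Longrightarrow> norm x \<le> R"
    and "\<And>e. 0 < e \<Longrightarrow> \<forall>\<^sub>F k in sequentially. \<forall>x. \<bar>\<psi> k x - \<phi> x\<bar> \<le> e"
    and "\<And>e. 0 < e \<Longrightarrow> \<forall>\<^sub>F k in sequentially. \<forall>x. norm (grad (\<psi> k) x - grad \<phi> x) \<le> e"
proof -
  have c: "continuous_on UNIV \<phi>" "bounded {x. \<phi> x \<noteq> 0}" and \<phi>1: "C_k 1 \<phi>"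
    using \<phi> C_k_continuous[of 1 \<phi>] by (auto simp: C0_1_iff simp del: C_k.simps One_nat_def)
  obtain \<kappa> :: "nat \<Rightarrow> 'a \<Rightarrow> real" where \<kappa>: "\<And>k. \<kappa> k \<in> C0_inf" "\<And>k y. 0 \<le> \<kappa> k y"
    "\<And>k. (LINT y|lborel. \<kappa> k y) = 1" "\<And>k y. \<kappa> k y \<noteq> 0 \<Longrightarrow> norm y \<le> DIM('a) / real (Suc k)"
    using mollifier_exists by metis
  have kc: "continuous_on UNIV (\<kappa> k)" "bounded {y. \<kappa> k y \<noteq> 0}" for k
    using \<kappa>(1)[of k] C_k_continuous[of 0 "\<kappa> k"] by (auto simp: C0_inf_iff)
  obtain R where R: "\<And>x. \<phi> x \<noteq> 0 \<Longrightarrow> norm x \<le> R" using c(2) by (auto simp: bounded_iff)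
  have approx: "\<forall>\<^sub>F k in sequentially. \<forall>x. \<bar>conv (\<kappa> k) f x - f x\<bar> \<le> e"
    if f: "continuous_on UNIV f" "bounded {x. f x \<noteq> 0}" and e: "0 < e" for f e
  proof -
    obtain d where d: "0 < d" "\<And>x y. norm y \<le> d \<Longrightarrow> \<bar>f (x - y) - f x\<bar> \<le> e"
      using uniformly_continuous_compact_support[OF f e] by blast
    have "(\<lambda>k. DIM('a) * inverse (real (Suc k))) \<longlonglongrightarrow> real DIM('a) * 0"
      by (intro tendsto_intros LIMSEQ_inverse_real_of_nat)
    then have "\<forall>\<^sub>F k in sequentially. DIM('a) * inverse (real (Suc k)) < d"
      using d(1) by (intro order_tendstoD(2)) auto
    then show ?thesis
    proof (eventually_elim, intro allI)
      fix k x assume "DIM('a) * inverse (real (Suc k)) < d"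
      then have "norm y \<le> d" if "\<kappa> k y \<noteq> 0" for y
        using \<kappa>(4)[OF that] by (simp add: divide_inverse)
      then show "\<bar>conv (\<kappa> k) f x - f x\<bar> \<le> e"
        by (intro conv_mollifier_close[OF \<kappa>(1,2,3) _ f(1) d(2)])
    qed
  qed
  define \<psi> where "\<psi> k = conv \<phi> (\<kappa> k)" for k
  have \<psi>': "\<psi> k = conv (\<kappa> k) \<phi>" for k using conv_commute[OF c(1) kc(1)] by (auto simp: \<psi>_def)
  have supp: "norm x \<le> R + DIM('a)" if "\<psi> k x \<noteq> 0" for k x
  proof -
    have "conv \<phi> (\<kappa> k) x \<noteq> 0" using that by (simp add: \<psi>_def)
    then obtain y where y: "\<phi> y \<noteq> 0" "\<kappa> k (x - y) \<noteq> 0" by (rule conv_nonzero)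
    have "norm (x - y) \<le> DIM('a)"
      using \<kappa>(4)[OF y(2)] by (rule order_trans) (simp add: divide_le_eq)
    then show ?thesis using R[OF y(1)] norm_triangle_ineq[of "x - y" y] by simp
  qed
  show thesis
  proof (rule that[of \<psi> "R + DIM('a)"])
    show "\<psi> k \<in> C0_inf" for k
      unfolding C0_inf_iff
    proof
      show "\<forall>m. C_k m (\<psi> k)" unfolding \<psi>_def using \<kappa>(1)[of k] C_k_conv[OF c] by (simp add: C0_inf_iff)
      show "bounded {x. \<psi> k x \<noteq> 0}" using supp[of k] by (auto simp: bounded_iff)
    qed
    show "norm x \<le> R + DIM('a)" if "\<phi> x \<noteq> 0" for x using R[OF that] by simp
    show "\<forall>\<^sub>F k in sequentially. \<forall>x. \<bar>\<psi> k x - \<phi> x\<bar> \<le> e" if "0 < e" for e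
      unfolding \<psi>' by (rule approx[OF c that])
    show "\<forall>\<^sub>F k in sequentially. \<forall>x. norm (grad (\<psi> k) x - grad \<phi> x) \<le> e" if e: "0 < e" for e
    proof -
      have gc: "continuous_on UNIV (\<lambda>x. grad \<phi> x \<bullet> b)" "bounded {x. grad \<phi> x \<bullet> b \<noteq> 0}" for b
        using C0_1_continuous_grad[OF \<phi>] C0_1_bounded_grad_support[OF \<phi>]
        by (auto intro!: continuous_intros elim: bounded_subset)
      have "\<forall>\<^sub>F k in sequentially. \<forall>b\<in>Basis. \<forall>x.
          \<bar>conv (\<kappa> k) (\<lambda>x. grad \<phi> x \<bullet> b) x - grad \<phi> x \<bullet> b\<bar> \<le> e / DIM('a)"
        using e by (intro eventually_ball_finite ballI approx[OF gc]) auto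
      then show ?thesis
      proof (eventually_elim, intro allI)
        fix k x assume *: "\<forall>b\<in>Basis. \<forall>x.
          \<bar>conv (\<kappa> k) (\<lambda>x. grad \<phi> x \<bullet> b) x - grad \<phi> x \<bullet> b\<bar> \<le> e / DIM('a)"
        have "grad (\<psi> k) x \<bullet> b = conv (\<kappa> k) (\<lambda>x. grad \<phi> x \<bullet> b) x" if "b \<in> Basis" for b
          unfolding \<psi>' by (rule grad_inner_Basis[OF conv_has_derivative[OF kc \<phi>1] that])
        then have "(\<Sum>b\<in>Basis. \<bar>(grad (\<psi> k) x - grad \<phi> x) \<bullet> b\<bar>) \<le> (\<Sum>b\<in>(Basis::'a set). e / DIM('a))"
          using * by (intro sum_mono) (simp add: inner_diff_left)
        then show "norm (grad (\<psi> k) x - grad \<phi> x) \<le> e"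
          using norm_le_l1[of "grad (\<psi> k) x - grad \<phi> x"] by simp
      qed
    qed
  qed (use supp in auto)
qed

section \<open>The transport operator\<close>

abbreviation transport :: "('a::euclidean_space \<Rightarrow> 'a) \<Rightarrow> ('a \<Rightarrow> real) \<Rightarrow> 'a \<Rightarrow> real" where
  "transport a u \<equiv> \<lambda>x. a x \<bullet> grad u x"

lemma L_inf_bound:
  assumes "L_inf a" obtains C where "0 \<le> C" "AE x in lebesgue. norm (a x) \<le> C"
proof -
  obtain C where C: "AE x in lebesgue. norm (a x) \<le> C" using assms by (auto simp: L_inf_def)
  then have "AE x in lebesgue. norm (a x) \<le> \<bar>C\<bar>" by eventually_elim simp
  then show ?thesis using that[of "\<bar>C\<bar>"] by simp
qed

lemma square_integrable_inner_L_inf: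
  fixes a :: "'a::euclidean_space \<Rightarrow> 'a"
  assumes a: "L_inf a" and g: "continuous_on UNIV g" "bounded {x. g x \<noteq> 0}"
  shows "square_integrable (\<lambda>x. a x \<bullet> g x)"
proof -
  obtain C where C: "0 \<le> C" "AE x in lebesgue. norm (a x) \<le> C" by (rule L_inf_bound[OF a])
  have m: "(\<lambda>x. a x \<bullet> g x) \<in> borel_measurable lebesgue"
    using a continuous_lebesgue_measurable[OF g(1)] by (auto simp: L_inf_def)
  have "integrable lebesgue (\<lambda>x. C\<^sup>2 * (norm (g x))\<^sup>2)"
    using g by (intro integrable_continuous_compact_support(2) continuous_intros)
      (auto elim: bounded_subset)
  then have "integrable lebesgue (\<lambda>x. (a x \<bullet> g x)\<^sup>2)"
  proof (rule Bochner_Integration.integrable_bound)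
    show "AE x in lebesgue. norm ((a x \<bullet> g x)\<^sup>2) \<le> norm (C\<^sup>2 * (norm (g x))\<^sup>2)"
      using C(2)
    proof eventually_elim
      fix x assume "norm (a x) \<le> C"
      then have "\<bar>a x \<bullet> g x\<bar> \<le> C * norm (g x)"
        by (intro order_trans[OF Cauchy_Schwarz_ineq2] mult_right_mono) auto
      then have "(a x \<bullet> g x)\<^sup>2 \<le> (C * norm (g x))\<^sup>2" using abs_le_square_iff by fastforce
      then show "norm ((a x \<bullet> g x)\<^sup>2) \<le> norm (C\<^sup>2 * (norm (g x))\<^sup>2)"
        by (simp add: power_mult_distrib)
    qed
  qed (use m in simp)
  with m show ?thesis by (simp add: square_integrable_def)
qed

lemma square_integrable_transport:
  "L_inf a \<Longrightarrow> u \<in> C0_1 \<Longrightarrow> square_integrable (transport a u)"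
  by (intro square_integrable_inner_L_inf C0_1_continuous_grad C0_1_bounded_grad_support)

lemma norm_abs_L2_le_on_ball:
  fixes d :: "'a::euclidean_space \<Rightarrow> real"
  assumes d: "square_integrable d" and e: "0 \<le> e"
    and le: "AE x in lebesgue. \<bar>d x\<bar> \<le> e * indicator (cball 0 R) x"
  shows "norm (abs_L2 d) \<le> e * sqrt (measure lebesgue (cball (0::'a) R))"
proof (rule power2_le_imp_le)
  have "(norm (abs_L2 d))\<^sup>2 = (LINT x|lebesgue. (d x)\<^sup>2)" by (rule norm_abs_L2[OF d])
  also have "\<dots> \<le> (LINT x|lebesgue. e\<^sup>2 * indicator (cball (0::'a) R) x)"
  proof (rule integral_mono_AE)
    show "integrable lebesgue (\<lambda>x. (d x)\<^sup>2)" using d by (simp add: square_integrable_def)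
    show "integrable lebesgue (\<lambda>x::'a. e\<^sup>2 * indicator (cball 0 R) x)"
      using lmeasurable_cball[of "0::'a" R] by (auto simp: fmeasurable_def)
    show "AE x in lebesgue. (d x)\<^sup>2 \<le> e\<^sup>2 * indicator (cball 0 R) x"
      using le
    proof eventually_elim
      fix x assume *: "\<bar>d x\<bar> \<le> e * indicator (cball 0 R) x"
      then have "(d x)\<^sup>2 \<le> (e * indicator (cball 0 R) x)\<^sup>2" using abs_le_square_iff by fastforce
      then show "(d x)\<^sup>2 \<le> e\<^sup>2 * indicator (cball 0 R) x"
        by (auto simp: power_mult_distrib indicator_def split: if_splits)
    qed
  qed
  also have "\<dots> = (e * sqrt (measure lebesgue (cball (0::'a) R)))\<^sup>2"
    by (simp add: power_mult_distrib)
  finally show "(norm (abs_L2 d))\<^sup>2 \<le> (e * sqrt (measure lebesgue (cball (0::'a) R)))\<^sup>2" .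
qed (use e in simp)

lemma abs_L2_tendsto_if_uniform_on_ball:
  fixes f :: "nat \<Rightarrow> 'a::euclidean_space \<Rightarrow> real"
  assumes f: "\<And>k. square_integrable (f k)" and g: "square_integrable g"
    and le: "\<And>e. 0 < e \<Longrightarrow> \<forall>\<^sub>F k in sequentially.
      AE x in lebesgue. \<bar>f k x - g x\<bar> \<le> e * indicator (cball 0 R) x"
  shows "(\<lambda>k. abs_L2 (f k)) \<longlonglongrightarrow> abs_L2 g"
proof (rule tendstoI)
  fix e :: real assume e: "0 < e"
  define m where "m = sqrt (measure lebesgue (cball (0::'a) R))"
  have m: "0 \<le> m" by (simp add: m_def)
  define d where "d = e / (1 + m)"
  have pos: "0 < 1 + m" using m by linarith
  then have "0 < d" "d * (1 + m) = e" using e by (simp_all add: d_def)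
  then have d: "0 < d" "d * m < e" by (simp_all add: distrib_left)
  from le[OF d(1)] show "\<forall>\<^sub>F k in sequentially. dist (abs_L2 (f k)) (abs_L2 g) < e"
  proof eventually_elim
    fix k assume "AE x in lebesgue. \<bar>f k x - g x\<bar> \<le> d * indicator (cball 0 R) x"
    then have "norm (abs_L2 (\<lambda>x. f k x - g x)) \<le> d * m"
      unfolding m_def using d(1) by (intro norm_abs_L2_le_on_ball square_integrable_diff f g) auto
    then show "dist (abs_L2 (f k)) (abs_L2 g) < e"
      using d(2) by (simp add: dist_norm minus_abs_L2[OF f g])
  qed
qed

text \<open>Uniform convergence inside a fixed ball is convergence in the mean, for the functions and,
  \<open>a\<close> being bounded, for their images under the transport operator.\<close>

lemma C0_1_approximation_in_graph:
  fixes a :: "'a::euclidean_space \<Rightarrow> 'a"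
  assumes a: "L_inf a" and \<phi>: "\<phi> \<in> C0_1"
  obtains \<psi> R where "\<And>k. \<psi> k \<in> C0_inf"
    and "(\<lambda>k. abs_L2 (\<psi> k)) \<longlonglongrightarrow> abs_L2 \<phi>"
    and "(\<lambda>k. abs_L2 (transport a (\<psi> k))) \<longlonglongrightarrow> abs_L2 (transport a \<phi>)"
    and "\<And>k x. grad (\<psi> k) x \<noteq> 0 \<Longrightarrow> x \<in> cball 0 R" and "\<And>x. grad \<phi> x \<noteq> 0 \<Longrightarrow> x \<in> cball 0 R"
proof -
  obtain \<psi> R where \<psi>: "\<And>k. \<psi> k \<in> C0_inf"
    "\<And>k x. \<psi> k x \<noteq> 0 \<Longrightarrow> norm x \<le> R" "\<And>x. \<phi> x \<noteq> 0 \<Longrightarrow> norm x \<le> R"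
    "\<And>e. 0 < e \<Longrightarrow> \<forall>\<^sub>F k in sequentially. \<forall>x. \<bar>\<psi> k x - \<phi> x\<bar> \<le> e"
    "\<And>e. 0 < e \<Longrightarrow> \<forall>\<^sub>F k in sequentially. \<forall>x. norm (grad (\<psi> k) x - grad \<phi> x) \<le> e"
    by (rule C0_1_smooth_approximation[OF \<phi>]) blast
  note \<psi>1 = C0_inf_imp_C0_1[OF \<psi>(1)]
  have gs: "x \<in> cball 0 R" if "grad u x \<noteq> 0" "\<And>y. u y \<noteq> 0 \<Longrightarrow> norm y \<le> R" for u :: "'a \<Rightarrow> real" and x
  proof -
    have "closure {y. u y \<noteq> 0} \<subseteq> cball 0 R" using that(2) by (intro closure_minimal) auto
    then show ?thesis using grad_outside_support[of x u] that(1) by blast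
  qed
  obtain C where C: "0 \<le> C" "AE x in lebesgue. norm (a x) \<le> C" by (rule L_inf_bound[OF a])
  have 1: "(\<lambda>k. abs_L2 (\<psi> k)) \<longlonglongrightarrow> abs_L2 \<phi>"
  proof (rule abs_L2_tendsto_if_uniform_on_ball[where R = R])
    fix e :: real assume e: "0 < e"
    from \<psi>(4)[OF e] show "\<forall>\<^sub>F k in sequentially.
        AE x in lebesgue. \<bar>\<psi> k x - \<phi> x\<bar> \<le> e * indicator (cball 0 R) x"
    proof eventually_elim
      fix k assume *: "\<forall>x. \<bar>\<psi> k x - \<phi> x\<bar> \<le> e"
      have "\<bar>\<psi> k x - \<phi> x\<bar> \<le> e * indicator (cball 0 R) x" for x
      proof (cases "norm x \<le> R")
        case False
        then have "\<psi> k x = 0" "\<phi> x = 0" using \<psi>(2,3) by blast+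
        then show ?thesis using e by simp
      qed (use * in simp)
      then show "AE x in lebesgue. \<bar>\<psi> k x - \<phi> x\<bar> \<le> e * indicator (cball 0 R) x" by simp
    qed
  qed (intro C0_1_square_integrable \<psi>1 \<phi>)+
  have 2: "(\<lambda>k. abs_L2 (transport a (\<psi> k))) \<longlonglongrightarrow> abs_L2 (transport a \<phi>)"
  proof (rule abs_L2_tendsto_if_uniform_on_ball[where R = R])
    fix e :: real assume e: "0 < e"
    have e': "0 < e / (1 + C)" using e C(1) by simp
    from \<psi>(5)[OF e'] show "\<forall>\<^sub>F k in sequentially.
        AE x in lebesgue. \<bar>a x \<bullet> grad (\<psi> k) x - a x \<bullet> grad \<phi> x\<bar> \<le> e * indicator (cball 0 R) x"
    proof eventually_elim
      fix k assume *: "\<forall>x. norm (grad (\<psi> k) x - grad \<phi> x) \<le> e / (1 + C)"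
      show "AE x in lebesgue. \<bar>a x \<bullet> grad (\<psi> k) x - a x \<bullet> grad \<phi> x\<bar> \<le> e * indicator (cball 0 R) x"
        using C(2)
      proof eventually_elim
        fix x assume ax: "norm (a x) \<le> C"
        show "\<bar>a x \<bullet> grad (\<psi> k) x - a x \<bullet> grad \<phi> x\<bar> \<le> e * indicator (cball 0 R) x"
        proof (cases "x \<in> cball 0 R")
          case True
          have "\<bar>a x \<bullet> grad (\<psi> k) x - a x \<bullet> grad \<phi> x\<bar> = \<bar>a x \<bullet> (grad (\<psi> k) x - grad \<phi> x)\<bar>"
            by (simp add: inner_diff_right)
          also have "\<dots> \<le> (1 + C) * (e / (1 + C))"
            using ax * C(1) e' by (intro order_trans[OF Cauchy_Schwarz_ineq2] mult_mono) auto
          finally show ?thesis using True C(1) by simp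
        next
          case False
          then have "grad (\<psi> k) x = 0" "grad \<phi> x = 0"
            using gs[of "\<psi> k" x] gs[of \<phi> x] \<psi>(2,3) by blast+
          then show ?thesis using e by simp
        qed
      qed
    qed
  qed (intro square_integrable_transport a \<psi>1 \<phi>)+
  show thesis by (rule that[OF \<psi>(1) 1 2]) (use gs \<psi>(2,3) in blast)+
qed

text \<open>On functions with gradients supported in a fixed ball, the integral of \<open>a \<bullet> \<nabla>\<phi>\<close> is the inner
  product with the indicator function \<open>\<eta>\<close> of the ball, hence continuous in the mean.\<close>

lemma div_free_C0_1:
  fixes a :: "'a::euclidean_space \<Rightarrow> 'a"
  assumes a: "L_inf a" "div_free a" and \<phi>: "\<phi> \<in> C0_1"
  shows "(LINT x|lebesgue. a x \<bullet> grad \<phi> x) = 0"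
proof -
  obtain \<psi> R where "(\<lambda>k. abs_L2 (\<psi> k)) \<longlonglongrightarrow> abs_L2 \<phi>" and \<psi>: "\<And>k. \<psi> k \<in> C0_inf"
    "(\<lambda>k. abs_L2 (transport a (\<psi> k))) \<longlonglongrightarrow> abs_L2 (transport a \<phi>)"
    "\<And>k x. grad (\<psi> k) x \<noteq> 0 \<Longrightarrow> x \<in> cball 0 R" "\<And>x. grad \<phi> x \<noteq> 0 \<Longrightarrow> x \<in> cball 0 R"
    by (rule C0_1_approximation_in_graph[OF a(1) \<phi>]) blast
  define \<eta> :: "'a \<Rightarrow> real" where "\<eta> = indicator (cball 0 R)"
  have \<eta>: "square_integrable \<eta>"
  proof -
    have "(\<lambda>x. (\<eta> x)\<^sup>2) = \<eta>" by (auto simp: \<eta>_def indicator_def)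
    moreover have "cball 0 R \<in> sets lebesgue" "emeasure lebesgue (cball (0::'a) R) < \<infinity>"
      using lmeasurable_cball[of "0::'a" R] by (auto simp: fmeasurable_def)
    ultimately show ?thesis
      unfolding square_integrable_def by (simp add: \<eta>_def borel_measurable_indicator)
  qed
  have *: "abs_L2 (transport a u) \<bullet> abs_L2 \<eta> = (LINT x|lebesgue. a x \<bullet> grad u x)"
    if "u \<in> C0_1" "\<And>x. grad u x \<noteq> 0 \<Longrightarrow> x \<in> cball 0 R" for u
  proof -
    have "a x \<bullet> grad u x * \<eta> x = a x \<bullet> grad u x" for x
      using that(2)[of x] by (cases "grad u x = 0") (auto simp: \<eta>_def indicator_def)
    then have "(\<lambda>x. a x \<bullet> grad u x * \<eta> x) = transport a u" by (rule ext)
    then show ?thesis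
      using inner_abs_L2[OF square_integrable_transport[OF a(1) that(1)] \<eta>] by (simp only:)
  qed
  have "(\<lambda>k. abs_L2 (transport a (\<psi> k)) \<bullet> abs_L2 \<eta>) \<longlonglongrightarrow> abs_L2 (transport a \<phi>) \<bullet> abs_L2 \<eta>"
    by (intro tendsto_intros \<psi>(2))
  moreover have "abs_L2 (transport a (\<psi> k)) \<bullet> abs_L2 \<eta> = 0" for k
    using *[OF C0_inf_imp_C0_1[OF \<psi>(1)] \<psi>(3)] a(2) \<psi>(1) by (auto simp: div_free_def)
  ultimately have "abs_L2 (transport a \<phi>) \<bullet> abs_L2 \<eta> = 0" by (simp add: LIMSEQ_const_iff)
  then show ?thesis using *[OF \<phi> \<psi>(4)] by simp
qed

lemma C0_1_add: "u \<in> C0_1 \<Longrightarrow> v \<in> C0_1 \<Longrightarrow> (\<lambda>x. u x + v x) \<in> C0_1"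
  unfolding C0_1_iff
  by (auto intro!: C_k_add simp del: C_k.simps One_nat_def
      intro: bounded_subset[of "{x. u x \<noteq> 0} \<union> {x. v x \<noteq> 0}"])

lemma C0_1_mult: "C_k 1 u \<Longrightarrow> v \<in> C0_1 \<Longrightarrow> (\<lambda>x. u x * v x) \<in> C0_1"
  unfolding C0_1_iff
  by (auto intro!: C_k_mult simp del: C_k.simps One_nat_def intro: bounded_subset)

lemma grad_add:
  assumes "u \<in> C0_1" "v \<in> C0_1" shows "grad (\<lambda>x. u x + v x) x = grad u x + grad v x"
  by (rule grad_eqI)
    (use has_derivative_add[OF assms[THEN C0_1_has_derivative]] in \<open>simp add: inner_add_left\<close>)

lemma grad_mult:
  assumes "u \<in> C0_1" "v \<in> C0_1"
  shows "grad (\<lambda>x. u x * v x) x = u x *\<^sub>R grad v x + v x *\<^sub>R grad u x"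
  by (rule grad_eqI)
    (use has_derivative_mult[OF assms[THEN C0_1_has_derivative]]
      in \<open>simp add: inner_add_left mult.commute\<close>)

lemma grad_cmult:
  assumes "u \<in> C0_1" shows "grad (\<lambda>x. c * u x) x = c *\<^sub>R grad u x"
  by (rule grad_eqI) (use has_derivative_mult_right[OF C0_1_has_derivative[OF assms]] in simp)

lemma A0I: "u \<in> C0_1 \<Longrightarrow> (abs_L2 u, abs_L2 (transport a u)) \<in> A0 a"
  by (auto simp: A0_def)

lemma A0E:
  assumes "(f, g) \<in> A0 a"
  obtains u where "u \<in> C0_1" "f = abs_L2 u" "g = abs_L2 (transport a u)"
  using assms by (auto simp: A0_def)

lemma subspace_A0:
  fixes a :: "'a::euclidean_space \<Rightarrow> 'a"
  assumes a: "L_inf a" shows "subspace (A0 a)"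
  unfolding subspace_def
proof (intro conjI ballI allI)
  note sq = C0_1_square_integrable square_integrable_transport[OF a]
  have z: "(\<lambda>x::'a. 0) \<in> C0_1" by (simp add: C0_1_iff del: C_k.simps)
  have "grad (\<lambda>x::'a. 0) = (\<lambda>x. 0)"
    by (rule ext, rule grad_eqI) simp
  then have "(abs_L2 (\<lambda>x::'a. 0), abs_L2 (\<lambda>x. 0)) \<in> A0 a" using A0I[OF z, of a] by simp
  then show "0 \<in> A0 a" by (simp add: zero_prod_def zero_L2_def)
  show "p + q \<in> A0 a" if "p \<in> A0 a" "q \<in> A0 a" for p q
  proof -
    obtain u where u: "u \<in> C0_1" "p = (abs_L2 u, abs_L2 (transport a u))"
      using \<open>p \<in> A0 a\<close> by (auto simp: A0_def)
    obtain v where v: "v \<in> C0_1" "q = (abs_L2 v, abs_L2 (transport a v))"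
      using \<open>q \<in> A0 a\<close> by (auto simp: A0_def)
    have "p + q = (abs_L2 (\<lambda>x. u x + v x), abs_L2 (transport a (\<lambda>x. u x + v x)))"
      using u v by (simp add: plus_abs_L2 sq grad_add inner_add_right)
    then show ?thesis using A0I[OF C0_1_add[OF u(1) v(1)]] by simp
  qed
  show "c *\<^sub>R p \<in> A0 a" if "p \<in> A0 a" for c p
  proof -
    from that obtain u where u: "u \<in> C0_1" "p = (abs_L2 u, abs_L2 (transport a u))"
      by (auto simp: A0_def)
    have "c *\<^sub>R p = (abs_L2 (\<lambda>x. c * u x), abs_L2 (transport a (\<lambda>x. c * u x)))"
      using u by (simp add: scaleR_abs_L2 sq grad_cmult)
    moreover have "(\<lambda>x. c * u x) \<in> C0_1" using C0_1_mult[OF C_k_const u(1)] .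
    ultimately show ?thesis using A0I by metis
  qed
qed

text \<open>Skew-symmetry is the divergence condition tested against products: \<open>a \<bullet> \<nabla>(u v)\<close> is the
  sum of the two terms of the form.\<close>

lemma skew_symmetric_A0:
  fixes a :: "'a::euclidean_space \<Rightarrow> 'a"
  assumes a: "L_inf a" "div_free a" shows "skew_symmetric (A0 a)"
proof (rule skew_symmetricI)
  show sub: "subspace (A0 a)" by (rule subspace_A0[OF a(1)])
  have "Domain (A0 a) = fst ` A0 a" by (simp add: Domain_fst)
  then have sD: "subspace (Domain (A0 a))"
    using linear_subspace_image[OF linear_fst sub] by simp
  show "closure (Domain (A0 a)) = UNIV"
  proof (rule dense_if_orthogonal_complement_trivial[OF sD], rule C0_inf_separating)
    fix z :: "'a L2" and f :: "'a \<Rightarrow> real"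
    assume "\<And>y. y \<in> Domain (A0 a) \<Longrightarrow> z \<bullet> y = 0" "f \<in> C0_inf"
    then show "z \<bullet> abs_L2 f = 0" using A0I[OF C0_inf_imp_C0_1] by blast
  qed
  fix f g p q assume "(f, g) \<in> A0 a" "(p, q) \<in> A0 a"
  then obtain u v where u: "u \<in> C0_1" "f = abs_L2 u" "g = abs_L2 (transport a u)"
    and v: "v \<in> C0_1" "p = abs_L2 v" "q = abs_L2 (transport a v)" by (metis A0E)
  note sq = C0_1_square_integrable square_integrable_transport[OF a(1)]
  have "g \<bullet> p + f \<bullet> q = (LINT x|lebesgue. (a x \<bullet> grad u x) * v x) + (LINT x|lebesgue. u x * (a x \<bullet> grad v x))"
    using u v by (simp add: inner_abs_L2 sq)
  also have "\<dots> = (LINT x|lebesgue. (a x \<bullet> grad u x) * v x + u x * (a x \<bullet> grad v x))"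
    using u v by (intro Bochner_Integration.integral_add[symmetric] square_integrable_mult sq)
  also have "\<dots> = (LINT x|lebesgue. a x \<bullet> grad (\<lambda>x. u x * v x) x)"
    using u v by (simp add: grad_mult inner_add_right algebra_simps)
  also have "\<dots> = 0"
    using u v by (intro div_free_C0_1 a C0_1_mult) (simp add: C0_1_iff del: C_k.simps)
  finally show "g \<bullet> p + f \<bullet> q = 0" .
qed

lemma skew_symmetric_A_op: "L_inf a \<Longrightarrow> div_free a \<Longrightarrow> skew_symmetric (A_op a)"
  unfolding A_op_def by (intro closure_skew_symmetric skew_symmetric_A0)

lemma closed_A_op: "closed (A_op a)"
  by (simp add: A_op_def)

section \<open>Fubini's theorem for Lebesgue measurable functions on space-time\<close>

lemma borel_measurable_lebesgue_AE:
  fixes f g :: "'a::euclidean_space \<Rightarrow> real"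
  assumes g: "g \<in> borel_measurable lebesgue" and eq: "AE x in lebesgue. f x = g x"
  shows "f \<in> borel_measurable lebesgue"
proof (rule measurableI)
  fix S :: "real set" assume S: "S \<in> sets borel"
  have A: "g -` S \<inter> space lebesgue \<in> sets lebesgue" by (rule measurable_sets[OF g S])
  have "AE x in lebesgue. x \<in> g -` S \<inter> space lebesgue \<longleftrightarrow> x \<in> f -` S \<inter> space lebesgue"
    using eq by eventually_elim simp
  then show "f -` S \<inter> space lebesgue \<in> sets lebesgue"
    by (rule completion.in_sets_AE[OF _ A]) simp
qed simp

lemma AE_lebesgue_snd:
  fixes P :: "'a::euclidean_space \<Rightarrow> bool"
  assumes "AE x in lebesgue. P x"
  shows "AE p in (lebesgue :: (real \<times> 'a) measure). P (snd p)"
proof -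
  have "AE x in lborel. P x" using assms by (simp add: AE_completion_iff)
  then obtain N where N: "{x. \<not> P x} \<subseteq> N" "emeasure lborel N = 0" "N \<in> sets lborel"
    by (auto elim: AE_E)
  have "emeasure (lborel \<Otimes>\<^sub>M lborel) ((UNIV :: real set) \<times> N) = emeasure lborel (UNIV :: real set) * emeasure lborel N"
    using N(3) by (intro lborel.emeasure_pair_measure_Times) auto
  then have null: "(UNIV :: real set) \<times> N \<in> null_sets (lborel \<Otimes>\<^sub>M lborel)"
    using N(2,3) by (intro null_setsI) auto
  have "AE p in (lborel \<Otimes>\<^sub>M lborel :: (real \<times> 'a) measure). P (snd p)"
    by (rule AE_I'[OF null]) (use N(1) in auto)
  then show ?thesis unfolding lborel_prod by (rule AE_completion)
qed

text \<open>The field \<open>a\<close> is only Lebesgue measurable. Replacing a function by a Borel version changes it on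
  a null set \<open>N\<close>, and as a function on space-time on the null set \<open>\<real> \<times> N\<close>.\<close>

lemma borel_measurable_lebesgue_snd:
  fixes c :: "'a::euclidean_space \<Rightarrow> real"
  assumes "c \<in> borel_measurable lebesgue"
  shows "(\<lambda>p :: real \<times> 'a. c (snd p)) \<in> borel_measurable lebesgue"
proof -
  obtain c' where c': "c' \<in> borel_measurable borel" "AE x in lborel. c x = c' x"
    using completion_ex_borel_measurable_real[OF assms] by auto
  have "(\<lambda>p :: real \<times> 'a. c' (snd p)) \<in> borel_measurable (borel \<Otimes>\<^sub>M borel)"
    by (rule measurable_compose[OF measurable_snd c'(1)])
  then have "(\<lambda>p :: real \<times> 'a. c' (snd p)) \<in> borel_measurable borel" by (simp add: borel_prod)
  then have "(\<lambda>p :: real \<times> 'a. c' (snd p)) \<in> borel_measurable lebesgue"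
    by (intro measurable_completion) simp
  then show ?thesis
    by (rule borel_measurable_lebesgue_AE) (rule AE_lebesgue_snd[OF AE_completion[OF c'(2)]])
qed

lemma integral_lebesgue_AE_slice:
  fixes f g :: "'a::euclidean_space \<Rightarrow> real"
  assumes g: "g \<in> borel_measurable borel" and eq: "AE x in lborel. f x = g x"
  shows "(LINT x|lebesgue. f x) = (LINT x|lborel. g x)"
proof -
  have g': "g \<in> borel_measurable lborel" using g by simp
  have "f \<in> borel_measurable lebesgue" "AE x in lebesgue. f x = g x"
    using borel_measurable_lebesgue_AE[OF measurable_completion[OF g'] AE_completion[OF eq]]
      AE_completion[OF eq] by auto
  then have "(LINT x|lebesgue. f x) = (LINT x|lebesgue. g x)"
    by (intro integral_cong_AE measurable_completion[OF g'])
  then show ?thesis using integral_completion[OF g'] by simp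
qed

text \<open>Lebesgue measure on the product is the completion of the product measure, so Fubini's theorem is
  applied to a Borel version \<open>G\<close> of \<open>F\<close>; almost every slice of \<open>G\<close> is a version of that of \<open>F\<close>.\<close>

lemma Fubini_lebesgue:
  fixes F :: "real \<times> 'a::euclidean_space \<Rightarrow> real"
  assumes F: "integrable lebesgue F"
  shows "integrable lebesgue (\<lambda>t. LINT x|lebesgue. F (t, x))"
    and "(LINT p|lebesgue. F p) = (LINT t|lebesgue. LINT x|lebesgue. F (t, x))"
proof -
  have Fm: "F \<in> borel_measurable lebesgue" using F by simp
  obtain G where G: "G \<in> borel_measurable borel" "AE p in lborel. F p = G p"
    using completion_ex_borel_measurable_real[OF Fm] by auto
  have Gm: "G \<in> borel_measurable lebesgue" using G(1) by (intro measurable_completion) simp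
  have eq: "AE p in lebesgue. F p = G p" by (rule AE_completion[OF G(2)])
  have "integrable lebesgue G" using F integrable_cong_AE[OF Fm Gm eq] by simp
  then have Gi: "integrable (lborel \<Otimes>\<^sub>M lborel) G"
    using G(1) by (simp add: integrable_completion lborel_prod)
  have "AE p in (lborel \<Otimes>\<^sub>M lborel :: (real \<times> 'a) measure). F p = G p"
    unfolding lborel_prod by (rule G(2))
  then have "AE t in lborel. AE x in lborel. F (t, x) = G (t, x)" by (rule lborel_pair.AE_pair)
  moreover have "(\<lambda>x. G (t, x)) \<in> borel_measurable borel" for t
    using G(1) by (intro measurable_compose[OF _ G(1)]) (simp add: borel_prod[symmetric])
  ultimately have sl: "AE t in lborel. (LINT x|lebesgue. F (t, x)) = (LINT x|lborel. G (t, x))"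
    by (auto elim!: eventually_mono intro!: integral_lebesgue_AE_slice)
  note sl' = AE_completion[OF sl]
  have Ii: "integrable lborel (\<lambda>t. LINT x|lborel. G (t, x))"
    by (rule lborel_pair.integrable_fst'[OF Gi])
  then have Im: "(\<lambda>t. LINT x|lborel. G (t, x)) \<in> borel_measurable lebesgue"
    by (intro measurable_completion) auto
  have m: "(\<lambda>t. LINT x|lebesgue. F (t, x)) \<in> borel_measurable lebesgue"
    by (rule borel_measurable_lebesgue_AE[OF Im sl'])
  show "integrable lebesgue (\<lambda>t. LINT x|lebesgue. F (t, x))"
    using integrable_cong_AE[OF m Im sl'] Ii by (simp add: integrable_completion)
  have "(LINT p|lebesgue. F p) = (LINT p|lebesgue. G p)" by (rule integral_cong_AE[OF Fm Gm eq])
  also have "\<dots> = (LINT p|(lborel \<Otimes>\<^sub>M lborel). G p)"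
    using G(1) by (simp add: integral_completion lborel_prod)
  also have "\<dots> = (LINT t|lborel. LINT x|lborel. G (t, x))"
    using lborel_pair.integral_fst'[OF Gi] by simp
  also have "\<dots> = (LINT t|lebesgue. LINT x|lborel. G (t, x))"
    using Ii by (intro integral_completion[symmetric]) auto
  also have "\<dots> = (LINT t|lebesgue. LINT x|lebesgue. F (t, x))"
    by (rule integral_cong_AE[OF m Im sl', symmetric])
  finally show "(LINT p|lebesgue. F p) = (LINT t|lebesgue. LINT x|lebesgue. F (t, x))" .
qed

section \<open>Time slices of test functions on space-time\<close>

abbreviation slice :: "(real \<times> 'a::euclidean_space \<Rightarrow> real) \<Rightarrow> real \<Rightarrow> 'a \<Rightarrow> real" where
  "slice f t \<equiv> \<lambda>x. f (t, x)"

definition time_deriv :: "(real \<times> 'a::euclidean_space \<Rightarrow> real) \<Rightarrow> real \<times> 'a \<Rightarrow> real" where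
  "time_deriv f p = grad f p \<bullet> (1, 0)"

lemma test_function_has_derivative:
  assumes f: "f \<in> C0_inf"
  shows "((\<lambda>s. f (s, x)) has_real_derivative time_deriv f (t, x)) (at t)"
    and "(slice f t has_derivative (\<lambda>h. snd (grad f (t, x)) \<bullet> h)) (at x)"
proof -
  note D = C0_1_has_derivative[OF C0_inf_imp_C0_1[OF f], of "(t, x)"]
  have "((\<lambda>s. (s, x)) has_derivative (\<lambda>h. (h, 0))) (at t)"
    by (intro has_derivative_Pair has_derivative_ident has_derivative_const)
  from has_derivative_compose[OF this D]
  have "((\<lambda>s. f (s, x)) has_derivative (\<lambda>h. grad f (t, x) \<bullet> (h, 0))) (at t)" .
  moreover have "(\<lambda>h. grad f (t, x) \<bullet> (h, 0)) = (*) (time_deriv f (t, x))"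
    by (auto simp: time_deriv_def inner_prod_def)
  ultimately show "((\<lambda>s. f (s, x)) has_real_derivative time_deriv f (t, x)) (at t)"
    by (simp add: has_field_derivative_def)
  have "((\<lambda>y. (t, y)) has_derivative (\<lambda>h. (0, h))) (at x)"
    by (intro has_derivative_Pair has_derivative_ident has_derivative_const)
  from has_derivative_compose[OF this D]
  show "(slice f t has_derivative (\<lambda>h. snd (grad f (t, x)) \<bullet> h)) (at x)"
    by (simp add: inner_prod_def)
qed

lemma deriv_eq_time_deriv: "f \<in> C0_inf \<Longrightarrow> deriv (\<lambda>s. f (s, x)) t = time_deriv f (t, x)"
  by (intro DERIV_imp_deriv test_function_has_derivative)

lemma grad_slice: "f \<in> C0_inf \<Longrightarrow> grad (slice f t) x = snd (grad f (t, x))"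
  by (intro grad_eqI test_function_has_derivative)

lemma slice_C0_inf:
  assumes f: "f \<in> C0_inf" shows "slice f t \<in> C0_inf"
  unfolding C0_inf_iff
proof (intro conjI allI)
  fix k
  have L: "bounded_linear (\<lambda>x::'a. (0::real, x))"
    by (intro bounded_linear_Pair bounded_linear_zero bounded_linear_ident)
  have "C_k k f" using f by (simp add: C0_inf_iff)
  from C_k_affine[OF L this, of "(t, 0)"] show "C_k k (slice f t)" by simp
  have "bounded {p. f p \<noteq> 0}" using f by (simp add: C0_inf_iff)
  then have "bounded (snd ` {p. f p \<noteq> 0})" by (rule bounded_snd)
  then show "bounded {x. f (t, x) \<noteq> 0}" by (rule bounded_subset) force
qed

lemma time_deriv_continuous:
  assumes f: "f \<in> C0_inf"
  shows "continuous_on UNIV (time_deriv f)" "bounded {p. time_deriv f p \<noteq> 0}"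
    "continuous_on UNIV (slice (time_deriv f) t)" "bounded {x. time_deriv f (t, x) \<noteq> 0}"
proof -
  note f1 = C0_inf_imp_C0_1[OF f]
  show c: "continuous_on UNIV (time_deriv f)"
    unfolding time_deriv_def[abs_def] by (intro continuous_intros C0_1_continuous_grad[OF f1])
  show b: "bounded {p. time_deriv f p \<noteq> 0}"
    by (rule bounded_subset[OF C0_1_bounded_grad_support[OF f1]]) (auto simp: time_deriv_def)
  show "continuous_on UNIV (slice (time_deriv f) t)"
    by (rule continuous_on_compose2[OF c]) (auto intro!: continuous_intros)
  show "bounded {x. time_deriv f (t, x) \<noteq> 0}"
    by (rule bounded_subset[OF bounded_snd[OF b]]) force
qed

lemma time_deriv_square_integrable:
  "f \<in> C0_inf \<Longrightarrow> square_integrable (slice (time_deriv f) t)"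
  by (intro square_integrable_continuous_compact_support time_deriv_continuous)

lemma slice_square_integrable: "f \<in> C0_inf \<Longrightarrow> square_integrable (slice f t)"
  by (intro C0_1_square_integrable C0_inf_imp_C0_1 slice_C0_inf)

lemma slice_transport_square_integrable:
  "L_inf a \<Longrightarrow> f \<in> C0_inf \<Longrightarrow> square_integrable (transport a (slice f t))"
  by (intro square_integrable_transport C0_inf_imp_C0_1 slice_C0_inf)

text \<open>The difference quotients converge uniformly, by the mean value theorem and uniform
  continuity of the time derivative, and inside a fixed ball.\<close>

lemma slice_has_vector_derivative:
  fixes f :: "real \<times> 'a::euclidean_space \<Rightarrow> real"
  assumes f: "f \<in> C0_inf"
  shows "((\<lambda>s. abs_L2 (slice f s)) has_vector_derivative abs_L2 (slice (time_deriv f) t)) (at t within S)"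
  unfolding has_vector_derivative_def has_derivative_within_alt
proof (intro conjI allI impI bounded_linear_scaleR_left)
  fix e :: real assume e: "0 < e"
  obtain R where R: "\<And>p. f p \<noteq> 0 \<Longrightarrow> norm p \<le> R" and R': "\<And>p. time_deriv f p \<noteq> 0 \<Longrightarrow> norm p \<le> R"
  proof -
    obtain R1 R2 where "\<And>p. f p \<noteq> 0 \<Longrightarrow> norm p \<le> R1" "\<And>p. time_deriv f p \<noteq> 0 \<Longrightarrow> norm p \<le> R2"
      using f time_deriv_continuous(2)[OF f] by (auto simp: C0_inf_iff bounded_iff)
    then show ?thesis using that[of "max R1 R2"] by (meson le_max_iff_disj)
  qed
  define m where "m = sqrt (measure lebesgue (cball (0::'a) R))"
  have m: "0 \<le> m" by (simp add: m_def)
  define e' where "e' = e / (1 + m)"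
  have e': "0 < e'" "e' * m \<le> e" using e m by (auto simp: e'_def field_simps add_pos_nonneg)
  obtain d where d: "0 < d" "\<And>p q. norm q \<le> d \<Longrightarrow> \<bar>time_deriv f (p - q) - time_deriv f p\<bar> \<le> e'"
    using uniformly_continuous_compact_support[OF time_deriv_continuous(1,2)[OF f] e'(1)] by blast
  have est: "\<bar>f (s, x) - f (t, x) - (s - t) * time_deriv f (t, x)\<bar>
      \<le> (e' * \<bar>s - t\<bar>) * indicator (cball 0 R) x" if s: "\<bar>s - t\<bar> < d" for s x
  proof (cases "x \<in> cball 0 R")
    case False
    have "f (r, x) = 0" "time_deriv f (r, x) = 0" for r
      using R[of "(r, x)"] R'[of "(r, x)"] norm_snd_le[of x r] False by force+
    then show ?thesis using e'(1) by simp
  next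
    case True
    have "\<bar>(f (s, x) - s * time_deriv f (t, x)) - (f (t, x) - t * time_deriv f (t, x))\<bar> \<le> e' * \<bar>s - t\<bar>"
    proof -
      have "norm ((f (s, x) - s * time_deriv f (t, x)) - (f (t, x) - t * time_deriv f (t, x)))
          \<le> e' * norm (s - t)"
      proof (rule field_differentiable_bound[where S = "{min s t..max s t}" and
            f' = "\<lambda>r. time_deriv f (r, x) - time_deriv f (t, x)"])
        fix r assume r: "r \<in> {min s t..max s t}"
        have "((\<lambda>r. f (r, x) - r * time_deriv f (t, x)) has_real_derivative
            time_deriv f (r, x) - 1 * time_deriv f (t, x)) (at r)"
          by (rule DERIV_diff[OF test_function_has_derivative(1)[OF f] DERIV_cmult_right[OF DERIV_ident]])
        then show "((\<lambda>r. f (r, x) - r * time_deriv f (t, x)) has_field_derivative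
            time_deriv f (r, x) - time_deriv f (t, x)) (at r within {min s t..max s t})"
          by (simp add: has_field_derivative_at_within)
        have "norm ((t - r, 0::'a)) \<le> d" using r s by (auto simp: norm_Pair min_def max_def split: if_splits)
        from d(2)[OF this, of "(t, x)"]
        show "norm (time_deriv f (r, x) - time_deriv f (t, x)) \<le> e'" by simp
      qed auto
      then show ?thesis by simp
    qed
    then show ?thesis using True by (simp add: algebra_simps)
  qed
  have "norm (abs_L2 (slice f s) - abs_L2 (slice f t) - (s - t) *\<^sub>R abs_L2 (slice (time_deriv f) t))
      \<le> e * norm (s - t)" if "norm (s - t) < d" for s
  proof -
    note sq = slice_square_integrable[OF f] time_deriv_square_integrable[OF f]
    have "abs_L2 (slice f s) - abs_L2 (slice f t) - (s - t) *\<^sub>R abs_L2 (slice (time_deriv f) t)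
        = abs_L2 (\<lambda>x. f (s, x) - f (t, x) - (s - t) * time_deriv f (t, x))"
      by (simp add: scaleR_abs_L2 minus_abs_L2 sq square_integrable_diff square_integrable_scale)
    also have "norm \<dots> \<le> (e' * \<bar>s - t\<bar>) * m"
      unfolding m_def using e'(1) est[of s] that
      by (intro norm_abs_L2_le_on_ball square_integrable_diff square_integrable_scale sq) auto
    also have "\<dots> = (e' * m) * \<bar>s - t\<bar>" by simp
    also have "\<dots> \<le> e * \<bar>s - t\<bar>" using e'(2) by (rule mult_right_mono) simp
    finally show ?thesis by simp
  qed
  then show "\<exists>d>0. \<forall>s\<in>S. norm (s - t) < d \<longrightarrow>
      norm (abs_L2 (slice f s) - abs_L2 (slice f t) - (s - t) *\<^sub>R abs_L2 (slice (time_deriv f) t))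
      \<le> e * norm (s - t)" using d(1) by blast
qed

section \<open>Generalized solutions and the weak evolution equation\<close>

lemma continuous_bounded_support_bounded:
  fixes g :: "'a::euclidean_space \<Rightarrow> 'b::real_normed_vector"
  assumes g: "continuous_on UNIV g" and supp: "\<And>x. g x \<noteq> 0 \<Longrightarrow> norm x \<le> R"
  obtains B where "0 \<le> B" "\<And>x. norm (g x) \<le> B"
proof -
  have "compact (g ` cball 0 R)"
    using g by (intro compact_continuous_image) (auto intro: continuous_on_subset)
  then have "bounded (g ` cball 0 R)" by (rule compact_imp_bounded)
  then obtain B where "\<forall>y\<in>g ` cball 0 R. norm y \<le> B" unfolding bounded_iff by blast
  then have B: "norm (g x) \<le> B" if "norm x \<le> R" for x using that by simp
  have "norm (g x) \<le> max 0 B" for x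
    using supp[of x] B[of x] by (cases "g x = 0") auto
  then show ?thesis using that[of "max 0 B"] by simp
qed

lemma space_time_slice_integral:
  fixes v :: "'a::euclidean_space L2"
  assumes a: "L_inf a" and f: "f \<in> C0_inf"
    and slice: "AE x in lebesgue. w x = rep_L2 v x"
  shows "(LINT x|lebesgue. w x * (time_deriv f (t, x) + a x \<bullet> snd (grad f (t, x))))
    = v \<bullet> abs_L2 (slice (time_deriv f) t) + v \<bullet> abs_L2 (transport a (slice f t))"
proof -
  note sq = time_deriv_square_integrable[OF f, of t] slice_transport_square_integrable[OF a f, of t]
  have g: "snd (grad f (t, x)) = grad (slice f t) x" for x by (simp add: grad_slice[OF f])
  have i: "integrable lebesgue (\<lambda>x. rep_L2 v x * time_deriv f (t, x))"
    "integrable lebesgue (\<lambda>x. rep_L2 v x * (a x \<bullet> grad (slice f t) x))"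
    by (intro square_integrable_mult square_integrable_rep sq)+
  have rm: "rep_L2 v \<in> borel_measurable lebesgue"
    using square_integrable_rep[of v] by (simp add: square_integrable_def)
  have wm: "w \<in> borel_measurable lebesgue" by (rule borel_measurable_lebesgue_AE[OF rm slice])
  have hm: "(\<lambda>x. time_deriv f (t, x) + a x \<bullet> grad (slice f t) x) \<in> borel_measurable lebesgue"
    using sq by (intro borel_measurable_add) (auto simp: square_integrable_def)
  have "(LINT x|lebesgue. w x * (time_deriv f (t, x) + a x \<bullet> grad (slice f t) x))
      = (LINT x|lebesgue. rep_L2 v x * (time_deriv f (t, x) + a x \<bullet> grad (slice f t) x))"
    using slice by (intro integral_cong_AE borel_measurable_times rm wm hm) (auto elim!: eventually_mono)
  also have "\<dots> = (LINT x|lebesgue. rep_L2 v x * time_deriv f (t, x) + rep_L2 v x * (a x \<bullet> grad (slice f t) x))"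
    by (simp add: distrib_left)
  also have "\<dots> = (LINT x|lebesgue. rep_L2 v x * time_deriv f (t, x))
      + (LINT x|lebesgue. rep_L2 v x * (a x \<bullet> grad (slice f t) x))"
    by (rule Bochner_Integration.integral_add[OF i])
  also have "\<dots> = v \<bullet> abs_L2 (slice (time_deriv f) t) + v \<bullet> abs_L2 (transport a (slice f t))"
    by (simp add: inner_abs_L2_right sq)
  finally show ?thesis by (simp only: g)
qed

text \<open>Fubini's theorem turns the space-time integral in the definition of a generalized solution into
  a time integral of inner products, the form in which it meets the evolution equation.\<close>

lemma space_time_pairing:
  fixes u :: "real \<times> 'a::euclidean_space \<Rightarrow> real" and v :: "real \<Rightarrow> 'a L2"
  assumes a: "L_inf a" and f: "f \<in> C0_inf" and u: "L1_loc ({0..} \<times> UNIV) u"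
    and slice: "\<And>t. 0 \<le> t \<Longrightarrow> AE x in lebesgue. u (t, x) = rep_L2 (v t) x"
    and R: "\<And>p. f p \<noteq> 0 \<Longrightarrow> norm p \<le> R"
  shows "((\<lambda>t. v t \<bullet> abs_L2 (slice (time_deriv f) t) + v t \<bullet> abs_L2 (transport a (slice f t)))
    has_integral
    (LINT p:{0<..} \<times> UNIV|lebesgue.
      (case p of (t, x) \<Rightarrow> u (t, x) * deriv (\<lambda>s. f (s, x)) t + u (t, x) * (a x \<bullet> grad (\<lambda>y. f (t, y)) x))))
    {0..R}" (is "(?q has_integral ?I) _")
proof -
  define h where "h p = time_deriv f p + a (snd p) \<bullet> snd (grad f p)" for p
  define X where "X = ({0<..} :: real set) \<times> (UNIV :: 'a set)"
  define K where "K = {0..R} \<times> cball (0::'a) R"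
  note f1 = C0_inf_imp_C0_1[OF f]
  have grad0: "norm p \<le> R" if "grad f p \<noteq> 0" for p
  proof -
    have "closure {p. f p \<noteq> 0} \<subseteq> cball 0 R" using R by (intro closure_minimal) auto
    then show ?thesis using grad_outside_support[of p f] that by force
  qed
  have h0: "norm p \<le> R" if "h p \<noteq> 0" for p
    using grad0[of p] that by (cases "grad f p = 0") (auto simp: h_def time_deriv_def)
  obtain B where B: "0 \<le> B" "\<And>p. norm (grad f p) \<le> B"
    using continuous_bounded_support_bounded[OF C0_1_continuous_grad[OF f1] grad0] by blast
  obtain C where C: "0 \<le> C" "AE x in lebesgue. norm (a x) \<le> C" by (rule L_inf_bound[OF a])
  have hm: "h \<in> borel_measurable lebesgue"
  proof -
    have aj: "(\<lambda>x. a x \<bullet> j) \<in> borel_measurable lebesgue" for j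
      using a by (auto simp: L_inf_def)
    have gj: "continuous_on UNIV (\<lambda>p. snd (grad f p) \<bullet> j)" for j
      by (intro continuous_intros C0_1_continuous_grad f1)
    have "(\<lambda>p. time_deriv f p + (\<Sum>j\<in>Basis. (a (snd p) \<bullet> j) * (snd (grad f p) \<bullet> j)))
        \<in> borel_measurable lebesgue"
      by (intro borel_measurable_add borel_measurable_sum borel_measurable_times
          borel_measurable_lebesgue_snd[OF aj] continuous_lebesgue_measurable gj time_deriv_continuous f)
    then show ?thesis by (simp add: h_def[abs_def] euclidean_inner[symmetric])
  qed
  have hb: "AE p in lebesgue. \<bar>h p\<bar> \<le> B + C * B"
    using AE_lebesgue_snd[OF C(2)]
  proof eventually_elim
    fix p :: "real \<times> 'a" assume ap: "norm (a (snd p)) \<le> C"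
    have "\<bar>time_deriv f p\<bar> \<le> norm (grad f p) * norm ((1::real, 0::'a))"
      unfolding time_deriv_def by (rule Cauchy_Schwarz_ineq2)
    then have "\<bar>time_deriv f p\<bar> \<le> B" using B(2)[of p] by (simp add: norm_Pair)
    moreover have "norm (snd (grad f p)) \<le> B"
      using norm_snd_le[of "snd (grad f p)" "fst (grad f p)"] B(2)[of p] by simp
    then have "\<bar>a (snd p) \<bullet> snd (grad f p)\<bar> \<le> C * B"
      using ap C(1) by (intro order_trans[OF Cauchy_Schwarz_ineq2] mult_mono) auto
    ultimately show "\<bar>h p\<bar> \<le> B + C * B" unfolding h_def by linarith
  qed
  have "compact K" "K \<subseteq> {0..} \<times> UNIV" by (auto simp: K_def intro: compact_Times)
  then have Ki: "integrable lebesgue (\<lambda>p. indicator K p *\<^sub>R u p)"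
    using u by (auto simp: L1_loc_def set_integrable_def)
  define F where "F p = indicator X p *\<^sub>R (u p * h p)" for p
  \<comment> \<open>The factor \<open>h\<close> confines the integral to the compact set \<open>K\<close>, where \<open>u\<close> is integrable.\<close>
  have F_eq: "F p = indicator X p * ((indicator K p *\<^sub>R u p) * h p)" for p
  proof (cases "p \<in> X \<and> h p \<noteq> 0")
    case True
    then obtain t x where p: "p = (t, x)" "0 < t" by (auto simp: X_def)
    have "norm p \<le> R" using h0 True by blast
    then have "t \<le> R" "norm x \<le> R"
      using norm_fst_le[of t x] norm_snd_le[of x t] p by auto
    then have "p \<in> K" using p by (simp add: K_def)
    then show ?thesis by (simp add: F_def)
  qed (auto simp: F_def)
  have Xm: "X \<in> sets lebesgue"
  proof -
    have "X = {p. 0 < fst p}" by (auto simp: X_def)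
    moreover have "open {p :: real \<times> 'a. 0 < fst p}" by (intro open_Collect_less continuous_intros)
    ultimately show ?thesis by simp
  qed
  have Fi: "integrable lebesgue F"
  proof (rule Bochner_Integration.integrable_bound)
    show "integrable lebesgue (\<lambda>p. (B + C * B) * norm (indicator K p *\<^sub>R u p))" using Ki by auto
    show "F \<in> borel_measurable lebesgue"
      unfolding F_eq[abs_def] using Ki hm Xm
      by (intro borel_measurable_times borel_measurable_indicator) auto
    show "AE p in lebesgue. norm (F p) \<le> norm ((B + C * B) * norm (indicator K p *\<^sub>R u p))"
      using hb
    proof eventually_elim
      fix p assume hp: "\<bar>h p\<bar> \<le> B + C * B"
      have "norm (F p) \<le> 1 * (norm (indicator K p *\<^sub>R u p) * \<bar>h p\<bar>)"
        unfolding F_eq norm_mult by (intro mult_mono) (auto simp: indicator_def)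
      also have "\<dots> \<le> norm (indicator K p *\<^sub>R u p) * (B + C * B)"
        using hp by (simp add: mult_left_mono)
      finally show "norm (F p) \<le> norm ((B + C * B) * norm (indicator K p *\<^sub>R u p))"
        using B(1) C(1) by (simp add: mult.commute)
    qed
  qed
  have I: "?I = (LINT p|lebesgue. F p)"
    unfolding set_lebesgue_integral_def
  proof (rule Bochner_Integration.integral_cong[OF refl])
    fix p :: "real \<times> 'a"
    obtain t x where p: "p = (t, x)" by fastforce
    show "indicator ({0<..} \<times> UNIV) p *\<^sub>R (case p of (t, x) \<Rightarrow>
        u (t, x) * deriv (\<lambda>s. f (s, x)) t + u (t, x) * (a x \<bullet> grad (\<lambda>y. f (t, y)) x)) = F p"
      by (simp add: p F_def X_def h_def deriv_eq_time_deriv[OF f] grad_slice[OF f] distrib_left)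
  qed
  define G where "G t = (LINT x|lebesgue. F (t, x))" for t
  have G0: "G t = 0" if "t \<le> 0 \<or> R < t" for t
  proof -
    have "F (t, x) = 0" for x
      using that h0[of "(t, x)"] norm_fst_le[of t x] by (auto simp: F_def X_def indicator_def)
    then show ?thesis by (simp add: G_def)
  qed
  have Gq: "G t = ?q t" if "0 < t" for t
  proof -
    have "G t = (LINT x|lebesgue. u (t, x) * (time_deriv f (t, x) + a x \<bullet> snd (grad f (t, x))))"
      using that by (simp add: G_def F_def X_def h_def)
    also have "\<dots> = ?q t"
      using that by (intro space_time_slice_integral a f slice) auto
    finally show ?thesis .
  qed
  have Gi: "integrable lebesgue G" and GI: "?I = (LINT t|lebesgue. G t)"
    using Fubini_lebesgue[OF Fi] by (auto simp: G_def[abs_def] I)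
  have ind: "(\<lambda>t. indicator {0..R} t *\<^sub>R G t) = G"
  proof
    fix t
    show "indicator {0..R} t *\<^sub>R G t = G t"
      using G0[of t] by (cases "t \<in> {0..R}") (auto simp: not_le)
  qed
  have "set_integrable lebesgue {0..R} G" unfolding set_integrable_def ind by (rule Gi)
  note S = set_lebesgue_integral_eq_integral[OF this]
  have "(LINT t|lebesgue. G t) = integral {0..R} G"
    using S(2) unfolding set_lebesgue_integral_def ind .
  then have "(G has_integral ?I) {0..R}" unfolding GI using S(1) by (simp add: has_integral_iff)
  then show ?thesis
    by (rule has_integral_spike_finite[of "{0}", rotated 2]) (use Gq in auto)
qed

lemma L1_loc_rep_L2: "L1_loc UNIV (rep_L2 (v :: 'a::euclidean_space L2))"
  unfolding L1_loc_def
proof (intro allI impI, elim conjE)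
  fix K :: "'a set" assume K: "compact K"
  then have "K \<in> sets lebesgue" "emeasure lebesgue K < \<infinity>"
    using lmeasurable_compact by (auto simp: fmeasurable_def)
  moreover have "(\<lambda>x. (indicator K x)\<^sup>2) = (indicator K :: 'a \<Rightarrow> real)" by (auto simp: indicator_def)
  ultimately have "square_integrable (indicator K :: 'a \<Rightarrow> real)"
    unfolding square_integrable_def by (simp add: borel_measurable_indicator)
  then show "rep_L2 v absolutely_integrable_on K"
    using square_integrable_mult[OF _ square_integrable_rep, of "indicator K" v]
    by (simp add: set_integrable_def)
qed

text \<open>The fundamental theorem of calculus for \<open>T t u0 \<bullet> f(t, \<cdot>)\<close> between time zero and a time \<open>R\<close>
  beyond the support of \<open>f\<close>.\<close>

lemma weak_evolution_generalized_solution: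
  fixes a :: "'a::euclidean_space \<Rightarrow> 'a"
  assumes a: "L_inf a" and T: "contraction_semigroup T" "weak_evolution (A_op a) T"
    and u: "L1_loc ({0..} \<times> UNIV) u"
    and slice: "\<And>t. 0 \<le> t \<Longrightarrow> AE x in lebesgue. u (t, x) = rep_L2 (T t u0) x"
  shows "generalized_solution a (rep_L2 u0) u"
  unfolding generalized_solution_def
proof (intro conjI ballI u L1_loc_rep_L2)
  fix f :: "real \<times> 'a \<Rightarrow> real" assume f: "f \<in> C0_inf"
  obtain R0 where R0: "\<And>p. f p \<noteq> 0 \<Longrightarrow> norm p \<le> R0" using f by (auto simp: C0_inf_iff bounded_iff)
  define R where "R = \<bar>R0\<bar> + 1"
  have R: "0 \<le> R" "\<And>p. f p \<noteq> 0 \<Longrightarrow> norm p \<le> R" using R0 by (fastforce simp: R_def)+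
  let ?q = "\<lambda>t. T t u0 \<bullet> abs_L2 (slice (time_deriv f) t) + T t u0 \<bullet> abs_L2 (transport a (slice f t))"
  have graph: "(abs_L2 (slice f t), abs_L2 (transport a (slice f t))) \<in> A_op a" for t
    using A0I[OF C0_inf_imp_C0_1[OF slice_C0_inf[OF f]]] closure_subset unfolding A_op_def by blast
  have "(?q has_integral T R u0 \<bullet> abs_L2 (slice f R) - T 0 u0 \<bullet> abs_L2 (slice f 0)) {0..R}"
  proof (rule fundamental_theorem_of_calculus[OF R(1)])
    fix t assume "t \<in> {0..R}"
    then have "((\<lambda>s. T s u0 \<bullet> abs_L2 (slice f s)) has_real_derivative
        T t u0 \<bullet> abs_L2 (transport a (slice f t)) + T t u0 \<bullet> abs_L2 (slice (time_deriv f) t))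
        (at t within {0..R})"
      by (intro weak_evolution_pairing[OF T, where z = "\<lambda>t. abs_L2 (transport a (slice f t))"
            and y' = "\<lambda>t. abs_L2 (slice (time_deriv f) t)"] graph slice_has_vector_derivative f) auto
    then show "((\<lambda>s. T s u0 \<bullet> abs_L2 (slice f s)) has_vector_derivative ?q t) (at t within {0..R})"
      by (simp add: has_real_derivative_iff_has_vector_derivative add.commute)
  qed
  moreover have "slice f R = (\<lambda>x. 0)"
  proof
    fix x :: 'a
    have "R \<le> norm (R, x)" using norm_fst_le[of R x] by simp
    then have "\<not> norm (R, x) \<le> R0" by (simp add: R_def)
    then show "f (R, x) = 0" using R0 by blast
  qed
  then have "abs_L2 (slice f R) = 0" by (simp add: zero_L2_def)
  moreover have "T 0 u0 = u0" using T(1) by (simp add: contraction_semigroup_def C0_semigroup_def)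
  moreover have "u0 \<bullet> abs_L2 (slice f 0) = (LINT x|lebesgue. rep_L2 u0 x * f (0, x))"
    by (rule inner_abs_L2_right[OF slice_square_integrable[OF f]])
  ultimately have "(?q has_integral - (LINT x|lebesgue. rep_L2 u0 x * f (0, x))) {0..R}" by simp
  from has_integral_unique[OF space_time_pairing[OF a f u slice R(2)] this]
  show "(LINT p:{0<..} \<times> UNIV|lebesgue. (case p of (t, x) \<Rightarrow>
      u (t, x) * deriv (\<lambda>s. f (s, x)) t + u (t, x) * (a x \<bullet> grad (\<lambda>y. f (t, y)) x)))
      + (LINT x|lebesgue. rep_L2 u0 x * f (0, x)) = 0"
    by (rule eq_neg_iff_add_eq_0[THEN iffD1])
qed

text \<open>A jointly measurable version of an orbit: step functions in time whose mesh is so fine that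
  they converge to the orbit fast enough to converge almost everywhere, at every single time.\<close>

lemma joint_version_exists:
  fixes T :: "real \<Rightarrow> 'a::euclidean_space L2 \<Rightarrow> 'a L2"
  assumes T: "contraction_semigroup T"
  obtains u where "u \<in> borel_measurable borel"
    and "\<And>t. 0 \<le> t \<Longrightarrow> AE x in lebesgue. u (t, x) = rep_L2 (T t u0) x"
proof -
  have "\<exists>d>0. \<forall>s\<ge>0. \<forall>t\<ge>0. \<bar>s - t\<bar> < d \<longrightarrow> norm (T s u0 - T t u0) < (1/2) ^ k" for k :: nat
    using contraction_semigroup_modulus[OF T, of "(1/2) ^ k" u0] by (metis zero_less_power half_gt_zero zero_less_one)
  then obtain d where d: "\<And>k. 0 < d k" and
    dT: "\<And>k s t. 0 \<le> s \<Longrightarrow> 0 \<le> t \<Longrightarrow> \<bar>s - t\<bar> < d k \<Longrightarrow> norm (T s u0 - T t u0) < (1/2) ^ k" by metis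
  have "\<exists>b. b \<in> borel_measurable borel \<and> (AE x in lborel. rep_L2 v x = b x)" for v :: "'a L2"
    using completion_ex_borel_measurable_real[of "rep_L2 v" lborel] square_integrable_rep[of v]
    by (auto simp: square_integrable_def)
  then obtain b :: "'a L2 \<Rightarrow> 'a \<Rightarrow> real" where b: "\<And>v. b v \<in> borel_measurable borel"
    and b_eq: "\<And>v. AE x in lborel. rep_L2 v x = b v x" by metis
  define j where "j k t = nat \<lfloor>t / d k\<rfloor>" for k :: nat and t :: real
  define w where "w k p = b (T (real (j k (fst p)) * d k) u0) (snd p)" for k and p :: "real \<times> 'a"
  have wm: "w k \<in> borel_measurable (borel \<Otimes>\<^sub>M borel)" for k
    unfolding w_def
  proof (rule measurable_compose_countable[where f = "\<lambda>i p. b (T (real i * d k) u0) (snd p)"])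
    show "(\<lambda>p. b (T (real i * d k) u0) (snd p)) \<in> borel_measurable (borel \<Otimes>\<^sub>M borel)" for i
      by (rule measurable_compose[OF measurable_snd b])
    show "(\<lambda>p. j k (fst p)) \<in> (borel \<Otimes>\<^sub>M borel) \<rightarrow>\<^sub>M count_space UNIV"
      unfolding j_def by measurable
  qed
  define u where "u p = lim (\<lambda>k. w k p)" for p
  have "u \<in> borel_measurable (borel \<Otimes>\<^sub>M borel)"
    unfolding u_def[abs_def] using wm by (rule borel_measurable_lim_metric)
  then have um: "u \<in> borel_measurable borel" by (simp add: borel_prod)
  have "AE x in lebesgue. u (t, x) = rep_L2 (T t u0) x" if t: "0 \<le> t" for t
  proof -
    have w: "abs_L2 (slice (w k) t) = T (real (j k t) * d k) u0" "square_integrable (slice (w k) t)" for k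
    proof -
      let ?v = "T (real (j k t) * d k) u0"
      have eq: "AE x in lebesgue. rep_L2 ?v x = slice (w k) t x"
        using AE_completion[OF b_eq[of ?v]] by (simp add: w_def)
      have m: "slice (w k) t \<in> borel_measurable lebesgue"
        unfolding w_def fst_conv snd_conv using b by (intro measurable_completion) simp
      have "integrable lebesgue (\<lambda>x. (slice (w k) t x)\<^sup>2)"
      proof (rule integrable_cong_AE_imp)
        show "integrable lebesgue (\<lambda>x. (rep_L2 ?v x)\<^sup>2)"
          using square_integrable_rep[of ?v] by (simp add: square_integrable_def)
        show "AE x in lebesgue. (rep_L2 ?v x)\<^sup>2 = (slice (w k) t x)\<^sup>2"
          using eq by eventually_elim simp
      qed (use m in simp)
      with m show sq: "square_integrable (slice (w k) t)" by (simp add: square_integrable_def)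
      have "abs_L2 (rep_L2 ?v) = abs_L2 (slice (w k) t)"
        by (rule abs_L2_eqI[OF square_integrable_rep sq eq])
      then show "abs_L2 (slice (w k) t) = ?v" by simp
    qed
    have "AE x in lebesgue. (\<lambda>k. slice (w k) t x) \<longlonglongrightarrow> rep_L2 (T t u0) x"
    proof (rule AE_tendsto_if_rapid[OF w(2)])
      fix k
      have "real (j k t) \<le> t / d k" "t / d k < real (j k t) + 1"
        using t d[of k] by (auto simp: j_def of_nat_nat)
      then have "real (j k t) * d k \<le> t" "t < real (j k t) * d k + d k"
        using d[of k] by (auto simp: field_simps)
      then have "norm (T (real (j k t) * d k) u0 - T t u0) < (1/2) ^ k"
        using t d[of k] by (intro dT) auto
      then show "norm (abs_L2 (slice (w k) t) - T t u0) \<le> (1/2) ^ k" by (simp add: w(1))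
    qed
    then show ?thesis by eventually_elim (simp add: u_def limI)
  qed
  with um that show thesis by blast
qed

text \<open>The bound \<open>|u| \<le> u\<^sup>2 + 1\<close> reduces local integrability to the norms of the slices, which do
  not exceed that of \<open>u0\<close>.\<close>

lemma joint_version_L1_loc:
  fixes T :: "real \<Rightarrow> 'a::euclidean_space L2 \<Rightarrow> 'a L2"
  assumes T: "contraction_semigroup T" and u: "u \<in> borel_measurable borel"
    and slice: "\<And>t. 0 \<le> t \<Longrightarrow> AE x in lebesgue. u (t, x) = rep_L2 (T t u0) x"
  shows "L1_loc ({0..} \<times> UNIV) u"
  unfolding L1_loc_def
proof (intro allI impI, elim conjE)
  fix K :: "(real \<times> 'a) set" assume K: "compact K" "K \<subseteq> {0..} \<times> UNIV"
  obtain N where N: "\<And>p. p \<in> K \<Longrightarrow> norm p \<le> N" using compact_imp_bounded[OF K(1)] by (auto simp: bounded_iff)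
  let ?B = "cball (0::'a) N"
  have Kb: "K \<in> sets borel" using K(1) by (simp add: compact_imp_closed borel_closed)
  have sub: "t \<in> {0..N} \<and> x \<in> ?B" if "(t, x) \<in> K" for t x
    using N[OF that] norm_fst_le[of t x] norm_snd_le[of x t] K(2) that by auto
  have slice_bound: "(\<integral>\<^sup>+x. ennreal (norm (indicator K (t, x) *\<^sub>R u (t, x))) \<partial>lborel)
      \<le> ennreal ((norm u0)\<^sup>2 + measure lborel ?B) * indicator {0..N} t" for t
  proof (cases "t \<in> {0..N}")
    case False
    then have "indicator K (t, x) = (0::real)" for x using sub[of t x] by (auto simp: indicator_def)
    then show ?thesis by simp
  next
    case True
    let ?v = "T t u0"
    have um: "(\<lambda>x. u (t, x)) \<in> borel_measurable borel"
      using u by (intro measurable_compose[OF _ u]) (simp add: borel_prod[symmetric])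
    have eq: "AE x in lborel. u (t, x) = rep_L2 ?v x"
      using slice[of t] True by (simp add: AE_completion_iff)
    have le: "s \<le> s\<^sup>2 + 1" for s :: real
    proof -
      have "0 \<le> (s - 1)\<^sup>2" by simp
      then have "2 * s \<le> s\<^sup>2 + 1" by (simp add: power2_diff)
      moreover have "0 \<le> s\<^sup>2" by simp
      ultimately show ?thesis by linarith
    qed
    have "(\<integral>\<^sup>+x. ennreal (norm (indicator K (t, x) *\<^sub>R u (t, x))) \<partial>lborel)
        \<le> (\<integral>\<^sup>+x. ennreal ((u (t, x))\<^sup>2) + indicator ?B x \<partial>lborel)"
    proof (rule nn_integral_mono)
      fix x
      show "ennreal (norm (indicator K (t, x) *\<^sub>R u (t, x))) \<le> ennreal ((u (t, x))\<^sup>2) + indicator ?B x"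
      proof (cases "(t, x) \<in> K")
        case True
        then have "x \<in> ?B" using sub by blast
        have "ennreal \<bar>u (t, x)\<bar> \<le> ennreal ((u (t, x))\<^sup>2 + 1)"
          using le[of "\<bar>u (t, x)\<bar>"] by (intro ennreal_leI) simp
        also have "\<dots> = ennreal ((u (t, x))\<^sup>2) + 1" using ennreal_plus[of "(u (t, x))\<^sup>2" 1] by simp
        finally show ?thesis using True \<open>x \<in> ?B\<close> by simp
      qed simp
    qed
    also have "\<dots> = (\<integral>\<^sup>+x. ennreal ((u (t, x))\<^sup>2) \<partial>lborel) + emeasure lborel ?B"
      using um by (subst nn_integral_add) (auto intro!: borel_measurable_indicator borel_closed)
    also have "(\<integral>\<^sup>+x. ennreal ((u (t, x))\<^sup>2) \<partial>lborel) = (\<integral>\<^sup>+x. ennreal ((u (t, x))\<^sup>2) \<partial>lebesgue)"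
      by (rule nn_integral_completion[symmetric])
    also have "\<dots> = (\<integral>\<^sup>+x. ennreal ((rep_L2 ?v x)\<^sup>2) \<partial>lebesgue)"
      using slice[of t] True by (intro nn_integral_cong_AE) (auto elim!: eventually_mono)
    also have "\<dots> = ennreal ((norm ?v)\<^sup>2)" using nn_integral_square[OF square_integrable_rep, of ?v] by simp
    also have "\<dots> \<le> ennreal ((norm u0)\<^sup>2)"
      using T True by (intro ennreal_leI power_mono) (auto simp: contraction_semigroup_def)
    also have "ennreal ((norm u0)\<^sup>2) + emeasure lborel ?B = ennreal ((norm u0)\<^sup>2 + measure lborel ?B)"
      using emeasure_eq_ennreal_measure[of lborel ?B] emeasure_lborel_cball_finite[of 0 N]
      by (simp add: less_top)
    finally show ?thesis using True by (simp add: add_right_mono)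
  qed
  have m: "(\<lambda>p. indicator K p *\<^sub>R u p) \<in> borel_measurable borel" using u Kb by measurable
  have "(\<integral>\<^sup>+p. ennreal (norm (indicator K p *\<^sub>R u p)) \<partial>lborel)
      = (\<integral>\<^sup>+t. \<integral>\<^sup>+x. ennreal (norm (indicator K (t, x) *\<^sub>R u (t, x))) \<partial>lborel \<partial>lborel)"
    using m unfolding lborel_prod[symmetric]
    by (intro lborel.nn_integral_fst[symmetric]) (simp add: borel_prod[symmetric] measurable_compose[OF _ measurable_ennreal])
  also have "\<dots> \<le> (\<integral>\<^sup>+t. ennreal ((norm u0)\<^sup>2 + measure lborel ?B) * indicator {0..N} t \<partial>lborel)"
    by (intro nn_integral_mono slice_bound)
  also have "\<dots> < \<infinity>"
    by (subst nn_integral_cmult_indicator) (auto simp: ennreal_mult_less_top emeasure_lborel_Icc_eq)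
  finally have "integrable lborel (\<lambda>p. indicator K p *\<^sub>R u p)"
    using m by (intro integrableI_bounded) auto
  then show "u absolutely_integrable_on K"
    unfolding set_integrable_def using m by (simp add: integrable_completion)
qed

lemma weak_evolution_provides:
  fixes a :: "'a::euclidean_space \<Rightarrow> 'a"
  assumes "L_inf a" "contraction_semigroup T" "weak_evolution (A_op a) T"
  shows "provides_generalized_solutions a T"
  unfolding provides_generalized_solutions_def
proof
  fix u0
  obtain u where u: "u \<in> borel_measurable borel"
    "\<And>t. 0 \<le> t \<Longrightarrow> AE x in lebesgue. u (t, x) = rep_L2 (T t u0) x"
    using joint_version_exists[OF assms(2)] by blast
  have "generalized_solution a (rep_L2 u0) u"
    by (rule weak_evolution_generalized_solution[OF assms joint_version_L1_loc[OF assms(2) u] u(2)])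
  with u(2) show "\<exists>u. (\<forall>t\<ge>0. AE x in lebesgue. u (t, x) = rep_L2 (T t u0) x) \<and>
      generalized_solution a (rep_L2 u0) u" by blast
qed

text \<open>Time cutoffs that drop from one to zero on \<open>[\<tau>, \<tau> + \<epsilon>]\<close>. As \<open>C\<close> does not depend on \<open>\<epsilon>\<close>, the
  integral of the absolute slope stays bounded when \<open>\<epsilon>\<close> tends to zero.\<close>

lemma time_cutoff_exists:
  obtains C :: real where "0 \<le> C"
    and "\<And>\<tau> \<epsilon>. 0 \<le> \<tau> \<Longrightarrow> 0 < \<epsilon> \<Longrightarrow> \<exists>\<theta> \<theta>'.
      \<theta> \<in> C0_inf \<and> (\<forall>t. (\<theta> has_real_derivative \<theta>' t) (at t)) \<and> continuous_on UNIV \<theta>' \<and>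
      (\<forall>t. \<bar>\<theta> t\<bar> \<le> 1) \<and> (\<forall>t\<in>{0..\<tau>}. \<theta> t = 1 \<and> \<theta>' t = 0) \<and>
      (\<forall>t\<ge>\<tau> + \<epsilon>. \<theta> t = 0 \<and> \<theta>' t = 0) \<and> (\<forall>t\<ge>0. \<bar>\<theta>' t\<bar> \<le> C / \<epsilon>)"
proof -
  define d where "d = grad smooth_step"
  have D: "(smooth_step has_real_derivative d s) (at s)" for s
  proof -
    have "(\<lambda>h. d s \<bullet> h) = (*) (d s)" by (simp add: fun_eq_iff)
    then show ?thesis
      using C_k_1_has_derivative[OF C_k_smooth_step[of "Suc 0"], of s]
      by (simp add: has_field_derivative_def d_def)
  qed
  have dc: "continuous_on UNIV d" unfolding d_def by (rule continuous_grad[OF C_k_smooth_step[of "Suc 0"]])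
  have d1: "d s = 0" if "1 \<le> s" for s
    by (rule DERIV_local_max[OF D, of 1]) (use that smooth_step_simps(2) smooth_step_bounds(2) in auto)
  have d0: "d s = 0" if "s \<le> 0" for s
    by (rule DERIV_local_min[OF D, of 1]) (use that smooth_step_simps(1) smooth_step_bounds(1) in auto)
  have "norm s \<le> 1" if "d s \<noteq> 0" for s
    using that d0[of s] d1[of s] by (cases "s \<le> 0"; cases "1 \<le> s") auto
  then obtain C where C: "0 \<le> C" "\<And>s. norm (d s) \<le> C"
    using continuous_bounded_support_bounded[OF dc] by metis
  show thesis
  proof (rule that[OF C(1)])
    fix \<tau> \<epsilon> :: real assume \<tau>: "0 \<le> \<tau>" and \<epsilon>: "0 < \<epsilon>"
    \<comment> \<open>The factor \<open>smooth_step (t + 2)\<close> cuts off at negative times and is one for \<open>t \<ge> -1\<close>.\<close>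
    define l where "l t = - (1/\<epsilon>) * t + (1 + \<tau>/\<epsilon>)" for t
    define \<theta> where "\<theta> t = smooth_step (t + 2) * smooth_step (l t)" for t
    define \<theta>' where "\<theta>' t = d (t + 2) * smooth_step (l t) + smooth_step (t + 2) * (d (l t) * (- (1/\<epsilon>)))" for t
    have l: "l t = 1 - (t - \<tau>) / \<epsilon>" for t by (simp add: l_def diff_divide_distrib)
    have l1: "1 \<le> l t" if "t \<le> \<tau>" for t
      using divide_nonpos_pos[of "t - \<tau>" \<epsilon>] that \<epsilon> by (simp add: l)
    have l0: "l t \<le> 0" if "\<tau> + \<epsilon> \<le> t" for t using that \<epsilon> by (simp add: l le_divide_eq)
    have z: "\<theta> t = 0" "\<theta>' t = 0" if "\<tau> + \<epsilon> \<le> t" for t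
      using l0[OF that] by (simp_all add: \<theta>_def \<theta>'_def smooth_step_simps d0)
    have Dl: "(l has_real_derivative - (1/\<epsilon>)) (at t)" for t
      unfolding l_def[abs_def] using \<epsilon> by (auto intro!: derivative_eq_intros)
    have "\<theta> \<in> C0_inf"
      unfolding C0_inf_iff
    proof (intro conjI allI)
      fix k
      have "C_k k (\<lambda>t. smooth_step (t + 2))" "C_k k (\<lambda>t. smooth_step (l t))"
        unfolding l_def by (intro C_k_affine C_k_smooth_step bounded_linear_ident bounded_linear_mult_right)+
      then show "C_k k \<theta>" unfolding \<theta>_def[abs_def] by (rule C_k_mult)
      have "{t. \<theta> t \<noteq> 0} \<subseteq> {-2..\<tau> + \<epsilon>}"
      proof
        fix t assume "t \<in> {t. \<theta> t \<noteq> 0}"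
        then have "\<not> t + 2 \<le> 0" "\<not> \<tau> + \<epsilon> \<le> t"
          using z(1)[of t] smooth_step_simps(1)[of "t + 2"] by (auto simp: \<theta>_def)
        then show "t \<in> {-2..\<tau> + \<epsilon>}" by simp
      qed
      then show "bounded {t. \<theta> t \<noteq> 0}" by (rule bounded_subset[OF bounded_closed_interval])
    qed
    moreover have "(\<theta> has_real_derivative \<theta>' t) (at t)" for t
    proof -
      have "((\<lambda>t. t + 2) has_real_derivative 1) (at t)" by (auto intro!: derivative_eq_intros)
      from DERIV_chain2[OF D this]
      have 1: "((\<lambda>t. smooth_step (t + 2)) has_real_derivative d (t + 2)) (at t)" by simp
      have 2: "((\<lambda>t. smooth_step (l t)) has_real_derivative d (l t) * (- (1/\<epsilon>))) (at t)"
        by (rule DERIV_chain2[OF D Dl])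
      show ?thesis
        using DERIV_mult'[OF 1 2] unfolding \<theta>_def[abs_def] \<theta>'_def by (simp only: add.commute)
    qed
    moreover have "continuous_on UNIV \<theta>'"
      unfolding \<theta>'_def[abs_def] l_def
      by (intro continuous_intros continuous_on_compose2[OF dc]
          continuous_on_compose2[OF C_k_continuous[OF C_k_smooth_step]]) auto
    moreover have "\<bar>\<theta> t\<bar> \<le> 1" for t
      unfolding \<theta>_def abs_mult by (intro mult_le_one) (auto simp: smooth_step_bounds)
    moreover have "\<theta> t = 1 \<and> \<theta>' t = 0" if "t \<in> {0..\<tau>}" for t
      using l1[of t] that by (simp add: \<theta>_def \<theta>'_def smooth_step_simps d1)
    moreover have "\<bar>\<theta>' t\<bar> \<le> C / \<epsilon>" if "0 \<le> t" for t
      using that C(2)[of "l t"] \<epsilon> by (simp add: \<theta>'_def d1 smooth_step_simps abs_mult divide_right_mono)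
    ultimately show "\<exists>\<theta> \<theta>'. \<theta> \<in> C0_inf \<and> (\<forall>t. (\<theta> has_real_derivative \<theta>' t) (at t)) \<and>
      continuous_on UNIV \<theta>' \<and> (\<forall>t. \<bar>\<theta> t\<bar> \<le> 1) \<and> (\<forall>t\<in>{0..\<tau>}. \<theta> t = 1 \<and> \<theta>' t = 0) \<and>
      (\<forall>t\<ge>\<tau> + \<epsilon>. \<theta> t = 0 \<and> \<theta>' t = 0) \<and> (\<forall>t\<ge>0. \<bar>\<theta>' t\<bar> \<le> C / \<epsilon>)"
      using z by blast
  qed
qed

lemma product_test_function:
  fixes \<theta> :: "real \<Rightarrow> real" and \<phi> :: "'a::euclidean_space \<Rightarrow> real"
  assumes "\<theta> \<in> C0_inf" "\<phi> \<in> C0_inf"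
  shows "(\<lambda>p. \<theta> (fst p) * \<phi> (snd p)) \<in> C0_inf"
  unfolding C0_inf_iff
proof (intro conjI allI)
  fix k
  have "C_k k (\<lambda>p::real \<times> 'a. \<theta> (fst p + 0))" "C_k k (\<lambda>p::real \<times> 'a. \<phi> (snd p + 0))"
    using assms by (intro C_k_affine bounded_linear_fst bounded_linear_snd; simp add: C0_inf_iff)+
  then show "C_k k (\<lambda>p::real \<times> 'a. \<theta> (fst p) * \<phi> (snd p))" by (simp add: C_k_mult)
  have "bounded ({t. \<theta> t \<noteq> 0} \<times> {x. \<phi> x \<noteq> 0})"
    using assms by (intro bounded_Times) (auto simp: C0_inf_iff)
  then show "bounded {p. \<theta> (fst p) * \<phi> (snd p) \<noteq> 0}" by (rule bounded_subset) auto
qed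

text \<open>Test functions \<open>\<theta>(t) \<phi>(x)\<close> with \<open>\<theta>\<close> approaching the indicator function of \<open>[0, \<tau>]\<close> turn the
  space-time identity into the evolution equation integrated over \<open>[0, \<tau>]\<close>.\<close>

lemma generalized_solution_integrated:
  fixes a :: "'a::euclidean_space \<Rightarrow> 'a"
  assumes a: "L_inf a" and T: "contraction_semigroup T"
    and gs: "generalized_solution a (rep_L2 u0) u"
    and slice: "\<And>t. 0 \<le> t \<Longrightarrow> AE x in lebesgue. u (t, x) = rep_L2 (T t u0) x"
    and \<phi>: "\<phi> \<in> C0_inf" and \<tau>: "0 \<le> \<tau>"
  shows "T \<tau> u0 \<bullet> abs_L2 \<phi> - u0 \<bullet> abs_L2 \<phi>
    = integral {0..\<tau>} (\<lambda>t. T t u0 \<bullet> abs_L2 (transport a \<phi>))"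
proof -
  obtain C where C: "0 \<le> C" and cutoff: "\<And>\<tau> \<epsilon>. 0 \<le> \<tau> \<Longrightarrow> 0 < \<epsilon> \<Longrightarrow> \<exists>\<theta> \<theta>'.
      \<theta> \<in> C0_inf \<and> (\<forall>t. (\<theta> has_real_derivative \<theta>' t) (at t)) \<and> continuous_on UNIV \<theta>' \<and>
      (\<forall>t. \<bar>\<theta> t\<bar> \<le> 1) \<and> (\<forall>t\<in>{0..\<tau>}. \<theta> t = 1 \<and> \<theta>' t = 0) \<and>
      (\<forall>t\<ge>\<tau> + \<epsilon>. \<theta> t = 0 \<and> \<theta>' t = 0) \<and> (\<forall>t\<ge>0. \<bar>\<theta>' t\<bar> \<le> C / \<epsilon>)"
    by (rule time_cutoff_exists) blast
  note \<phi>1 = C0_inf_imp_C0_1[OF \<phi>]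
  define p where "p t = T t u0 \<bullet> abs_L2 \<phi>" for t
  define r where "r t = T t u0 \<bullet> abs_L2 (transport a \<phi>)" for t
  have pc: "continuous_on {0..} p" and rc: "continuous_on {0..} r"
    unfolding p_def[abs_def] r_def[abs_def]
    by (intro continuous_intros contraction_semigroup_continuous[OF T])+
  define M where "M = norm u0 * norm (abs_L2 (transport a \<phi>))"
  have M: "\<bar>r t\<bar> \<le> M" if "0 \<le> t" for t
    unfolding r_def M_def using T that
    by (intro order_trans[OF Cauchy_Schwarz_ineq2] mult_right_mono) (auto simp: contraction_semigroup_def)
  define D where "D = p \<tau> - p 0 - integral {0..\<tau>} r"
  \<comment> \<open>Since \<open>\<theta>'\<close> has integral \<open>-1\<close> over \<open>[\<tau>, \<tau> + \<epsilon>]\<close>, it acts there like minus the evaluation at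
    \<open>\<tau>\<close>, up to the oscillation \<open>w\<close> of \<open>p\<close>.\<close>
  have est: "\<bar>D\<bar> \<le> C * w + M * \<epsilon>"
    if \<epsilon>: "0 < \<epsilon>" and w: "\<And>t. t \<in> {\<tau>..\<tau> + \<epsilon>} \<Longrightarrow> \<bar>p t - p \<tau>\<bar> \<le> w" for \<epsilon> w
  proof -
    obtain \<theta> \<theta>' where \<theta>: "\<theta> \<in> C0_inf" "\<And>t. (\<theta> has_real_derivative \<theta>' t) (at t)"
      "continuous_on UNIV \<theta>'" "\<And>t. \<bar>\<theta> t\<bar> \<le> 1" "\<And>t. t \<in> {0..\<tau>} \<Longrightarrow> \<theta> t = 1 \<and> \<theta>' t = 0"
      "\<And>t. \<tau> + \<epsilon> \<le> t \<Longrightarrow> \<theta> t = 0 \<and> \<theta>' t = 0" "\<And>t. 0 \<le> t \<Longrightarrow> \<bar>\<theta>' t\<bar> \<le> C / \<epsilon>"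
      using cutoff[OF \<tau> \<epsilon>] by blast
    define S where "S = \<tau> + \<epsilon>"
    define f where "f p = \<theta> (fst p) * \<phi> (snd p)" for p
    have f: "f \<in> C0_inf" unfolding f_def[abs_def] by (rule product_test_function[OF \<theta>(1) \<phi>])
    obtain R0 where R0: "\<And>p. f p \<noteq> 0 \<Longrightarrow> norm p \<le> R0" using f by (auto simp: C0_inf_iff bounded_iff)
    define R where "R = max R0 S"
    have R: "S \<le> R" "\<And>p. f p \<noteq> 0 \<Longrightarrow> norm p \<le> R" using R0 by (auto simp: R_def le_max_iff_disj)
    define q where "q t = \<theta>' t * p t + \<theta> t * r t" for t
    have td: "time_deriv f (t, x) = \<theta>' t * \<phi> x" for t x
    proof (rule DERIV_unique[OF test_function_has_derivative(1)[OF f]])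
      show "((\<lambda>s. f (s, x)) has_real_derivative \<theta>' t * \<phi> x) (at t)"
        unfolding f_def fst_conv snd_conv by (rule DERIV_cmult_right[OF \<theta>(2)])
    qed
    have tr: "transport a (slice f t) = (\<lambda>x. \<theta> t * (a x \<bullet> grad \<phi> x))" for t
      by (simp add: f_def grad_cmult[OF \<phi>1])
    have q: "T t u0 \<bullet> abs_L2 (slice (time_deriv f) t) + T t u0 \<bullet> abs_L2 (transport a (slice f t)) = q t" for t
      by (simp add: td tr q_def p_def r_def scaleR_abs_L2[symmetric] C0_1_square_integrable[OF \<phi>1]
          square_integrable_transport[OF a \<phi>1])
    then have q_eq: "q = (\<lambda>t. T t u0 \<bullet> abs_L2 (slice (time_deriv f) t)
        + T t u0 \<bullet> abs_L2 (transport a (slice f t)))"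
      by (simp only:)
    have u: "L1_loc ({0..} \<times> UNIV) u" using gs by (simp add: generalized_solution_def)
    have qI: "(q has_integral (LINT p:{0<..} \<times> UNIV|lebesgue. (case p of (t, x) \<Rightarrow>
        u (t, x) * deriv (\<lambda>s. f (s, x)) t + u (t, x) * (a x \<bullet> grad (\<lambda>y. f (t, y)) x)))) {0..R}"
      unfolding q_eq by (rule space_time_pairing[OF a f u slice R(2)])
    have "(LINT p:{0<..} \<times> UNIV|lebesgue. (case p of (t, x) \<Rightarrow>
        u (t, x) * deriv (\<lambda>s. f (s, x)) t + u (t, x) * (a x \<bullet> grad (\<lambda>y. f (t, y)) x)))
        + (LINT x|lebesgue. rep_L2 u0 x * f (0, x)) = 0"
      using gs f unfolding generalized_solution_def by blast
    moreover have "(LINT x|lebesgue. rep_L2 u0 x * f (0, x)) = p 0"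
    proof -
      have "f (0, x) = \<phi> x" for x using \<theta>(5)[of 0] \<tau> by (simp add: f_def)
      moreover have "T 0 u0 = u0" using T by (simp add: contraction_semigroup_def C0_semigroup_def)
      ultimately show ?thesis by (simp add: p_def inner_abs_L2_right[OF C0_1_square_integrable[OF \<phi>1]])
    qed
    ultimately have qI': "integral {0..R} q = - p 0"
      using integral_unique[OF qI] by (simp only: eq_neg_iff_add_eq_0)
    have \<theta>c: "continuous_on UNIV \<theta>" using \<theta>(1) C_k_continuous[of 0 \<theta>] by (simp add: C0_inf_iff)
    note cont = continuous_on_subset[OF \<theta>(3) subset_UNIV] continuous_on_subset[OF \<theta>c subset_UNIV]
      continuous_on_subset[OF pc] continuous_on_subset[OF rc]
    have S: "\<tau> \<le> S" "0 \<le> S" using \<epsilon> \<tau> by (auto simp: S_def)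
    have qi: "q integrable_on {b..c}" if "0 \<le> b" for b c
      unfolding q_def[abs_def] using that
      by (intro integrable_continuous_real continuous_intros cont) auto
    have "integral {0..R} q = integral {0..\<tau>} q + (integral {\<tau>..S} q + integral {S..R} q)"
      using Henstock_Kurzweil_Integration.integral_combine[of 0 \<tau> R q]
        Henstock_Kurzweil_Integration.integral_combine[of \<tau> S R q] qi \<tau> S R(1) by simp
    also have "integral {0..\<tau>} q = integral {0..\<tau>} r"
      by (rule integral_cong) (simp add: q_def \<theta>(5))
    also have "integral {S..R} q = integral {S..R} (\<lambda>t. 0)"
      by (rule integral_cong) (simp add: q_def \<theta>(6) S_def)
    also have "integral {\<tau>..S} q
        = integral {\<tau>..S} (\<lambda>t. (\<theta>' t * (p t - p \<tau>) + \<theta> t * r t) + p \<tau> * \<theta>' t)"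
      by (rule integral_cong) (simp add: q_def algebra_simps)
    also have "\<dots> = integral {\<tau>..S} (\<lambda>t. \<theta>' t * (p t - p \<tau>) + \<theta> t * r t) + p \<tau> * integral {\<tau>..S} \<theta>'"
      using \<tau> by (subst Henstock_Kurzweil_Integration.integral_add)
        (auto intro!: integrable_continuous_real continuous_intros cont)
    also have "integral {\<tau>..S} \<theta>' = \<theta> S - \<theta> \<tau>"
      using S(1) \<theta>(2) by (intro integral_unique fundamental_theorem_of_calculus)
        (auto simp: has_real_derivative_iff_has_vector_derivative[symmetric]
          intro: has_field_derivative_at_within)
    also have "\<theta> S - \<theta> \<tau> = - 1" using \<theta>(5)[of \<tau>] \<theta>(6)[of S] \<tau> by (simp add: S_def)
    finally have D_eq: "D = integral {\<tau>..S} (\<lambda>t. \<theta>' t * (p t - p \<tau>) + \<theta> t * r t)"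
      by (simp add: qI' D_def)
    have "norm (integral {\<tau>..S} (\<lambda>t. \<theta>' t * (p t - p \<tau>) + \<theta> t * r t)) \<le> (C / \<epsilon> * w + M) * (S - \<tau>)"
    proof (rule integral_bound[OF S(1)])
      show "continuous_on {\<tau>..S} (\<lambda>t. \<theta>' t * (p t - p \<tau>) + \<theta> t * r t)"
        using \<tau> by (intro continuous_intros cont) auto
      fix t assume t: "t \<in> {\<tau>..S}"
      then have t0: "0 \<le> t" using \<tau> by simp
      have "\<bar>\<theta>' t * (p t - p \<tau>)\<bar> \<le> C / \<epsilon> * w"
        unfolding abs_mult using \<theta>(7)[OF t0] w[of t] t C \<epsilon>
        by (intro mult_mono) (auto simp: S_def)
      moreover have "\<bar>\<theta> t * r t\<bar> \<le> 1 * M"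
        unfolding abs_mult using \<theta>(4)[of t] M[OF t0] by (intro mult_mono) auto
      ultimately show "norm (\<theta>' t * (p t - p \<tau>) + \<theta> t * r t) \<le> C / \<epsilon> * w + M" by simp
    qed
    also have "\<dots> = C * w + M * \<epsilon>" using \<epsilon> by (simp add: S_def field_simps)
    finally show ?thesis by (simp add: D_eq)
  qed
  have "\<bar>D\<bar> \<le> 0"
  proof (rule field_le_epsilon)
    fix e :: real assume e: "0 < e"
    define L where "L = C * norm (abs_L2 \<phi>) + M"
    have L: "0 \<le> L" using C by (auto simp: L_def M_def)
    define e' where "e' = e / (1 + L)"
    have e': "0 < e'" "e' * L \<le> e" using e L by (auto simp: e'_def field_simps add_pos_nonneg)
    obtain d where d: "0 < d"
      "\<And>s t. 0 \<le> s \<Longrightarrow> 0 \<le> t \<Longrightarrow> \<bar>s - t\<bar> < d \<Longrightarrow> norm (T s u0 - T t u0) < e'"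
      using contraction_semigroup_modulus[OF T e'(1)] by blast
    define \<epsilon> where "\<epsilon> = min e' (d/2)"
    have \<epsilon>: "0 < \<epsilon>" "\<epsilon> \<le> e'" "\<epsilon> < d" using e' d(1) by (auto simp: \<epsilon>_def)
    have "\<bar>p t - p \<tau>\<bar> \<le> e' * norm (abs_L2 \<phi>)" if "t \<in> {\<tau>..\<tau> + \<epsilon>}" for t
    proof -
      have "norm (T t u0 - T \<tau> u0) \<le> e'" using d(2)[of t \<tau>] that \<epsilon> \<tau> by simp
      then show ?thesis
        unfolding p_def inner_diff_left[symmetric]
        by (intro order_trans[OF Cauchy_Schwarz_ineq2] mult_right_mono) auto
    qed
    from est[OF \<epsilon>(1) this] have "\<bar>D\<bar> \<le> C * (e' * norm (abs_L2 \<phi>)) + M * \<epsilon>" .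
    also have "\<dots> \<le> C * (e' * norm (abs_L2 \<phi>)) + M * e'"
      using \<epsilon>(2) by (simp add: M_def mult_left_mono)
    also have "\<dots> = e' * L" by (simp add: L_def algebra_simps)
    finally show "\<bar>D\<bar> \<le> 0 + e" using e'(2) by simp
  qed
  then show ?thesis
    using T by (simp add: D_def p_def[abs_def] r_def[abs_def] contraction_semigroup_def C0_semigroup_def)
qed

text \<open>The pairs \<open>(f, g)\<close> that satisfy the integrated equation form a closed set \<open>Z\<close>. It contains the
  smooth test functions with their images, hence by mollification the graph of \<open>A0\<close>, hence that of
  its closure.\<close>

lemma provides_weak_evolution:
  fixes a :: "'a::euclidean_space \<Rightarrow> 'a"
  assumes a: "L_inf a" and T: "contraction_semigroup T" and prov: "provides_generalized_solutions a T"
  shows "weak_evolution (A_op a) T"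
  unfolding weak_evolution_def
proof (intro allI ballI, clarify)
  fix u0 t f g assume fg: "(f, g) \<in> A_op a" and t: "(0::real) \<le> t"
  have cont: "continuous_on {0..} (\<lambda>s. T s u0)" by (rule contraction_semigroup_continuous[OF T])
  define V where "V \<tau> = integral {0..\<tau>} (\<lambda>s. T s u0)" for \<tau>
  have V: "integral {0..\<tau>} (\<lambda>s. T s u0 \<bullet> y) = V \<tau> \<bullet> y" for \<tau> y
  proof -
    have "(\<lambda>s. T s u0) integrable_on {0..\<tau>}"
      by (intro integrable_continuous_real continuous_on_subset[OF cont]) auto
    from integral_linear[OF this bounded_linear_inner_left[of y]]
    show ?thesis by (simp add: o_def V_def)
  qed
  obtain u where u: "\<And>t. 0 \<le> t \<Longrightarrow> AE x in lebesgue. u (t, x) = rep_L2 (T t u0) x"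
    "generalized_solution a (rep_L2 u0) u"
    using prov unfolding provides_generalized_solutions_def by blast
  define Z where "Z = {p. \<forall>\<tau>\<in>{0..}. (T \<tau> u0 - u0) \<bullet> fst p = V \<tau> \<bullet> snd p}"
  have "Z = (\<Inter>\<tau>\<in>{0..}. {p. (T \<tau> u0 - u0) \<bullet> fst p = V \<tau> \<bullet> snd p})" by (auto simp: Z_def)
  moreover have "closed \<dots>" by (intro closed_INT ballI closed_Collect_eq continuous_intros)
  ultimately have Zc: "closed Z" by simp
  have smooth: "(abs_L2 \<phi>, abs_L2 (transport a \<phi>)) \<in> Z" if "\<phi> \<in> C0_inf" for \<phi>
    using generalized_solution_integrated[OF a T u(2,1) that]
    by (simp add: Z_def V inner_diff_left)
  have "A0 a \<subseteq> Z"
  proof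
    fix p assume "p \<in> A0 a"
    then obtain \<phi> where \<phi>: "\<phi> \<in> C0_1" "p = (abs_L2 \<phi>, abs_L2 (transport a \<phi>))"
      by (auto simp: A0_def)
    obtain \<psi> R where \<psi>: "\<And>k. \<psi> k \<in> C0_inf" "(\<lambda>k. abs_L2 (\<psi> k)) \<longlonglongrightarrow> abs_L2 \<phi>"
      "(\<lambda>k. abs_L2 (transport a (\<psi> k))) \<longlonglongrightarrow> abs_L2 (transport a \<phi>)"
      and "\<And>k x. grad (\<psi> k) x \<noteq> 0 \<Longrightarrow> x \<in> cball 0 R" "\<And>x. grad \<phi> x \<noteq> 0 \<Longrightarrow> x \<in> cball 0 R"
      by (rule C0_1_approximation_in_graph[OF a \<phi>(1)]) blast
    show "p \<in> Z"
      using closed_sequentially[OF Zc, of "\<lambda>k. (abs_L2 (\<psi> k), abs_L2 (transport a (\<psi> k)))" p]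
        smooth[OF \<psi>(1)] tendsto_Pair[OF \<psi>(2,3)] by (simp add: \<phi>(2))
  qed
  then have "A_op a \<subseteq> Z" unfolding A_op_def by (rule closure_minimal[OF _ Zc])
  then have "(f, g) \<in> Z" using fg by blast
  then have "(T \<tau> u0 - u0) \<bullet> f = V \<tau> \<bullet> g" if "0 \<le> \<tau>" for \<tau> using that by (simp add: Z_def)
  then have eq: "T \<tau> u0 \<bullet> f = u0 \<bullet> f + integral {0..\<tau>} (\<lambda>s. T s u0 \<bullet> g)" if "0 \<le> \<tau>" for \<tau>
    using that unfolding V inner_diff_left by (metis add.commute diff_add_cancel)
  have "continuous_on {0..t + 1} (\<lambda>s. T s u0 \<bullet> g)"
    by (intro continuous_intros continuous_on_subset[OF cont]) auto
  from integral_has_real_derivative[OF this, of t]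
  have "((\<lambda>\<tau>. integral {0..\<tau>} (\<lambda>s. T s u0 \<bullet> g)) has_real_derivative T t u0 \<bullet> g) (at t within {0..t + 1})"
    using t by simp
  from DERIV_add[OF DERIV_const this, of "u0 \<bullet> f"]
  have "((\<lambda>\<tau>. u0 \<bullet> f + integral {0..\<tau>} (\<lambda>s. T s u0 \<bullet> g)) has_real_derivative T t u0 \<bullet> g) (at t within {0..t + 1})"
    by simp
  moreover have "at t within {0..t + 1} = at t within {0..}"
    by (rule at_within_nhd[where S = "{..<t + 1}"]) auto
  ultimately have "((\<lambda>\<tau>. u0 \<bullet> f + integral {0..\<tau>} (\<lambda>s. T s u0 \<bullet> g)) has_real_derivative T t u0 \<bullet> g) (at t within {0..})"
    by simp
  then show "((\<lambda>s. T s u0 \<bullet> f) has_real_derivative T t u0 \<bullet> g) (at t within {0..})"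
    by (rule has_field_derivative_transform_within[where d = 1]) (use t eq in auto)
qed

lemma provides_iff_weak_evolution:
  "L_inf a \<Longrightarrow> contraction_semigroup T \<Longrightarrow>
    provides_generalized_solutions a T \<longleftrightarrow> weak_evolution (A_op a) T"
  using provides_weak_evolution weak_evolution_provides by blast

theorem theorem6p2:
  fixes a :: "real ^ 'n \<Rightarrow> real ^ 'n"
  assumes "L_inf a"
    and "div_free a"
  shows "(\<forall>T T'. contraction_semigroup T \<and> provides_generalized_solutions a T \<and>
                 contraction_semigroup T' \<and> provides_generalized_solutions a T'
                 \<longrightarrow> (\<forall>t\<ge>0. T t = T' t))
         \<longleftrightarrow> maximal_skew_symmetric (A_op a)"
  using unique_weak_evolution_iff_maximal[OF skew_symmetric_A_op[OF assms] closed_A_op]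
    provides_iff_weak_evolution[OF assms(1)]
  by (metis (no_types, lifting))

end
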